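(* Let $N\ge1$ be an integer, $0<\alpha<2$, $H=(H_1,\ldots,H_N)\in(0,1)^N$, and let $Z^H=\{Z^H(t),\,t\in\mathbb{R}^N\}$ be the harmonizable fractional $\alpha$-stable sheet with index $H$. Let $(\mathcal{D}_n)_{n\in\mathbb{N}}$ be an increasing sequence of finite subsets of $\mathbb{Z}^N\times\mathbb{Z}^N$ which converges to $\mathbb{Z}^N\times\mathbb{Z}^N$, i.e. $\mathcal{D}_n\subset\mathcal{D}_{n+1}$ for every $n\in\mathbb{N}$ and $\bigcup_{n\in\mathbb{N}}\mathcal{D}_n=\mathbb{Z}^N\times\mathbb{Z}^N$. For each $n\in\mathbb{N}$ and $t\in\mathbb{R}^N$, let $$U_n(t)=\mathrm{Re}\sum_{(J,K)\in\mathcal{D}_n}2^{-\langle J,H\rangle}\,\epsilon_{J,K}\prod_{l=1}^N\big\{\psi^{H_l}(2^{j_l}t_l-k_l)-\psi^{H_l}(-k_l)\big\}.$$ Then, for each $t\in\mathbb{R}^N$, $U_n(t)$ converges in probability to $Z^H(t)$ as $n\to\infty$.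
   Context: $\widetilde M_\alpha$ is a complex-valued rotationally invariant $\alpha$-stable random measure on $\mathbb{R}^N$ with Lebesgue control measure: the integral $f\mapsto\int_{\mathbb{R}^N} f\,d\widetilde M_\alpha$ is complex-linear on the complex space $L^\alpha(\mathbb{R}^N)$ and $\mathbb{E}\exp\big(i\,\mathrm{Re}\int f\,d\widetilde M_\alpha\big)=\exp\big(-\int_{\mathbb{R}^N}|f(\lambda)|^\alpha d\lambda\big)$. The harmonizable fractional $\alpha$-stable sheet is $$Z^H(t)=\mathrm{Re}\int_{\mathbb{R}^N}\prod_{j=1}^N\frac{e^{it_j\lambda_j}-1}{|\lambda_j|^{H_j+1/\alpha}}\,\widetilde M_\alpha(d\lambda).$$ $\psi$ is a fixed Lemarié–Meyer mother wavelet: $\psi$ is real-valued and in the Schwartz class $S(\mathbb{R})$; its Fourier transform $\widehat\psi(\xi)=(2\pi)^{-1/2}\int_{\mathbb{R}}e^{-is\xi}\psi(s)\,ds$ is supported in $\{\xi\in\mathbb{R}:\frac{2\pi}{3}\le|\xi|\le\frac{8\pi}{3}\}$; and $\{2^{j/2}\psi(2^j\cdot-k):(j,k)\in\mathbb{Z}^2\}$ is an orthonormal basis of $L^2(\mathbb{R})$. For $v\in(0,1)$, $\psi^v(y)=\int_{\mathbb{R}}e^{iy\eta}\,\dfrac{\widehat\psi(\eta)}{|\eta|^{v+1/\alpha}}\,d\eta$ for $y\in\mathbb{R}$ (a real-valued function in $S(\mathbb{R})$). For $(j,k)\in\mathbb{Z}^2$, $\widehat\psi_{\alpha,j,k}(\xi)=2^{-j/\alpha}e^{-ik2^{-j}\xi}\widehat\psi(2^{-j}\xi)$.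 For $J=(j_1,\ldots,j_N)$, $K=(k_1,\ldots,k_N)\in\mathbb{Z}^N$, $\widehat\Psi_{\alpha,J,K}(\lambda)=\prod_{l=1}^N\widehat\psi_{\alpha,j_l,k_l}(\lambda_l)$ and $$\epsilon_{J,K}=\int_{\mathbb{R}^N}\overline{\widehat\Psi_{\alpha,J,K}(\lambda)}\,\widetilde M_\alpha(d\lambda),$$ with the same random measure $\widetilde M_\alpha$ as in the definition of $Z^H$. Also $\langle J,H\rangle=\sum_{l=1}^N j_lH_l$. *)

theory Defs
  imports "HOL-Probability.Probability"
begin

text \<open>Elements of \<open>L^p\<close> are represented by Borel functions, not by almost-everywhere classes.
  Every exponent \<open>p > 0\<close> is allowed, so this need not be a normed space.\<close>

definition Lspace :: "real \<Rightarrow> ('a::euclidean_space \<Rightarrow> complex) set" where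
  "Lspace p = {f \<in> borel_measurable borel. integrable lborel (\<lambda>x. norm (f x) powr p)}"

text \<open>A complex rotationally invariant \<open>\<alpha>\<close>-stable random measure on a Euclidean space with
  Lebesgue control measure is given through its stochastic integral \<open>I\<close>: the random variable
  \<open>I f\<close> is the integral of \<open>f\<close>, and the random measure of a Borel set of finite Lebesgue
  measure is \<open>I\<close> of its indicator function. Random variables are identified only up to null sets, so
  linearity holds almost surely, with an exceptional set depending on \<open>a, b, f, g\<close>.\<close>

locale rot_inv_stable_random_measure = prob_space M
  for M :: "'w measure"
    and \<alpha> :: real
    and I :: "('a::euclidean_space \<Rightarrow> complex) \<Rightarrow> 'w \<Rightarrow> complex" +
  assumes integral_random_variable:
      "f \<in> Lspace \<alpha> \<Longrightarrow> I f \<in> borel_measurable M"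
    and integral_linear:
      "f \<in> Lspace \<alpha> \<Longrightarrow> g \<in> Lspace \<alpha> \<Longrightarrow>
        AE \<omega> in M. I (\<lambda>x. a * f x + b * g x) \<omega> = a * I f \<omega> + b * I g \<omega>"
    and integral_char:
      "f \<in> Lspace \<alpha> \<Longrightarrow>
        (LINT \<omega>|M. exp (\<i> * of_real (Re (I f \<omega>)))) =
          of_real (exp (- (LINT x|lborel. norm (f x) powr \<alpha>)))"

text \<open>The integrand below is set to \<open>0\<close> where some \<open>x $ j = 0\<close> (a Lebesgue null set), by the
  convention \<open>x / 0 = 0\<close>.\<close>

definition harmonizable_sheet ::
    "((real ^ 'n \<Rightarrow> complex) \<Rightarrow> 'w \<Rightarrow> complex) \<Rightarrow> real \<Rightarrow> real ^ 'n \<Rightarrow> real ^ 'n \<Rightarrow> 'w \<Rightarrow> real" where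
  "harmonizable_sheet I \<alpha> H t \<omega> =
     Re (I (\<lambda>x. \<Prod>j\<in>UNIV. (exp (\<i> * of_real (t $ j * x $ j)) - 1) /
                        of_real (\<bar>x $ j\<bar> powr (H $ j + 1 / \<alpha>))) \<omega>)"

definition schwartz :: "(real \<Rightarrow> real) \<Rightarrow> bool" where
  "schwartz f \<longleftrightarrow>
     (\<forall>n x. (deriv ^^ n) f differentiable (at x)) \<and>
     (\<forall>m n. bounded (range (\<lambda>x. x ^ m * (deriv ^^ n) f x)))"

definition fourier :: "(real \<Rightarrow> real) \<Rightarrow> real \<Rightarrow> complex" where
  "fourier f \<xi> = of_real ((2 * pi) powr (- (1/2))) *
     (LINT s|lborel. exp (- (\<i> * of_real (s * \<xi>))) * of_real (f s))"

definition orthonormal_basis_L2 :: "('i \<Rightarrow> real \<Rightarrow> complex) \<Rightarrow> bool" where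
  "orthonormal_basis_L2 e \<longleftrightarrow>
     (\<forall>i. e i \<in> Lspace 2) \<and>
     (\<forall>i i'. (LINT x|lborel. e i x * cnj (e i' x)) = (if i = i' then 1 else 0)) \<and>
     (\<forall>f\<in>Lspace 2. \<forall>\<epsilon>>0. \<exists>F c. finite F \<and>
        (LINT x|lborel. (norm (f x - (\<Sum>i\<in>F. c i * e i x)))\<^sup>2) < \<epsilon>)"

text \<open>Since the annulus is closed, the support condition amounts to vanishing outside it.\<close>

definition lemarie_meyer_wavelet :: "(real \<Rightarrow> real) \<Rightarrow> bool" where
  "lemarie_meyer_wavelet \<psi> \<longleftrightarrow>
     schwartz \<psi> \<and>
     (\<forall>\<xi>. fourier \<psi> \<xi> \<noteq> 0 \<longrightarrow> 2 * pi / 3 \<le> \<bar>\<xi>\<bar> \<and> \<bar>\<xi>\<bar> \<le> 8 * pi / 3) \<and>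
     orthonormal_basis_L2 (\<lambda>(j::int, k::int) x.
       of_real (2 powr (of_int j / 2) * \<psi> (2 powi j * x - of_int k)))"

text \<open>For a real-valued \<open>\<psi>\<close> the following function takes real values only; it is kept
  complex-valued so that its definition is literally the Fourier integral.\<close>

definition psi_frac :: "(real \<Rightarrow> real) \<Rightarrow> real \<Rightarrow> real \<Rightarrow> real \<Rightarrow> complex" where
  "psi_frac \<psi> \<alpha> v y =
     (LINT \<eta>|lborel. exp (\<i> * of_real (y * \<eta>)) * (fourier \<psi> \<eta> / of_real (\<bar>\<eta>\<bar> powr (v + 1 / \<alpha>))))"

definition psi_hat :: "(real \<Rightarrow> real) \<Rightarrow> real \<Rightarrow> int \<Rightarrow> int \<Rightarrow> real \<Rightarrow> complex" where
  "psi_hat \<psi> \<alpha> j k \<xi> =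
     of_real (2 powr (- of_int j / \<alpha>)) *
     exp (- (\<i> * of_real (of_int k * 2 powi (- j) * \<xi>))) * fourier \<psi> (2 powi (- j) * \<xi>)"

definition Psi_hat ::
    "(real \<Rightarrow> real) \<Rightarrow> real \<Rightarrow> int ^ 'n \<Rightarrow> int ^ 'n \<Rightarrow> real ^ 'n \<Rightarrow> complex" where
  "Psi_hat \<psi> \<alpha> J K x = (\<Prod>l\<in>UNIV. psi_hat \<psi> \<alpha> (J $ l) (K $ l) (x $ l))"

definition wavelet_coeff ::
    "((real ^ 'n \<Rightarrow> complex) \<Rightarrow> 'w \<Rightarrow> complex) \<Rightarrow> (real \<Rightarrow> real) \<Rightarrow> real \<Rightarrow>
     int ^ 'n \<Rightarrow> int ^ 'n \<Rightarrow> 'w \<Rightarrow> complex" where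
  "wavelet_coeff I \<psi> \<alpha> J K = I (\<lambda>x. cnj (Psi_hat \<psi> \<alpha> J K x))"

definition wavelet_partial_sum ::
    "((real ^ 'n \<Rightarrow> complex) \<Rightarrow> 'w \<Rightarrow> complex) \<Rightarrow> (real \<Rightarrow> real) \<Rightarrow> real \<Rightarrow> real ^ 'n \<Rightarrow>
     ((int ^ 'n) \<times> (int ^ 'n)) set \<Rightarrow> real ^ 'n \<Rightarrow> 'w \<Rightarrow> real" where
  "wavelet_partial_sum I \<psi> \<alpha> H D t \<omega> =
     Re (\<Sum>(J, K)\<in>D.
       of_real (2 powr (- (\<Sum>l\<in>UNIV. of_int (J $ l) * H $ l))) *
       wavelet_coeff I \<psi> \<alpha> J K \<omega> *
       (\<Prod>l\<in>UNIV. (psi_frac \<psi> \<alpha> (H $ l) (2 powi (J $ l) * t $ l - of_int (K $ l)) -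
                   psi_frac \<psi> \<alpha> (H $ l) (- of_int (K $ l)))))"

definition converges_in_probability ::
    "'w measure \<Rightarrow> (nat \<Rightarrow> 'w \<Rightarrow> real) \<Rightarrow> ('w \<Rightarrow> real) \<Rightarrow> bool" where
  "converges_in_probability M X Y \<longleftrightarrow>
     (\<forall>\<epsilon>>0. (\<lambda>n. measure M {\<omega> \<in> space M. \<bar>X n \<omega> - Y \<omega>\<bar> > \<epsilon>}) \<longlonglongrightarrow> 0)"

end

theory Submission
  imports Defs
begin

text \<open>
  By linearity and the form of the characteristic function, \<open>U\<^sub>n(t) - Z\<^sup>H(t)\<close> is almost surely the
  real part of the integral of \<open>S\<^sub>n - F\<close>, where \<open>F\<close> is the kernel of the sheet and \<open>S\<^sub>n\<close> a finite
  partial sum of its expansion in the functions conjugate to \<open>Psi_hat\<close>. Averaging the characteristic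
  function over a Gaussian frequency shows that it tends to \<open>0\<close> in probability as soon as
  \<open>\<integral> \<bar>S\<^sub>n - F\<bar>\<^sup>\<alpha> \<longlonglongrightarrow> 0\<close>.

  Kernel and expansion factorise over the coordinates. In one variable, the Schwartz decay of \<open>\<psi>\<close> and
  the cancellation at coarse scales show that the series converges absolutely and is dominated by
  \<open>C \<bar>x\<bar> powr (- v - 1 / \<alpha>) * min 1 \<bar>x\<bar>\<close>, whose power \<open>\<alpha>\<close> is integrable; so dominated
  convergence applies once the pointwise sum is known to be the kernel almost everywhere.
  Since \<open>fourier \<psi>\<close> is supported in an annulus, for \<open>x\<close> in a fixed annulus the series only sees the kernel
  on a larger one, where it may be replaced by a twice differentiable function \<open>u\<close> of compact support.
  The transform of \<open>u\<close> is then square integrable, and transporting its expansion in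
  the wavelet basis back by the Plancherel identity gives the expansion of \<open>u\<close>.
\<close>

section \<open>The Fourier transform on the line\<close>

text \<open>The wavelets form a basis of L^2, while convergence is needed in
  \<open>Lspace \<alpha>\<close>; and for t \<noteq> 0 the one-variable kernel, of order |x| powr (1
  - v - 1 / \<alpha>) at 0, is not even square integrable once v + 1 / \<alpha> \<ge> 3/2. So the
  L^2 theory only identifies the value of a sum already known to converge, on annuli away from 0 and
  infinity, while the passage to the limit rests on a bound for the partial sums that is uniform
  over all finite index sets. The majorant comes from counting powers of 2: at scale j the
  coefficients summed over k are at most of order 2 powr (- j * v) * min 1 (2 powr j),
  \<open>psi_hat\<close> contributes 2 powr (- j / \<alpha>), and 2 powr j is comparable with |x|
  wherever the term is nonzero. All decay estimates have the form C / (1 + y^2): two derivatives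
  give it, and it is both integrable over the line and summable over integer shifts. The Gaussian
  average takes the place of second moments, which stable variables with \<alpha> < 2 do not have in
  general.\<close>

definition ft :: "(real \<Rightarrow> complex) \<Rightarrow> real \<Rightarrow> complex" where
  "ft f y = (LINT x|lborel. exp (- (\<i> * of_real (x * y))) * f x)"

text \<open>The constant is kept out of \<open>ft\<close>, so that \<open>ft_multiplication\<close>
  carries none and 2 pi enters only through inversion and Plancherel.\<close>

lemma fourier_eq_ft: "fourier f \<xi> = of_real ((2 * pi) powr (- (1/2))) * ft (\<lambda>x. of_real (f x)) \<xi>"
  by (simp add: fourier_def ft_def)

lemma norm_exp_ii [simp]:
  "norm (exp (\<i> * complex_of_real x)) = 1" "norm (exp (- (\<i> * complex_of_real x))) = 1"
  by (simp_all add: norm_exp_eq_Re)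

lemma borel_measurable_exp_ii [measurable]:
  "f \<in> borel_measurable M \<Longrightarrow> (\<lambda>x. exp (\<i> * complex_of_real (f x))) \<in> borel_measurable M"
  "f \<in> borel_measurable M \<Longrightarrow> (\<lambda>x. exp (- (\<i> * complex_of_real (f x)))) \<in> borel_measurable M"
  by (auto intro!: borel_measurable_continuous_on[of "\<lambda>z. exp (\<i> * complex_of_real z)"]
      borel_measurable_continuous_on[of "\<lambda>z. exp (- (\<i> * complex_of_real z))"] continuous_intros)

lemma integrable_exp_mult:
  fixes f :: "real \<Rightarrow> complex"
  assumes "integrable lborel f" and [measurable]: "g \<in> borel_measurable lborel"
  shows "integrable lborel (\<lambda>x. exp (\<i> * complex_of_real (g x)) * f x)"
    and "integrable lborel (\<lambda>x. exp (- (\<i> * complex_of_real (g x))) * f x)"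
proof -
  have [measurable]: "f \<in> borel_measurable lborel" using assms by auto
  show "integrable lborel (\<lambda>x. exp (\<i> * complex_of_real (g x)) * f x)"
    by (rule Bochner_Integration.integrable_bound[OF assms(1)]) (auto simp: norm_mult)
  show "integrable lborel (\<lambda>x. exp (- (\<i> * complex_of_real (g x))) * f x)"
    by (rule Bochner_Integration.integrable_bound[OF assms(1)]) (auto simp: norm_mult)
qed

lemma norm_ft_le: "norm (ft f y) \<le> (LINT x|lborel. norm (f x))"
  unfolding ft_def by (rule order_trans[OF integral_norm_bound]) (simp add: norm_mult)

lemma ft_measurable [measurable]:
  assumes [measurable]: "f \<in> borel_measurable borel"
  shows "ft f \<in> borel_measurable borel"
  unfolding ft_def by measurable

lemma continuous_ft:
  assumes "integrable lborel f"
  shows "continuous_on UNIV (ft f)"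
proof -
  have [measurable]: "f \<in> borel_measurable lborel" using assms by auto
  have "isCont (ft f) y" for y
    unfolding continuous_within ft_def
  proof (rule tendsto_at_iff_sequentially[THEN iffD2], intro allI impI)
    fix X :: "nat \<Rightarrow> real" assume "\<forall>i. X i \<in> UNIV - {y}" and X: "X \<longlonglongrightarrow> y"
    show "((\<lambda>z. LINT x|lborel. exp (- (\<i> * of_real (x * z))) * f x) \<circ> X)
        \<longlonglongrightarrow> (LINT x|lborel. exp (- (\<i> * of_real (x * y))) * f x)"
      unfolding comp_def
      by (rule integral_dominated_convergence[where w = "\<lambda>x. norm (f x)"])
        (use assms in \<open>auto simp: norm_mult intro!: tendsto_intros X\<close>)
  qed
  then show ?thesis by (simp add: continuous_on_eq_continuous_at)
qed

lemma integrable_prod_lborel: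
  fixes f g :: "real \<Rightarrow> complex"
  assumes f: "integrable lborel f" and g: "integrable lborel g"
  shows "integrable (lborel \<Otimes>\<^sub>M lborel) (\<lambda>(x, y). f x * g y)"
proof (rule lborel_pair.Fubini_integrable)
  have [measurable]: "f \<in> borel_measurable lborel" "g \<in> borel_measurable lborel" using f g by auto
  show "(\<lambda>(x, y). f x * g y) \<in> borel_measurable (lborel \<Otimes>\<^sub>M lborel)" by measurable
  show "integrable lborel (\<lambda>x. \<integral>y. norm (case (x, y) of (x, y) \<Rightarrow> f x * g y) \<partial>lborel)"
    using f by (simp add: norm_mult)
  show "AE x in lborel. integrable lborel (\<lambda>y. case (x, y) of (x, y) \<Rightarrow> f x * g y)"
    using g by simp
qed

text \<open>Fubini, since the kernel is symmetric in x and y. Inversion, Plancherel, the wavelet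
  coefficients of a transform and the convolution formula for \<open>psi_frac\<close> are all
  derived from this identity.\<close>

lemma ft_multiplication:
  assumes f: "integrable lborel f" and g: "integrable lborel g"
  shows "(LINT y|lborel. ft f y * g y) = (LINT x|lborel. f x * ft g x)"
proof -
  have [measurable]: "f \<in> borel_measurable lborel" "g \<in> borel_measurable lborel" using f g by auto
  have *: "integrable (lborel \<Otimes>\<^sub>M lborel) (\<lambda>(x, y). exp (- (\<i> * of_real (x * y))) * (f x * g y))"
    by (rule Bochner_Integration.integrable_bound[OF integrable_prod_lborel[OF f g]])
      (auto simp: norm_mult split: prod.splits)
  have "(LINT y|lborel. ft f y * g y)
      = (LINT y|lborel. LINT x|lborel. exp (- (\<i> * of_real (x * y))) * (f x * g y))"
    unfolding ft_def by (simp add: mult.assoc flip: integral_mult_left_zero)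
  also have "\<dots> = (LINT x|lborel. LINT y|lborel. exp (- (\<i> * of_real (x * y))) * (f x * g y))"
    by (rule lborel_pair.Fubini_integral) (use * in simp)
  also have "\<dots> = (LINT x|lborel. f x * ft g x)"
    unfolding ft_def by (simp add: mult_ac flip: integral_mult_right_zero)
  finally show ?thesis .
qed

text \<open>The phase exp (i x y) centres the transformed Gaussian at x with width 1 / n, so
  integrating f against it averages f near x: the approximate identity of
  \<open>ft_inversion\<close>.\<close>

lemma ft_gaussian:
  fixes x \<xi> :: real and n :: real
  assumes "n > 0"
  shows "ft (\<lambda>y. exp (\<i> * of_real (x * y)) * of_real (exp (- (y / n)\<^sup>2 / 2))) \<xi>
       = of_real (n * sqrt (2 * pi) * exp (- (n * (x - \<xi>))\<^sup>2 / 2))"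
proof -
  have "ft (\<lambda>y. exp (\<i> * of_real (x * y)) * of_real (exp (- (y / n)\<^sup>2 / 2))) \<xi>
      = (LINT y|lborel. exp (\<i> * of_real ((x - \<xi>) * y)) * of_real (exp (- (y / n)\<^sup>2 / 2)))"
    unfolding ft_def
    by (rule Bochner_Integration.integral_cong[OF refl], subst mult.assoc[symmetric], subst exp_add[symmetric])
      (simp add: algebra_simps)
  also have "\<dots> = n * (LINT y|lborel. exp (\<i> * of_real ((x - \<xi>) * (n * y))) * of_real (exp (- y\<^sup>2 / 2)))"
    using assms by (subst lborel_integral_real_affine[where c = n and t = 0]) (auto simp: scaleR_conv_of_real)
  also have "(LINT y|lborel. exp (\<i> * of_real ((x - \<xi>) * (n * y))) * of_real (exp (- y\<^sup>2 / 2)))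
      = sqrt (2 * pi) * char std_normal_distribution (n * (x - \<xi>))"
  proof -
    have "char std_normal_distribution u
        = (LINT y|lborel. of_real (1 / sqrt (2 * pi)) * (exp (\<i> * of_real (u * y)) * of_real (exp (- y\<^sup>2 / 2))))" for u
      unfolding char_def
      by (subst integral_density)
        (auto simp: std_normal_density_def scaleR_conv_of_real normal_density_nonneg
           intro!: Bochner_Integration.integral_cong)
    then show ?thesis
      by (simp only: integral_mult_right_zero) (simp add: ac_simps)
  qed
  finally show ?thesis by (simp add: char_std_normal_distribution)
qed

lemma integrable_gaussian: "integrable lborel (\<lambda>y::real. exp (- y\<^sup>2 / 2))"
  and integral_gaussian: "(LINT y|lborel. exp (- y\<^sup>2 / 2 :: real)) = sqrt (2 * pi)"
proof -
  have *: "exp (- y\<^sup>2 / 2) = sqrt (2 * pi) * std_normal_density y" for y :: real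
    by (simp add: std_normal_density_def)
  show "integrable lborel (\<lambda>y::real. exp (- y\<^sup>2 / 2))" unfolding * by simp
  show "(LINT y|lborel. exp (- y\<^sup>2 / 2 :: real)) = sqrt (2 * pi)" unfolding * by simp
qed

text \<open>The Gaussian factor \<open>G n\<close> widens with n. On the frequency side it tends to
  the bare exponential, with majorant |ft f|; after \<open>ft_multiplication\<close> the same
  quantity is a Gaussian average of f at the points x + z / (n + 1), where the bound B gives the
  majorant and continuity the limit.\<close>

lemma ft_inversion:
  fixes f :: "real \<Rightarrow> complex"
  assumes f: "integrable lborel f" and cont: "continuous_on UNIV f" and bdd: "\<And>x. norm (f x) \<le> B"
    and ftf: "integrable lborel (ft f)"
  shows "(LINT y|lborel. exp (\<i> * of_real (x * y)) * ft f y) = 2 * pi * f x"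
proof -
  define G where "G n y = exp (\<i> * complex_of_real (x * y)) * of_real (exp (- (y / real (Suc n))\<^sup>2 / 2))" for n y
  have [measurable]: "f \<in> borel_measurable lborel" "ft f \<in> borel_measurable lborel" using f ftf by auto
  have Gint: "integrable lborel (G n)" for n
  proof -
    have "integrable lborel (\<lambda>y. exp (- (y / real (Suc n))\<^sup>2 / 2))"
      using lborel_integrable_real_affine[OF integrable_gaussian, of "1 / real (Suc n)" 0] by simp
    then show ?thesis unfolding G_def
      by (rule integrable_exp_mult(1)[OF integrable_of_real]) simp
  qed
  have 1: "(\<lambda>n. LINT y|lborel. ft f y * G n y) \<longlonglongrightarrow> (LINT y|lborel. ft f y * exp (\<i> * of_real (x * y)))"
  proof (rule integral_dominated_convergence[where w = "\<lambda>y. norm (ft f y)"])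
    have "(\<lambda>n. G n y) \<longlonglongrightarrow> exp (\<i> * of_real (x * y)) * of_real (exp (- (y * 0)\<^sup>2 / 2))" for y
      unfolding G_def divide_inverse[of y]
      by (intro tendsto_intros LIMSEQ_inverse_real_of_nat) auto
    then show "AE y in lborel. (\<lambda>n. ft f y * G n y) \<longlonglongrightarrow> ft f y * exp (\<i> * of_real (x * y))"
      by (intro AE_I2 tendsto_intros) simp
    show "AE y in lborel. norm (ft f y * G n y) \<le> norm (ft f y)" for n
      by (intro AE_I2) (auto simp: G_def norm_mult intro!: mult_left_le)
  qed (use ftf Gint in \<open>auto intro: borel_measurable_integrable\<close>)
  have 2: "(LINT y|lborel. ft f y * G n y)
      = of_real (sqrt (2 * pi)) * (LINT z|lborel. of_real (exp (- z\<^sup>2 / 2)) * f (x + z / real (Suc n)))" for n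
  proof -
    have "(LINT y|lborel. ft f y * G n y) = (LINT \<xi>|lborel. f \<xi> * ft (G n) \<xi>)"
      by (rule ft_multiplication[OF f Gint])
    also have "\<dots> = (LINT \<xi>|lborel. f \<xi> * of_real (real (Suc n) * sqrt (2 * pi) * exp (- (real (Suc n) * (x - \<xi>))\<^sup>2 / 2)))"
      unfolding G_def by (subst ft_gaussian) simp_all
    also have "\<dots> = (1 / real (Suc n)) *\<^sub>R (LINT z|lborel. f (x + z / real (Suc n)) * of_real (real (Suc n) * sqrt (2 * pi) * exp (- z\<^sup>2 / 2)))"
      by (subst lborel_integral_real_affine[where c = "1 / real (Suc n)" and t = x])
        (simp_all add: field_simps del: of_nat_Suc)
    also have "\<dots> = of_real (sqrt (2 * pi)) * (LINT z|lborel. of_real (exp (- z\<^sup>2 / 2)) * f (x + z / real (Suc n)))"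
      by (simp add: scaleR_conv_of_real mult_ac flip: integral_mult_right_zero del: of_nat_Suc)
    finally show ?thesis .
  qed
  have 3: "(\<lambda>n. LINT z|lborel. of_real (exp (- z\<^sup>2 / 2)) * f (x + z / real (Suc n)))
      \<longlonglongrightarrow> (LINT z|lborel. of_real (exp (- z\<^sup>2 / 2)) * f x)"
  proof (rule integral_dominated_convergence[where w = "\<lambda>z. exp (- z\<^sup>2 / 2) * B"])
    have "(\<lambda>n. f (x + z * inverse (real (Suc n)))) \<longlonglongrightarrow> f (x + z * 0)" for z
      by (intro isCont_tendsto_compose[of _ f] tendsto_intros LIMSEQ_inverse_real_of_nat)
        (use cont in \<open>simp add: continuous_on_eq_continuous_at\<close>)
    then show "AE z in lborel. (\<lambda>n. of_real (exp (- z\<^sup>2 / 2)) * f (x + z / real (Suc n)))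
        \<longlonglongrightarrow> of_real (exp (- z\<^sup>2 / 2)) * f x"
      unfolding divide_inverse by (intro AE_I2 tendsto_intros) simp
    show "integrable lborel (\<lambda>z. exp (- z\<^sup>2 / 2) * B)"
      using integrable_gaussian by simp
    show "AE z in lborel. norm (of_real (exp (- z\<^sup>2 / 2)) * f (x + z / real (Suc n))) \<le> exp (- z\<^sup>2 / 2) * B" for n
      by (intro AE_I2) (auto simp: norm_mult intro!: mult_left_mono bdd)
  qed auto
  have "(LINT z|lborel. of_real (exp (- z\<^sup>2 / 2)) * f x) = of_real (sqrt (2 * pi)) * f x"
    by (simp only: integral_mult_left_zero integral_complex_of_real integral_gaussian)
  then have "(\<lambda>n. LINT y|lborel. ft f y * G n y) \<longlonglongrightarrow> of_real (sqrt (2 * pi)) * (of_real (sqrt (2 * pi)) * f x)"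
    unfolding 2 using 3 by (intro tendsto_mult_left) (simp only:)
  from LIMSEQ_unique[OF 1 this] show ?thesis
    by (simp add: mult.commute[of "ft f _"] flip: mult.assoc of_real_mult)
qed

text \<open>By inversion the transform of the conjugate of \<open>ft f\<close> is 2 pi times the
  conjugate of f; the claim is then \<open>ft_multiplication\<close> applied to f and that
  conjugate.\<close>

lemma ft_plancherel:
  fixes f :: "real \<Rightarrow> complex"
  assumes f: "integrable lborel f" and cont: "continuous_on UNIV f" and bdd: "\<And>x. norm (f x) \<le> B"
    and ftf: "integrable lborel (ft f)"
  shows "(LINT y|lborel. (norm (ft f y))\<^sup>2) = 2 * pi * (LINT x|lborel. (norm (f x))\<^sup>2)"
proof -
  have "ft (\<lambda>y. cnj (ft f y)) x = 2 * pi * cnj (f x)" for x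
  proof -
    have "ft (\<lambda>y. cnj (ft f y)) x = cnj (LINT y|lborel. exp (\<i> * of_real (x * y)) * ft f y)"
      unfolding ft_def[of "\<lambda>y. cnj (ft f y)"] 
      by (subst Bochner_Integration.integral_cnj[symmetric]) (simp add: exp_cnj mult.commute[of _ x])
    then show ?thesis unfolding ft_inversion[OF assms] by simp
  qed
  then have "(LINT y|lborel. ft f y * cnj (ft f y)) = (LINT x|lborel. f x * (2 * pi * cnj (f x)))"
    using ft_multiplication[OF f, of "\<lambda>y. cnj (ft f y)"] ftf by simp
  then have "(LINT y|lborel. complex_of_real ((norm (ft f y))\<^sup>2))
      = (LINT x|lborel. complex_of_real (2 * pi * (norm (f x))\<^sup>2))"
    by (simp only: complex_norm_square of_real_mult ac_simps)
  then show ?thesis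
    by (simp only: integral_complex_of_real of_real_eq_iff) simp
qed

section \<open>Decay of transforms of twice differentiable functions\<close>

lemma has_vector_derivative_exp_ii:
  "((\<lambda>x. exp (\<i> * complex_of_real (b * x))) has_vector_derivative \<i> * b * exp (\<i> * complex_of_real (b * x))) (at x)"
proof -
  have "((\<lambda>z. exp (\<i> * (complex_of_real b * z))) has_field_derivative
      \<i> * b * exp (\<i> * (complex_of_real b * of_real x))) (at (of_real x))"
    by (auto intro!: derivative_eq_intros)
  from has_vector_derivative_real_field[OF this] show ?thesis by simp
qed

text \<open>Two integrations by parts in one: \<open>F\<close> is chosen so that the first-order
  terms cancel in its derivative \<open>f\<close>. Since F vanishes at both ends, the integral of f
  is 0, that is, y^2 * ft u y = - ft u2 y.\<close>

lemma ft_decay: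
  fixes u u1 u2 :: "real \<Rightarrow> complex"
  assumes u: "\<And>x. (u has_vector_derivative u1 x) (at x)"
    and u1: "\<And>x. (u1 has_vector_derivative u2 x) (at x)"
    and cont: "continuous_on UNIV u2"
    and R: "\<And>x. \<bar>x\<bar> \<ge> R \<Longrightarrow> u x = 0 \<and> u1 x = 0 \<and> u2 x = 0"
  shows "norm (ft u y) \<le> (LINT x|lborel. norm (u x) + norm (u2 x)) / (1 + y\<^sup>2)"
    and "integrable lborel u" and "integrable lborel u1" and "integrable lborel u2"
proof -
  define S where "S = max R 0"
  have cu: "continuous_on UNIV u" "continuous_on UNIV u1"
    using u u1 by (auto simp: continuous_on_eq_continuous_at intro: has_vector_derivative_continuous)
  have ic: "integrable lborel f" if "continuous_on UNIV f" "\<And>x. \<bar>x\<bar> \<ge> R \<Longrightarrow> f x = 0" for f :: "real \<Rightarrow> complex"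
  proof -
    have "integrable lborel (\<lambda>x. indicator {-S..S} x *\<^sub>R f x)"
      by (rule borel_integrable_compact) (auto intro: continuous_on_subset[OF that(1)])
    also have "(\<lambda>x. indicator {-S..S} x *\<^sub>R f x) = f"
      using that(2) by (auto simp: fun_eq_iff indicator_def S_def)
    finally show ?thesis .
  qed
  show iu: "integrable lborel u" and iu1: "integrable lborel u1" and iu2: "integrable lborel u2"
    using ic cu cont R by auto
  define F where "F x = exp (- (\<i> * complex_of_real (x * y))) * (u1 x + \<i> * y * u x)" for x
  define f where "f x = exp (- (\<i> * complex_of_real (x * y))) * (u2 x + y\<^sup>2 * u x)" for x
  have F: "(F has_vector_derivative f x) (at x)" for x
  proof -
    have "((\<lambda>x. exp (\<i> * complex_of_real ((- y) * x)) * (u1 x + \<i> * y * u x)) has_vector_derivative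
        exp (\<i> * complex_of_real ((- y) * x)) * (u2 x + \<i> * y * u1 x)
        + \<i> * complex_of_real (- y) * exp (\<i> * complex_of_real ((- y) * x)) * (u1 x + \<i> * y * u x)) (at x)"
      by (intro has_vector_derivative_mult has_vector_derivative_exp_ii has_vector_derivative_add
          has_vector_derivative_mult_right u u1)
    then show ?thesis unfolding F_def f_def
      by (simp add: algebra_simps power2_eq_square)
  qed
  have "(LINT x|lborel. indicator {-S..S} x *\<^sub>R f x) = F S - F (-S)"
  proof (rule integral_FTC_Icc)
    show "(F has_vector_derivative f x) (at x within {- S..S})" for x
      by (rule has_vector_derivative_at_within[OF F])
    show "continuous_on {- S..S} f"
      unfolding f_def using cu cont by (auto intro!: continuous_intros intro: continuous_on_subset)
  qed (auto simp: S_def)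
  also have "F S - F (-S) = 0" using R[of S] R[of "-S"] by (simp add: F_def S_def)
  also have "(\<lambda>x. indicator {-S..S} x *\<^sub>R f x) = f"
    using R by (auto simp: fun_eq_iff indicator_def S_def f_def)
  also have "(LINT x|lborel. f x) = ft u2 y + y\<^sup>2 * ft u y"
    using integrable_exp_mult(2)[OF iu, of "\<lambda>x. x * y"] integrable_exp_mult(2)[OF iu2, of "\<lambda>x. x * y"]
    unfolding f_def ft_def
    by (simp add: distrib_left mult.left_commute[of _ "(complex_of_real y)\<^sup>2"])
  finally have "y\<^sup>2 * ft u y = - ft u2 y" by (simp add: eq_neg_iff_add_eq_0 add.commute)
  then have "y\<^sup>2 * norm (ft u y) = norm (ft u2 y)"
    by (metis norm_minus_cancel norm_mult norm_of_real abs_power2 of_real_power)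
  then have "(1 + y\<^sup>2) * norm (ft u y) \<le> (LINT x|lborel. norm (u x) + norm (u2 x))"
    using norm_ft_le[of u y] norm_ft_le[of u2 y] iu iu2 by (simp add: algebra_simps)
  then show "norm (ft u y) \<le> (LINT x|lborel. norm (u x) + norm (u2 x)) / (1 + y\<^sup>2)"
    by (subst pos_le_divide_eq) (auto simp: mult.commute add_pos_nonneg)
qed

section \<open>Twice continuously differentiable functions and cutoffs\<close>

definition C2 :: "(real \<Rightarrow> real) \<Rightarrow> bool" where
  "C2 f \<longleftrightarrow> (\<exists>f1 f2. (\<forall>x. (f has_real_derivative f1 x) (at x)) \<and>
     (\<forall>x. (f1 has_real_derivative f2 x) (at x)) \<and> continuous_on UNIV f2)"

lemma C2I:
  assumes "\<And>x. (f has_real_derivative f1 x) (at x)" "\<And>x. (f1 has_real_derivative f2 x) (at x)"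
    and "continuous_on UNIV f2"
  shows "C2 f"
  unfolding C2_def by (rule exI[of _ f1], rule exI[of _ f2]) (use assms in auto)

lemma DERIV_continuous_UNIV:
  "(\<And>x. (f has_real_derivative f' x) (at x)) \<Longrightarrow> continuous_on UNIV f"
  by (auto simp: continuous_on_eq_continuous_at intro: DERIV_isCont)

lemma C2_continuous: "C2 f \<Longrightarrow> continuous_on UNIV f"
  unfolding C2_def by (auto intro: DERIV_continuous_UNIV)

lemma C2_const: "C2 (\<lambda>x. c)"
  unfolding C2_def by (intro exI[of _ "\<lambda>_. 0"]) auto

lemma C2_square: "C2 (\<lambda>x. x\<^sup>2)"
  unfolding C2_def
  by (intro exI[of _ "\<lambda>x. 2 * x"] exI[of _ "\<lambda>_. 2"]) (auto intro!: derivative_eq_intros)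

lemma C2_add:
  assumes "C2 f" "C2 g" shows "C2 (\<lambda>x. f x + g x)"
proof -
  obtain f1 f2 g1 g2 where
    "\<forall>x. (f has_real_derivative f1 x) (at x)" "\<forall>x. (f1 has_real_derivative f2 x) (at x)"
    "continuous_on UNIV f2" "\<forall>x. (g has_real_derivative g1 x) (at x)"
    "\<forall>x. (g1 has_real_derivative g2 x) (at x)" "continuous_on UNIV g2"
    using assms unfolding C2_def by metis
  then show ?thesis unfolding C2_def
    by (intro exI[of _ "\<lambda>x. f1 x + g1 x"] exI[of _ "\<lambda>x. f2 x + g2 x"])
      (auto intro!: continuous_intros Deriv.field_differentiable_add)
qed

lemma C2_mult:
  assumes "C2 f" "C2 g" shows "C2 (\<lambda>x. f x * g x)"
proof -
  obtain f1 f2 g1 g2 where *: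
    "\<And>x. (f has_real_derivative f1 x) (at x)" "\<And>x. (f1 has_real_derivative f2 x) (at x)"
    "continuous_on UNIV f2" "\<And>x. (g has_real_derivative g1 x) (at x)"
    "\<And>x. (g1 has_real_derivative g2 x) (at x)" "continuous_on UNIV g2"
    using assms unfolding C2_def by metis
  have [continuous_intros]: "continuous_on UNIV f" "continuous_on UNIV g" "continuous_on UNIV f1" "continuous_on UNIV g1"
    by (rule DERIV_continuous_UNIV, rule *)+
  have 1: "((\<lambda>x. f x * g x) has_real_derivative f1 x * g x + g1 x * f x) (at x)" for x
    by (rule DERIV_mult[OF *(1,4)])
  have 2: "((\<lambda>x. f1 x * g x + g1 x * f x) has_real_derivative
      (f2 x * g x + g1 x * f1 x) + (g2 x * f x + f1 x * g1 x)) (at x)" for x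
    by (rule DERIV_add[OF DERIV_mult[OF *(2,4)] DERIV_mult[OF *(5,1)]])
  have 3: "continuous_on UNIV (\<lambda>x. (f2 x * g x + g1 x * f1 x) + (g2 x * f x + f1 x * g1 x))"
    by (intro continuous_intros *(3,6))
  show ?thesis by (rule C2I[OF 1 2 3])
qed

lemma C2_compose:
  assumes "C2 g"
    and h: "\<And>x. (h has_real_derivative h' (g x)) (at (g x))"
      "\<And>x. (h' has_real_derivative h'' (g x)) (at (g x))"
    and cont: "continuous_on UNIV (\<lambda>x. h'' (g x))"
  shows "C2 (\<lambda>x. h (g x))"
proof -
  obtain g1 g2 where *:
    "\<And>x. (g has_real_derivative g1 x) (at x)" "\<And>x. (g1 has_real_derivative g2 x) (at x)"
    "continuous_on UNIV g2"
    using assms(1) unfolding C2_def by metis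
  have 1: "((\<lambda>x. h (g x)) has_real_derivative h' (g x) * g1 x) (at x)" for x
    by (rule DERIV_chain2[OF h(1) *(1)])
  have 2: "((\<lambda>x. h' (g x)) has_real_derivative h'' (g x) * g1 x) (at x)" for x
    by (rule DERIV_chain2[OF h(2) *(1)])
  have [continuous_intros]: "continuous_on UNIV g1" "continuous_on UNIV (\<lambda>x. h' (g x))"
    by (rule DERIV_continuous_UNIV, rule *(2), rule DERIV_continuous_UNIV, rule 2)
  show ?thesis unfolding C2_def
    by (intro exI[of _ "\<lambda>x. h' (g x) * g1 x"] exI[of _ "\<lambda>x. h'' (g x) * g1 x * g1 x + h' (g x) * g2 x"])
      (auto intro!: continuous_intros 1 *(3) cont DERIV_cong[OF DERIV_mult[OF 2 *(2)]])
qed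

text \<open>An exponent of at least 2 flattens the corner at 0. Using n = 1 and then n = 0 shows
  that the cube of a positive part is twice continuously differentiable, which is why cutoffs are
  built from cubes.\<close>

lemma DERIV_pos_part_power:
  "((\<lambda>u. max 0 u ^ (n + 2)) has_real_derivative real (n + 2) * max 0 u ^ (n + 1)) (at u)"
proof -
  consider "u < 0" | "u > 0" | "u = 0" by linarith
  then show ?thesis
  proof cases
    case 1
    have "((\<lambda>u. 0) has_real_derivative 0) (at u)" by simp
    then have "((\<lambda>u. max 0 u ^ (n + 2)) has_real_derivative 0) (at u)"
      by (rule has_field_derivative_transform_within_open[where S = "{..<0}"]) (use 1 in \<open>auto simp: max_def\<close>)
    then show ?thesis using 1 by (simp add: max_def)
  next
    case 2
    have "((\<lambda>u. u ^ (n + 2)) has_real_derivative real (n + 2) * u ^ (n + 1)) (at u)"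
      using DERIV_pow[of "n + 2" u] by simp
    then have "((\<lambda>u. max 0 u ^ (n + 2)) has_real_derivative real (n + 2) * u ^ (n + 1)) (at u)"
      by (rule has_field_derivative_transform_within_open[where S = "{0<..}"]) (use 2 in \<open>auto simp: max_def\<close>)
    then show ?thesis using 2 by (simp add: max_def)
  next
    case 3
    have "((\<lambda>h. max 0 h ^ (n + 2) / h) \<longlongrightarrow> 0) (at (0::real))"
    proof (rule Lim_null_comparison)
      show "\<forall>\<^sub>F h in at (0::real). norm (max 0 h ^ (n + 2) / h) \<le> \<bar>h\<bar> ^ (n + 1)"
        by (intro always_eventually) (auto simp: max_def power_abs intro!: mult_nonpos_nonneg)
      show "((\<lambda>h. \<bar>h\<bar> ^ (n + 1)) \<longlongrightarrow> 0) (at (0::real))"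
        by (auto intro!: tendsto_eq_intros)
    qed
    then show ?thesis using 3 by (simp add: DERIV_def)
  qed
qed

lemma C2_pos_part_cube: "C2 f \<Longrightarrow> C2 (\<lambda>x. max 0 (f x) ^ 3)"
proof -
  assume f: "C2 f"
  have 1: "((\<lambda>u. max 0 u ^ 3) has_real_derivative 3 * max 0 u ^ 2) (at u)" for u :: real
    using DERIV_pos_part_power[of 1 u] by (simp add: numeral_eq_Suc)
  have 2: "((\<lambda>u. 3 * max 0 u ^ 2) has_real_derivative 6 * max 0 u) (at u)" for u :: real
    using DERIV_cmult[OF DERIV_pos_part_power[of 0 u], of 3] by (simp add: numeral_eq_Suc)
  show ?thesis
    by (rule C2_compose[OF f 1 2]) (auto intro!: continuous_intros C2_continuous[OF f])
qed

lemma C2_powr: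
  assumes f: "C2 f" and pos: "\<And>x. f x > 0"
  shows "C2 (\<lambda>x. f x powr a)"
proof (rule C2_compose[OF f, where h = "\<lambda>u. u powr a" and h' = "\<lambda>u. a * u powr (a - 1)"
        and h'' = "\<lambda>u. a * ((a - 1) * u powr (a - 1 - 1))"])
  show "((\<lambda>u. u powr a) has_real_derivative a * f x powr (a - 1)) (at (f x))" for x
    by (rule has_real_derivative_powr[OF pos])
  show "((\<lambda>u. a * u powr (a - 1)) has_real_derivative a * ((a - 1) * f x powr (a - 1 - 1))) (at (f x))" for x
    by (intro DERIV_cmult has_real_derivative_powr pos)
  show "continuous_on UNIV (\<lambda>x. a * ((a - 1) * f x powr (a - 1 - 1)))"
    using less_imp_neq[OF pos] by (intro continuous_intros C2_continuous[OF f]) auto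
qed

text \<open>The modulus is smoothed near the origin by replacing \<open>x\<^sup>2\<close> with
  \<open>x\<^sup>2 + (max 0 (c\<^sup>2 - x\<^sup>2))\<^sup>3 > 0\<close>.\<close>

lemma C2_cutoff_powr:
  assumes c: "0 < c" and R: "0 < R"
  shows "\<exists>w S. C2 w \<and> (\<forall>x. c \<le> \<bar>x\<bar> \<and> \<bar>x\<bar> \<le> R \<longrightarrow> w x = \<bar>x\<bar> powr (- s)) \<and>
    (\<forall>x. \<bar>x\<bar> > S \<longrightarrow> w x = 0) \<and> 0 < S"
proof -
  define m where "m x = x\<^sup>2 + max 0 (c\<^sup>2 + (- 1) * x\<^sup>2) ^ 3" for x
  \<comment> \<open>The cutoff: the inner cube is 0 for |x| \<le> R, giving q = 1, and at least 1
    once x^2 - R^2 \<ge> 1, giving q = 0. The latter holds for |x| > R + 1.\<close>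
  define q where "q x = max 0 (1 + (- 1) * max 0 (x\<^sup>2 + (- (R\<^sup>2))) ^ 3) ^ 3" for x
  define w where "w x = m x powr (- s / 2) * q x" for x
  have m: "C2 m" unfolding m_def
    by (intro C2_add C2_square C2_pos_part_cube C2_mult C2_const)
  have chi: "C2 q" unfolding q_def
    by (intro C2_add C2_square C2_pos_part_cube C2_mult C2_const)
  have pos: "m x > 0" for x
    using c by (cases "x = 0") (auto simp: m_def intro!: add_pos_nonneg)
  have "C2 w" unfolding w_def by (intro C2_mult C2_powr m chi pos)
  moreover have "w x = \<bar>x\<bar> powr (- s)" if x: "c \<le> \<bar>x\<bar>" "\<bar>x\<bar> \<le> R" for x
  proof -
    have "c\<^sup>2 \<le> x\<^sup>2" "x\<^sup>2 \<le> R\<^sup>2"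
      using x c R by (auto simp flip: abs_le_square_iff)
    then have "m x = \<bar>x\<bar> powr 2" "q x = 1"
      using x c by (auto simp: m_def q_def max_def powr_numeral)
    then show ?thesis unfolding w_def by (simp only: powr_powr) simp
  qed
  moreover have "w x = 0" if x: "\<bar>x\<bar> > R + 1" for x
  proof -
    have "(R + 1)\<^sup>2 \<le> x\<^sup>2" using x R by (auto simp flip: abs_le_square_iff)
    then have "x\<^sup>2 - R\<^sup>2 \<ge> 1" using R by (simp add: power2_eq_square algebra_simps)
    then have "max 0 (x\<^sup>2 - R\<^sup>2) ^ 3 \<ge> 1" by (intro one_le_power) auto
    then show ?thesis by (simp add: w_def q_def)
  qed
  ultimately show ?thesis using R by (intro exI[of _ w] exI[of _ "R + 1"]) auto
qed

lemma norm_exp_ii_minus_one: "norm (exp (\<i> * complex_of_real x) - 1) \<le> \<bar>x\<bar>"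
  using iexp_approx1[of x 0] by simp

text \<open>The second estimate keeps track of b. On the support |exp (i b x) - 1| \<le> |b| S, and
  differentiating the exponential produces factors b and b^2, so the bound vanishes linearly as b
  tends to 0. This is the source of the gain at coarse scales.\<close>

lemma ft_C2_decay:
  assumes w: "C2 w" and S: "\<And>x. \<bar>x\<bar> > S \<Longrightarrow> w x = 0" "0 < S"
  obtains C where "0 \<le> C" and "\<And>y. norm (ft (\<lambda>x. of_real (w x)) y) \<le> C / (1 + y\<^sup>2)"
    and "\<And>b y. norm (ft (\<lambda>x. (exp (\<i> * of_real (b * x)) - 1) * of_real (w x)) y) \<le> C * (\<bar>b\<bar> + b\<^sup>2) / (1 + y\<^sup>2)"
proof -
  obtain w1 w2 where d: "\<And>x. (w has_real_derivative w1 x) (at x)"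
    "\<And>x. (w1 has_real_derivative w2 x) (at x)" and cont: "continuous_on UNIV w2"
    using w unfolding C2_def by metis
  \<comment> \<open>The strict inequality makes this region open, so derivatives vanish on it too.
    \<open>ft_decay\<close> asks for vanishing on a closed region, hence the radius
    \<open>S + 1\<close> below.\<close>
  have o: "open {x. \<bar>x\<bar> > S}" by (intro open_Collect_less continuous_intros)
  have z: "f1 x = 0" if "\<And>x. (f has_real_derivative f1 x) (at x)" "\<And>x. \<bar>x\<bar> > S \<Longrightarrow> f x = 0" "\<bar>x\<bar> > S" for f f1 :: "real \<Rightarrow> real" and x
  proof -
    have "((\<lambda>x. 0) has_real_derivative 0) (at x)" by simp
    then have "(f has_real_derivative 0) (at x)"
      by (rule has_field_derivative_transform_within_open[OF _ o]) (use that in auto)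
    then show ?thesis using DERIV_unique that(1) by blast
  qed
  have w1: "w1 x = 0" if "\<bar>x\<bar> > S" for x using z[OF d(1) S(1)] that by auto
  have w2: "w2 x = 0" if "\<bar>x\<bar> > S" for x using z[OF d(2) w1] that by auto
  note dv = d[THEN has_vector_derivative_of_real]
  have 1: "norm (ft (\<lambda>x. of_real (w x)) y) \<le> (LINT x|lborel. norm (complex_of_real (w x)) + norm (complex_of_real (w2 x))) / (1 + y\<^sup>2)"
    "integrable lborel (\<lambda>x. complex_of_real (w x))" "integrable lborel (\<lambda>x. complex_of_real (w1 x))"
    "integrable lborel (\<lambda>x. complex_of_real (w2 x))" for y
    by (rule ft_decay[OF dv, where R = "S + 1"]; use S w1 w2 cont in \<open>auto intro!: continuous_intros\<close>)+
  then have int: "integrable lborel w" "integrable lborel w1" "integrable lborel w2"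
    by (simp_all add: complex_of_real_integrable_eq)
  \<comment> \<open>One majorant for both estimates: \<open>S + 1\<close> dominates S in the terms
    where |b| S occurs, and 1 in the term with b^2 and in the estimate without b; the 2 is from the
    product rule.\<close>
  define B where "B x = (S + 1) * \<bar>w x\<bar> + 2 * \<bar>w1 x\<bar> + (S + 1) * \<bar>w2 x\<bar>" for x
  have B: "integrable lborel B" unfolding B_def using int by auto
  define C where "C = (LINT x|lborel. B x)"
  show ?thesis
  proof
    show "0 \<le> C" unfolding C_def B_def using S by (intro Bochner_Integration.integral_nonneg) auto
    show "norm (ft (\<lambda>x. of_real (w x)) y) \<le> C / (1 + y\<^sup>2)" for y
    proof (rule order_trans[OF 1(1)], rule divide_right_mono)
      show "(LINT x|lborel. norm (complex_of_real (w x)) + norm (complex_of_real (w2 x))) \<le> C"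
        unfolding C_def using int B S
        by (intro integral_mono) (auto simp: B_def algebra_simps)
    qed auto
    show "norm (ft (\<lambda>x. (exp (\<i> * of_real (b * x)) - 1) * of_real (w x)) y) \<le> C * (\<bar>b\<bar> + b\<^sup>2) / (1 + y\<^sup>2)" for b y
    proof -
      let ?e = "\<lambda>x. exp (\<i> * complex_of_real (b * x))"
      let ?u = "\<lambda>x. (?e x - 1) * of_real (w x)"
      let ?u1 = "\<lambda>x. \<i> * b * ?e x * of_real (w x) + (?e x - 1) * of_real (w1 x)"
      let ?u2 = "\<lambda>x. - (b\<^sup>2) * ?e x * of_real (w x) + 2 * \<i> * b * ?e x * of_real (w1 x) + (?e x - 1) * of_real (w2 x)"
      have e: "(?e has_vector_derivative \<i> * b * ?e x) (at x)" for x
        by (rule has_vector_derivative_exp_ii)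
      have u: "(?u has_vector_derivative ?u1 x) (at x)" for x
      proof -
        have "(?u has_vector_derivative (?e x - 1) * of_real (w1 x) + (\<i> * b * ?e x - 0) * of_real (w x)) (at x)"
          by (intro has_vector_derivative_mult has_vector_derivative_diff has_vector_derivative_const e dv)
        then show ?thesis by (simp add: algebra_simps)
      qed
      have u1: "(?u1 has_vector_derivative ?u2 x) (at x)" for x
      proof -
        have "(?u1 has_vector_derivative (\<i> * b * ?e x * of_real (w1 x) + (\<i> * b * (\<i> * b * ?e x)) * of_real (w x))
            + ((?e x - 1) * of_real (w2 x) + (\<i> * b * ?e x - 0) * of_real (w1 x))) (at x)"
          by (intro has_vector_derivative_mult has_vector_derivative_diff has_vector_derivative_add
              has_vector_derivative_mult_right has_vector_derivative_const e dv)
        then show ?thesis by (simp add: algebra_simps power2_eq_square)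
      qed
      have cw: "continuous_on UNIV w" "continuous_on UNIV w1"
        by (rule DERIV_continuous_UNIV, rule d)+
      have cu2: "continuous_on UNIV ?u2"
        using cw cont by (intro continuous_intros) auto
      have vanish: "?u x = 0 \<and> ?u1 x = 0 \<and> ?u2 x = 0" if "\<bar>x\<bar> \<ge> S + 1" for x
        using that S w1 w2 by auto
      note D = ft_decay[OF u u1 cu2 vanish]
      have bound: "norm (?u x) + norm (?u2 x) \<le> (\<bar>b\<bar> + b\<^sup>2) * B x" for x
      proof (cases "\<bar>x\<bar> > S")
        case False
        have "norm (?e x - 1) \<le> \<bar>b\<bar> * \<bar>x\<bar>"
          using norm_exp_ii_minus_one[of "b * x"] by (simp add: abs_mult)
        also have "\<dots> \<le> \<bar>b\<bar> * S" using False by (intro mult_left_mono) auto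
        finally have e1: "norm (?e x - 1) \<le> \<bar>b\<bar> * S" .
        have "norm (?u x) \<le> (\<bar>b\<bar> * S) * \<bar>w x\<bar>"
          using e1 by (simp add: norm_mult mult_right_mono)
        moreover have "norm (?u2 x) \<le> b\<^sup>2 * \<bar>w x\<bar> + 2 * \<bar>b\<bar> * \<bar>w1 x\<bar> + (\<bar>b\<bar> * S) * \<bar>w2 x\<bar>"
          using e1 by (intro norm_triangle_le add_mono) (auto simp: norm_mult norm_power intro!: mult_right_mono)
        moreover have "(\<bar>b\<bar> * S) * \<bar>w x\<bar> + (b\<^sup>2 * \<bar>w x\<bar> + 2 * \<bar>b\<bar> * \<bar>w1 x\<bar> + (\<bar>b\<bar> * S) * \<bar>w2 x\<bar>) \<le> (\<bar>b\<bar> + b\<^sup>2) * B x"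
          using S(2) by (simp add: B_def algebra_simps)
        ultimately show ?thesis by linarith
      next
        case True
        then show ?thesis using S w1 w2 by (auto simp: B_def)
      qed
      have "(LINT x|lborel. norm (?u x) + norm (?u2 x)) \<le> (LINT x|lborel. (\<bar>b\<bar> + b\<^sup>2) * B x)"
        using D(2,4) B bound by (intro integral_mono integrable_add integrable_norm integrable_mult_right) auto
      then have "(LINT x|lborel. norm (?u x) + norm (?u2 x)) \<le> C * (\<bar>b\<bar> + b\<^sup>2)"
        by (simp add: C_def mult.commute)
      then show ?thesis
        by (intro order_trans[OF D(1)] divide_right_mono) auto
    qed
  qed
qed

section \<open>Orthonormal expansions\<close>

lemma Lspace2_iff: "f \<in> Lspace 2 \<longleftrightarrow> f \<in> borel_measurable borel \<and> integrable lborel (\<lambda>x. (norm (f x))\<^sup>2)"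
  by (simp add: Lspace_def)

lemma borel_measurable_cnj' [measurable (raw)]:
  "f \<in> borel_measurable M \<Longrightarrow> (\<lambda>x. cnj (f x)) \<in> borel_measurable M"
  by (rule borel_measurable_continuous_on[of cnj]) (auto intro!: continuous_intros)

lemma Lspace2_integrable_mult_cnj:
  assumes "f \<in> Lspace 2" "g \<in> Lspace 2"
  shows "integrable lborel (\<lambda>x. f x * cnj (g x))"
proof (rule Bochner_Integration.integrable_bound)
  have [measurable]: "f \<in> borel_measurable borel" "g \<in> borel_measurable borel"
    using assms by (auto simp: Lspace_def)
  show "integrable lborel (\<lambda>x. (norm (f x))\<^sup>2 + (norm (g x))\<^sup>2)"
    using assms by (auto simp: Lspace2_iff)
  show "(\<lambda>x. f x * cnj (g x)) \<in> borel_measurable lborel" by measurable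
  have "norm (f x) * norm (g x) \<le> (norm (f x))\<^sup>2 + (norm (g x))\<^sup>2" for x
    using sum_squares_bound[of "norm (f x)" "norm (g x)"] mult_nonneg_nonneg[OF norm_ge_zero norm_ge_zero, of "f x" "g x"]
    by linarith
  then show "AE x in lborel. norm (f x * cnj (g x)) \<le> norm ((norm (f x))\<^sup>2 + (norm (g x))\<^sup>2)"
    by (auto simp: norm_mult)
qed

text \<open>Pythagoras with free coefficients d: the last sum is the price of deviating from c, so d
  = c is the best choice on F, and with it the error can only shrink as F grows.\<close>

lemma orthonormal_residual:
  fixes f :: "'a::euclidean_space \<Rightarrow> complex"
  assumes f: "f \<in> Lspace 2" and e: "\<And>i. e i \<in> Lspace 2"
    and on: "\<And>i i'. (LINT x|lborel. e i x * cnj (e i' x)) = (if i = i' then 1 else 0)"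
    and F: "finite F"
  defines "c \<equiv> \<lambda>i. LINT x|lborel. f x * cnj (e i x)"
  shows "(LINT x|lborel. (norm (f x - (\<Sum>i\<in>F. d i * e i x)))\<^sup>2)
    = (LINT x|lborel. (norm (f x))\<^sup>2) - (\<Sum>i\<in>F. (norm (c i))\<^sup>2) + (\<Sum>i\<in>F. (norm (c i - d i))\<^sup>2)"
proof -
  note I [simp] = Lspace2_integrable_mult_cnj
  have c': "(LINT x|lborel. e i x * cnj (f x)) = cnj (c i)" for i
    unfolding c_def by (simp flip: Bochner_Integration.integral_cnj add: mult.commute)
  have "complex_of_real (LINT x|lborel. (norm (f x - (\<Sum>i\<in>F. d i * e i x)))\<^sup>2)
      = (LINT x|lborel. (f x - (\<Sum>i\<in>F. d i * e i x)) * cnj (f x - (\<Sum>i\<in>F. d i * e i x)))"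
    by (simp only: flip: integral_complex_of_real complex_norm_square)
  also have "\<dots> = (LINT x|lborel. f x * cnj (f x) - (\<Sum>i\<in>F. cnj (d i) * (f x * cnj (e i x)))
      - (\<Sum>i\<in>F. d i * (e i x * cnj (f x)))
      + (\<Sum>i\<in>F. \<Sum>i'\<in>F. d i' * cnj (d i) * (e i' x * cnj (e i x))))"
    by (rule Bochner_Integration.integral_cong)
      (simp_all add: sum_product sum_distrib_left sum_distrib_right algebra_simps)
  also have "\<dots> = (LINT x|lborel. f x * cnj (f x)) - (\<Sum>i\<in>F. cnj (d i) * c i)
      - (\<Sum>i\<in>F. d i * cnj (c i)) + (\<Sum>i\<in>F. \<Sum>i'\<in>F. d i' * cnj (d i) * (if i' = i then 1 else 0))"
    using f e by (simp add: Bochner_Integration.integral_sum on c') (simp add: c_def)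
  also have "(\<Sum>i\<in>F. \<Sum>i'\<in>F. d i' * cnj (d i) * (if i' = i then 1 else 0)) = (\<Sum>i\<in>F. d i * cnj (d i))"
    using F by (simp add: if_distrib cong: if_cong)
  also have "(LINT x|lborel. f x * cnj (f x)) = of_real (LINT x|lborel. (norm (f x))\<^sup>2)"
    by (simp only: flip: integral_complex_of_real complex_norm_square)
  also have "of_real (LINT x|lborel. (norm (f x))\<^sup>2) - (\<Sum>i\<in>F. cnj (d i) * c i)
      - (\<Sum>i\<in>F. d i * cnj (c i)) + (\<Sum>i\<in>F. d i * cnj (d i))
      = complex_of_real ((LINT x|lborel. (norm (f x))\<^sup>2) - (\<Sum>i\<in>F. (norm (c i))\<^sup>2) + (\<Sum>i\<in>F. (norm (c i - d i))\<^sup>2))"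
    by (simp add: complex_norm_square algebra_simps sum.distrib sum_subtractf del: of_real_power)
  finally show ?thesis by (simp only: of_real_eq_iff)
qed

text \<open>The definition of a basis provides only density of finite combinations. A good
  combination on F is extended by zero to F', and replacing its coefficients by the Fourier
  coefficients does not increase the error.\<close>

lemma orthonormal_basis_L2_expansion:
  assumes "orthonormal_basis_L2 e" and f: "f \<in> Lspace 2" and "\<epsilon> > 0"
  obtains F where "finite F" and "\<And>F'. finite F' \<Longrightarrow> F \<subseteq> F' \<Longrightarrow>
    (LINT x|lborel. (norm (f x - (\<Sum>i\<in>F'. (LINT x|lborel. f x * cnj (e i x)) * e i x)))\<^sup>2) < \<epsilon>"
proof -
  have e: "\<And>i. e i \<in> Lspace 2"
    and on: "\<And>i i'. (LINT x|lborel. e i x * cnj (e i' x)) = (if i = i' then 1 else 0)"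
    using assms(1) by (auto simp: orthonormal_basis_L2_def)
  obtain F d where F: "finite F" and d: "(LINT x|lborel. (norm (f x - (\<Sum>i\<in>F. d i * e i x)))\<^sup>2) < \<epsilon>"
    using assms unfolding orthonormal_basis_L2_def by blast
  show ?thesis
  proof (rule that[OF F])
    fix F' assume F': "finite F'" "F \<subseteq> F'"
    have "(\<Sum>i\<in>F. d i * e i x) = (\<Sum>i\<in>F'. (if i \<in> F then d i else 0) * e i x)" for x
      using F' by (intro sum.mono_neutral_cong_left) auto
    with d have d': "(LINT x|lborel. (norm (f x - (\<Sum>i\<in>F'. (if i \<in> F then d i else 0) * e i x)))\<^sup>2) < \<epsilon>"
      by simp
    show "(LINT x|lborel. (norm (f x - (\<Sum>i\<in>F'. (LINT x|lborel. f x * cnj (e i x)) * e i x)))\<^sup>2) < \<epsilon>"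
      using d' unfolding orthonormal_residual[OF f e on F'(1)]
      by (smt (verit, best) sum_nonneg zero_le_power2 norm_zero diff_self sum.neutral power_zero_numeral zero_eq_power2)
  qed
qed

text \<open>As the sets increase, a finite set lies inside a single one of them. This turns
  \<open>has_sum\<close> into convergence along a sequence, both for the sets of the theorem and for
  those built in \<open>psi_hat_completeness\<close>.\<close>

lemma exhausting_filterlim:
  assumes "\<And>n. finite (D n)" "\<And>n. D n \<subseteq> D (Suc n)" "(\<Union>n. D n) = UNIV"
  shows "filterlim D (finite_subsets_at_top UNIV) sequentially"
  unfolding filterlim_finite_subsets_at_top
proof (intro allI impI)
  fix X :: "'a set" assume X: "finite X \<and> X \<subseteq> UNIV"
  have mono: "D m \<subseteq> D n" if "m \<le> n" for m n
    using lift_Suc_mono_le[of D, OF assms(2) that] .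
  from X have "finite X" ..
  then have "\<exists>n. X \<subseteq> D n"
  proof (induction X)
    case (insert x X)
    then obtain m where "X \<subseteq> D m" by blast
    moreover obtain n where "x \<in> D n" using assms(3) by blast
    ultimately have "insert x X \<subseteq> D (max m n)"
      using mono[of m "max m n"] mono[of n "max m n"] by auto
    then show ?case ..
  qed simp
  then obtain n where "X \<subseteq> D n" by blast
  then show "\<forall>\<^sub>F n in sequentially. finite (D n) \<and> X \<subseteq> D n \<and> D n \<subseteq> UNIV"
    using assms(1) mono by (intro eventually_sequentiallyI[of n]) blast
qed

lemma integrable_inverse_1_plus_square': "integrable lborel (\<lambda>x::real. 1 / (1 + x\<^sup>2))"
  using integrable_inverse_1_plus_square
  by (simp add: set_integrable_def inverse_eq_divide einterval_eq)

section \<open>The wavelet basis in the frequency domain\<close>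

lemma integrable_continuous_compact_support:
  fixes f :: "real \<Rightarrow> complex"
  assumes "continuous_on UNIV f" and "\<And>x. \<bar>x\<bar> > R \<Longrightarrow> f x = 0"
  shows "integrable lborel f"
proof -
  have "integrable lborel (\<lambda>x. indicator {-R..R} x *\<^sub>R f x)"
    by (rule borel_integrable_compact) (auto intro: continuous_on_subset[OF assms(1)])
  also have "(\<lambda>x. indicator {-R..R} x *\<^sub>R f x) = f"
    using assms(2) by (auto simp: fun_eq_iff indicator_def)
  finally show ?thesis .
qed

lemma bounded_continuous_compact_support:
  fixes f :: "real \<Rightarrow> complex"
  assumes "continuous_on UNIV f" and "\<And>x. \<bar>x\<bar> > R \<Longrightarrow> f x = 0"
  obtains B where "\<And>x. norm (f x) \<le> B"
proof -
  have "bounded (f ` {-R..R})"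
    by (intro compact_imp_bounded compact_continuous_image continuous_on_subset[OF assms(1)]) auto
  then obtain B where B: "\<forall>x\<in>{-R..R}. norm (f x) \<le> B" by (auto simp: bounded_iff)
  have "norm (f x) \<le> max B 0" for x
    using assms(2)[of x] B by (cases "\<bar>x\<bar> > R") (auto simp: le_max_iff_disj abs_le_iff not_less)
  then show ?thesis by (rule that)
qed

section \<open>Decay, support and transforms of the wavelet\<close>

locale meyer_wavelet =
  fixes \<psi> :: "real \<Rightarrow> real"
  assumes wavelet: "lemarie_meyer_wavelet \<psi>"
begin

lemma schwartz: "schwartz \<psi>"
  using wavelet by (simp add: lemarie_meyer_wavelet_def)

lemma psi_continuous [continuous_intros]: "continuous_on UNIV \<psi>"
proof -
  have "\<psi> differentiable (at x)" for x
    using schwartz unfolding schwartz_def by (metis funpow_0)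
  then show ?thesis
    by (auto simp: continuous_on_eq_continuous_at intro: differentiable_imp_continuous_within)
qed

lemma psi_measurable [measurable]: "\<psi> \<in> borel_measurable borel"
  by (rule borel_measurable_continuous_onI) (rule psi_continuous)

text \<open>The weight 1 + x^2 occurs twice: once as the weight that
  \<open>psi_convolution_bound\<close> has to absorb, once to make the weighted function integrable.
  Its square involves the Schwartz seminorms with x^0, x^2 and x^4.\<close>

lemma psi_decay: "\<exists>B. \<forall>x. (1 + x\<^sup>2) * \<bar>\<psi> x\<bar> \<le> B / (1 + x\<^sup>2)"
proof -
  have "bounded (range (\<lambda>x. x ^ m * \<psi> x))" for m
    using schwartz unfolding schwartz_def by (metis (no_types, lifting) funpow_0 ext)
  then obtain b where b: "\<And>m x. \<bar>x ^ m * \<psi> x\<bar> \<le> b m"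
    unfolding bounded_iff by (metis rangeI real_norm_def)
  have "(1 + x\<^sup>2) * \<bar>\<psi> x\<bar> \<le> (b 0 + 2 * b 2 + b 4) / (1 + x\<^sup>2)" for x
  proof -
    have "((1 + x\<^sup>2) * \<bar>\<psi> x\<bar>) * (1 + x\<^sup>2) = \<bar>x ^ 0 * \<psi> x\<bar> + 2 * \<bar>x ^ 2 * \<psi> x\<bar> + \<bar>x ^ 4 * \<psi> x\<bar>"
    proof -
      have "\<bar>x ^ 2 * \<psi> x\<bar> = x ^ 2 * \<bar>\<psi> x\<bar>" "\<bar>x ^ 4 * \<psi> x\<bar> = x ^ 4 * \<bar>\<psi> x\<bar>"
        unfolding abs_mult by (simp_all del: power_abs add: abs_of_nonneg)
      then show ?thesis by (simp only:) (simp add: algebra_simps power2_eq_square power4_eq_xxxx)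
    qed
    also have "\<dots> \<le> b 0 + 2 * b 2 + b 4"
      using b[of x 0] b[of x 2] b[of x 4] by linarith
    finally show ?thesis by (subst pos_le_divide_eq) (auto simp: add_pos_nonneg)
  qed
  then show ?thesis by blast
qed

lemma psi_weighted_integrable: "integrable lborel (\<lambda>x. (1 + x\<^sup>2) * \<bar>\<psi> x\<bar>)"
proof -
  obtain B where B: "\<And>x. (1 + x\<^sup>2) * \<bar>\<psi> x\<bar> \<le> B / (1 + x\<^sup>2)"
    using psi_decay by blast
  show ?thesis
  proof (rule Bochner_Integration.integrable_bound)
    show "integrable lborel (\<lambda>x. B * (1 / (1 + x\<^sup>2)))"
      by (intro integrable_mult_right integrable_inverse_1_plus_square')
    show "AE x in lborel. norm ((1 + x\<^sup>2) * \<bar>\<psi> x\<bar>) \<le> norm (B * (1 / (1 + x\<^sup>2)))"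
    proof (intro AE_I2)
      fix x
      have "norm ((1 + x\<^sup>2) * \<bar>\<psi> x\<bar>) = (1 + x\<^sup>2) * \<bar>\<psi> x\<bar>" by (simp add: abs_mult)
      also have "\<dots> \<le> B * (1 / (1 + x\<^sup>2))" using B[of x] by simp
      finally show "norm ((1 + x\<^sup>2) * \<bar>\<psi> x\<bar>) \<le> norm (B * (1 / (1 + x\<^sup>2)))"
        unfolding real_norm_def by (rule order_trans[OF _ abs_ge_self])
    qed
  qed measurable
qed

lemma psi_bounded: "\<exists>B. \<forall>x. \<bar>\<psi> x\<bar> \<le> B"
proof -
  have "bounded (range (\<lambda>x. x ^ 0 * \<psi> x))"
    using schwartz unfolding schwartz_def by (metis (no_types, lifting) funpow_0 ext)
  then show ?thesis by (auto simp: bounded_iff)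
qed

lemma psi_integrable: "integrable lborel (\<lambda>x. complex_of_real (\<psi> x))"
proof (rule Bochner_Integration.integrable_bound[OF psi_weighted_integrable])
  show "AE x in lborel. norm (complex_of_real (\<psi> x)) \<le> norm ((1 + x\<^sup>2) * \<bar>\<psi> x\<bar>)"
    by (intro AE_I2) (simp add: abs_mult mult_le_cancel_right1 algebra_simps)
qed measurable

fun wav :: "int \<times> int \<Rightarrow> real \<Rightarrow> complex" where
  "wav (j, k) x = of_real (2 powr (of_int j / 2) * \<psi> (2 powi j * x - of_int k))"

lemma wav_basis: "orthonormal_basis_L2 wav"
proof -
  have "wav = (\<lambda>(j, k) x. of_real (2 powr (of_int j / 2) * \<psi> (2 powi j * x - of_int k)))"
    by (auto simp: fun_eq_iff)
  then show ?thesis using wavelet by (simp add: lemarie_meyer_wavelet_def)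
qed

lemma wav_integrable: "integrable lborel (wav i)"
proof (cases i)
  case (Pair j k)
  have "integrable lborel (\<lambda>x. complex_of_real (\<psi> (- of_int k + 2 powi j * x)))"
    by (rule lborel_integrable_real_affine[OF psi_integrable]) simp
  then show ?thesis using Pair by (simp add: wav.simps[abs_def])
qed

lemma fourier_support: "fourier \<psi> \<xi> \<noteq> 0 \<Longrightarrow> 2 * pi / 3 \<le> \<bar>\<xi>\<bar> \<and> \<bar>\<xi>\<bar> \<le> 8 * pi / 3"
  using wavelet by (simp add: lemarie_meyer_wavelet_def)

lemma fourier_continuous: "continuous_on UNIV (fourier \<psi>)"
  unfolding fourier_eq_ft[abs_def] by (intro continuous_intros continuous_ft psi_integrable)

lemma psi_hat_continuous: "continuous_on UNIV (psi_hat \<psi> \<alpha> j k)"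
  unfolding psi_hat_def
  by (intro continuous_intros continuous_on_compose2[OF fourier_continuous]) auto

lemma psi_hat_support: "psi_hat \<psi> \<alpha> j k x \<noteq> 0 \<Longrightarrow> 2 * pi / 3 \<le> 2 powi (- j) * \<bar>x\<bar> \<and> 2 powi (- j) * \<bar>x\<bar> \<le> 8 * pi / 3"
  using fourier_support[of "2 powi (- j) * x"] by (auto simp: psi_hat_def abs_mult)

lemma psi_hat_compact_support: "\<bar>x\<bar> > 2 powi j * (8 * pi / 3) \<Longrightarrow> psi_hat \<psi> \<alpha> j k x = 0"
  using psi_hat_support[of \<alpha> j k x] by (auto simp: power_int_minus field_simps)

lemmas psi_hat_integrable = integrable_continuous_compact_support[OF psi_hat_continuous psi_hat_compact_support]

text \<open>The substitution x = 2^(-j) (k + y) has Jacobian 2^(-j), which turns the L^2 factor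
  2^(j/2) into 2^(-j/2), the normalisation of \<open>psi_hat\<close> for exponent 2.\<close>

lemma psi_hat_eq_ft: "psi_hat \<psi> 2 j k \<xi> = of_real ((2 * pi) powr (- (1/2))) * ft (wav (j, k)) \<xi>"
proof -
  have "ft (wav (j, k)) \<xi> = (LINT x|lborel. exp (- (\<i> * of_real (x * \<xi>))) *
      of_real (2 powr (of_int j / 2) * \<psi> (2 powi j * x - of_int k)))"
    by (simp add: ft_def)
  also have "\<dots> = \<bar>2 powi (- j)\<bar> *\<^sub>R (LINT x|lborel. exp (- (\<i> * of_real ((of_int k * 2 powi (- j) + 2 powi (- j) * x) * \<xi>))) *
      of_real (2 powr (of_int j / 2) * \<psi> (2 powi j * (of_int k * 2 powi (- j) + 2 powi (- j) * x) - of_int k)))"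
    by (rule lborel_integral_real_affine) simp
  also have "\<dots> = \<bar>2 powi (- j)\<bar> *\<^sub>R (LINT x|lborel. (of_real (2 powr (of_int j / 2)) * exp (- (\<i> * of_real (of_int k * 2 powi (- j) * \<xi>)))) *
      (exp (- (\<i> * of_real (x * (2 powi (- j) * \<xi>)))) * of_real (\<psi> x)))"
  proof -
    have 1: "exp (- (\<i> * of_real ((of_int k * 2 powi (- j) + 2 powi (- j) * x) * \<xi>)))
      = exp (- (\<i> * of_real (of_int k * 2 powi (- j) * \<xi>))) * exp (- (\<i> * of_real (x * (2 powi (- j) * \<xi>))))" for x
      by (subst exp_add[symmetric]) (simp add: algebra_simps)
    have 2: "2 powi j * (of_int k * 2 powi (- j) + 2 powi (- j) * x) - of_int k = x" for x :: real
      by (simp add: power_int_minus field_simps)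
    show ?thesis
      by (intro arg_cong2[where f = scaleR] refl Bochner_Integration.integral_cong, subst 1, subst 2) simp
  qed
  also have "\<dots> = of_real (2 powi (- j) * 2 powr (of_int j / 2)) * exp (- (\<i> * of_real (of_int k * 2 powi (- j) * \<xi>))) *
      ft (\<lambda>x. of_real (\<psi> x)) (2 powi (- j) * \<xi>)"
    unfolding integral_mult_right_zero ft_def by (simp add: scaleR_conv_of_real)
  also have "2 powi (- j) * 2 powr (of_int j / 2) = (2 powr (- of_int j / 2) :: real)"
  proof -
    have "2 powi (- j) = (2 powr (of_int (- j)) :: real)" by (rule powr_real_of_int'[symmetric]) auto
    then show ?thesis by (simp flip: powr_add)
  qed
  finally show ?thesis
    by (simp add: psi_hat_def fourier_eq_ft mult_ac del: wav.simps)
qed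

lemma sqrt_2pi: "(2 * pi) powr (- (1/2)) = 1 / sqrt (2 * pi)"
  unfolding powr_minus by (subst powr_half_sqrt) (auto simp: inverse_eq_divide)

lemma ft_wav: "ft (wav (j, k)) \<xi> = of_real (sqrt (2 * pi)) * psi_hat \<psi> 2 j k \<xi>"
  unfolding psi_hat_eq_ft sqrt_2pi by simp

text \<open>Inversion for the wavelet, conjugated; \<open>wav\<close> is real, so no conjugate
  remains on the right. The transform is integrable because it is continuous with compact
  support.\<close>

lemma ft_cnj_psi_hat: "ft (\<lambda>\<xi>. cnj (psi_hat \<psi> 2 j k \<xi>)) y = of_real (sqrt (2 * pi)) * wav (j, k) y"
proof -
  obtain B where B: "\<And>x. \<bar>\<psi> x\<bar> \<le> B" using psi_bounded by blast
  have "(LINT \<xi>|lborel. exp (\<i> * of_real (y * \<xi>)) * ft (wav (j, k)) \<xi>) = 2 * pi * wav (j, k) y"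
  proof (rule ft_inversion[where f = "wav (j, k)" and B = "2 powr (of_int j / 2) * B"])
    show "integrable lborel (wav (j, k))" by (rule wav_integrable)
    show "continuous_on UNIV (wav (j, k))"
      unfolding wav.simps by (intro continuous_intros continuous_on_compose2[OF psi_continuous]) auto
    show "norm (wav (j, k) x) \<le> 2 powr (of_int j / 2) * B" for x
      using B by (simp add: norm_mult)
    show "integrable lborel (ft (wav (j, k)))"
      unfolding ft_wav[abs_def] by (intro integrable_mult_right psi_hat_integrable)
  qed
  moreover have "(LINT \<xi>|lborel. exp (\<i> * of_real (y * \<xi>)) * ft (wav (j, k)) \<xi>)
      = of_real (sqrt (2 * pi)) * (LINT \<xi>|lborel. exp (\<i> * of_real (y * \<xi>)) * psi_hat \<psi> 2 j k \<xi>)"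
    unfolding ft_wav integral_mult_right_zero[symmetric]
    by (rule Bochner_Integration.integral_cong) (rule refl, rule mult.left_commute)
  moreover have "complex_of_real (2 * pi) = of_real (sqrt (2 * pi)) * of_real (sqrt (2 * pi))"
    by (simp flip: of_real_mult)
  ultimately have 1: "of_real (sqrt (2 * pi)) * (LINT \<xi>|lborel. exp (\<i> * of_real (y * \<xi>)) * psi_hat \<psi> 2 j k \<xi>)
      = of_real (sqrt (2 * pi)) * (of_real (sqrt (2 * pi)) * wav (j, k) y)"
    by (simp only: mult.assoc)
  have "ft (\<lambda>\<xi>. cnj (psi_hat \<psi> 2 j k \<xi>)) y = (LINT \<xi>|lborel. cnj (exp (\<i> * of_real (y * \<xi>)) * psi_hat \<psi> 2 j k \<xi>))"
    unfolding ft_def by (simp only: complex_cnj_mult) (simp add: exp_cnj mult.commute[of _ y])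
  also have "\<dots> = cnj (LINT \<xi>|lborel. exp (\<i> * of_real (y * \<xi>)) * psi_hat \<psi> 2 j k \<xi>)"
    by (rule Bochner_Integration.integral_cnj)
  also have "(LINT \<xi>|lborel. exp (\<i> * of_real (y * \<xi>)) * psi_hat \<psi> 2 j k \<xi>) = of_real (sqrt (2 * pi)) * wav (j, k) y"
    by (rule mult_left_cancel[THEN iffD1, OF _ 1]) simp
  finally show ?thesis by simp
qed

lemma wav_real: "cnj (wav i x) = wav i x"
  by (cases i) simp

text \<open>The wavelet coefficients of \<open>ft u\<close> are sqrt (2 pi) times the integrals of u
  against \<open>psi_hat\<close>, and Plancherel turns the L^2 error of the expansion of
  \<open>ft u\<close> into that of the partial sums \<open>T\<close>. L^2 convergence identifies a
  limit only almost everywhere along a subsequence; as the series is assumed to have a pointwise sum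
  S on A, this is enough to force S = u there.\<close>

lemma psi_hat_completeness:
  fixes u :: "real \<Rightarrow> complex" and S :: "real \<Rightarrow> complex"
  assumes cont: "continuous_on UNIV u" and supp: "\<And>x. \<bar>x\<bar> > R \<Longrightarrow> u x = 0"
    and ftu: "integrable lborel (ft u)"
    and S: "\<And>x. x \<in> A \<Longrightarrow>
      ((\<lambda>(j, k). (LINT \<xi>|lborel. u \<xi> * psi_hat \<psi> 2 j k \<xi>) * cnj (psi_hat \<psi> 2 j k x)) has_sum S x) UNIV"
  shows "AE x in lborel. x \<in> A \<longrightarrow> S x = u x"
proof -
  have u: "integrable lborel u" by (rule integrable_continuous_compact_support[OF cont supp])
  have [measurable]: "u \<in> borel_measurable borel" using u by auto
  define e where "e = (\<lambda>(j, k). psi_hat \<psi> 2 j k)"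
  define b where "b i = (LINT \<xi>|lborel. u \<xi> * e i \<xi>)" for i
  have e_cont: "continuous_on UNIV (e i)" for i
    by (cases i) (simp add: e_def psi_hat_continuous)
  have e_supp: "\<exists>R. \<forall>x. \<bar>x\<bar> > R \<longrightarrow> e i x = 0" for i
    using psi_hat_compact_support[of "fst i" _ 2 "snd i"]
    by (intro exI[of _ "2 powi (fst i) * (8 * pi / 3)"]) (auto simp: e_def case_prod_unfold)
  have ftw: "ft (wav i) \<xi> = of_real (sqrt (2 * pi)) * e i \<xi>" for i \<xi>
    by (cases i) (simp add: e_def ft_wav del: wav.simps)
  have fte: "ft (\<lambda>\<xi>. cnj (e i \<xi>)) y = of_real (sqrt (2 * pi)) * wav i y" for i y
    by (cases i) (simp add: e_def ft_cnj_psi_hat del: wav.simps)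
  have wavb: "wav i \<in> Lspace 2" for i
    using wav_basis unfolding orthonormal_basis_L2_def by blast
  have ftu2: "ft u \<in> Lspace 2"
  proof -
    have "integrable lborel (\<lambda>y. (norm (ft u y))\<^sup>2)"
    proof (rule Bochner_Integration.integrable_bound)
      show "integrable lborel (\<lambda>y. (LINT x|lborel. norm (u x)) * norm (ft u y))"
        using ftu by simp
      show "AE y in lborel. norm ((norm (ft u y))\<^sup>2) \<le> norm ((LINT x|lborel. norm (u x)) * norm (ft u y))"
        using norm_ft_le[of u] by (intro AE_I2) (auto simp: power2_eq_square abs_mult intro!: mult_right_mono intro: order_trans)
    qed measurable
    then show ?thesis by (simp add: Lspace2_iff)
  qed
  have coef: "(LINT y|lborel. ft u y * cnj (wav i y)) = of_real (sqrt (2 * pi)) * b i" for i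
  proof -
    have "(LINT y|lborel. ft u y * wav i y) = (LINT x|lborel. u x * ft (wav i) x)"
      by (rule ft_multiplication[OF u wav_integrable])
    also have "\<dots> = of_real (sqrt (2 * pi)) * b i"
      unfolding ftw b_def integral_mult_right_zero[symmetric]
      by (rule Bochner_Integration.integral_cong) (rule refl, rule mult.left_commute)
    finally show ?thesis by (simp only: wav_real)
  qed
  define T where "T F x = (\<Sum>i\<in>F. b i * cnj (e i x))" for F x
  have planch: "integrable lborel (\<lambda>x. (norm (u x - T F x))\<^sup>2)"
     "(LINT y|lborel. (norm (ft u y - (\<Sum>i\<in>F. (LINT y|lborel. ft u y * cnj (wav i y)) * wav i y)))\<^sup>2)
      = 2 * pi * (LINT x|lborel. (norm (u x - T F x))\<^sup>2)" if F: "finite F" for F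
  proof -
    define w where "w x = u x - T F x" for x
    obtain RF where "\<forall>i\<in>F. \<forall>x. \<bar>x\<bar> > RF i \<longrightarrow> e i x = 0" using e_supp by metis
    then have RF: "e i x = 0" if "\<bar>x\<bar> > Max (insert R (RF ` F))" "i \<in> F" for i x
      using that F by (auto intro!: le_less_trans[OF _ that(1)])
    have ws: "w x = 0" if "\<bar>x\<bar> > Max (insert R (RF ` F))" for x
    proof -
      have "R \<le> Max (insert R (RF ` F))" using F by (intro Max_ge) auto
      then have "u x = 0" using that by (intro supp) linarith
      then show ?thesis using RF[OF that] by (simp add: w_def T_def)
    qed
    have wc: "continuous_on UNIV w"
      unfolding w_def T_def by (intro continuous_intros cont e_cont)
    obtain B where B: "\<And>x. norm (w x) \<le> B"
      using bounded_continuous_compact_support[OF wc ws] by blast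
    have wi: "integrable lborel w" by (rule integrable_continuous_compact_support[OF wc ws])
    have ei: "integrable lborel (\<lambda>x. cnj (e i x))" for i
      by (cases i) (auto simp: e_def intro!: psi_hat_integrable)
    have ft_w: "ft w y = ft u y - (\<Sum>i\<in>F. (LINT y|lborel. ft u y * cnj (wav i y)) * wav i y)" for y
    proof -
      have 1: "integrable lborel (\<lambda>x. exp (- (\<i> * of_real (x * y))) * (b i * cnj (e i x)))" for i
        by (intro integrable_exp_mult integrable_mult_right ei) simp
      have 2: "integrable lborel (\<lambda>x. exp (- (\<i> * of_real (x * y))) * u x)"
        by (intro integrable_exp_mult u) simp
      have 3: "(LINT x|lborel. exp (- (\<i> * of_real (x * y))) * (b i * cnj (e i x))) = b i * (of_real (sqrt (2 * pi)) * wav i y)" for i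
        unfolding fte[symmetric] ft_def integral_mult_right_zero[symmetric]
        by (rule Bochner_Integration.integral_cong) (rule refl, rule mult.left_commute)
      have "ft w y = (LINT x|lborel. exp (- (\<i> * of_real (x * y))) * u x
          - (\<Sum>i\<in>F. exp (- (\<i> * of_real (x * y))) * (b i * cnj (e i x))))"
        unfolding ft_def w_def T_def by (simp only: right_diff_distrib sum_distrib_left)
      also have "\<dots> = ft u y - (\<Sum>i\<in>F. b i * (of_real (sqrt (2 * pi)) * wav i y))"
        by (subst Bochner_Integration.integral_diff[OF 2 Bochner_Integration.integrable_sum[OF 1]],
            subst Bochner_Integration.integral_sum[OF 1]) (simp only: 3 ft_def)
      finally show ?thesis unfolding coef by (simp only: mult.assoc mult.left_commute)
    qed
    have "integrable lborel (ft w)"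
      unfolding ft_w[abs_def]
      by (intro Bochner_Integration.integrable_diff Bochner_Integration.integrable_sum integrable_mult_right ftu wav_integrable)
    from ft_plancherel[OF wi wc B this]
    show "(LINT y|lborel. (norm (ft u y - (\<Sum>i\<in>F. (LINT y|lborel. ft u y * cnj (wav i y)) * wav i y)))\<^sup>2)
      = 2 * pi * (LINT x|lborel. (norm (u x - T F x))\<^sup>2)"
      unfolding ft_w by (simp only: w_def)
    have "integrable lborel (\<lambda>x. (norm (w x))\<^sup>2)"
    proof (rule Bochner_Integration.integrable_bound)
      show "integrable lborel (\<lambda>x. B * norm (w x))" using wi by simp
      show "(\<lambda>x. (norm (w x))\<^sup>2) \<in> borel_measurable lborel"
        using borel_measurable_integrable[OF wi] by simp
      have "norm (w x) * norm (w x) \<le> \<bar>B\<bar> * norm (w x)" for x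
        using B[of x] by (intro mult_right_mono) auto
      then show "AE x in lborel. norm ((norm (w x))\<^sup>2) \<le> norm (B * norm (w x))"
        by (auto simp: power2_eq_square abs_mult)
    qed
    then show "integrable lborel (\<lambda>x. (norm (u x - T F x))\<^sup>2)" by (simp add: w_def)
  qed
  have "\<exists>F. finite F \<and> (\<forall>F'. finite F' \<longrightarrow> F \<subseteq> F' \<longrightarrow> (LINT x|lborel. (norm (u x - T F' x))\<^sup>2) < inverse (real (Suc n)))" for n
  proof -
    have "0 < 2 * pi * inverse (real (Suc n))" by simp
    from orthonormal_basis_L2_expansion[OF wav_basis ftu2 this]
    obtain F where F: "finite F" "\<And>F'. finite F' \<Longrightarrow> F \<subseteq> F' \<Longrightarrow>
        (LINT x|lborel. (norm (ft u x - (\<Sum>i\<in>F'. (LINT x|lborel. ft u x * cnj (wav i x)) * wav i x)))\<^sup>2)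
          < 2 * pi * inverse (real (Suc n))"
      by blast
    then show ?thesis using planch(2) by (intro exI[of _ F]) auto
  qed
  then obtain F0 where F0: "\<And>n. finite (F0 n)" "\<And>n F'. finite F' \<Longrightarrow> F0 n \<subseteq> F' \<Longrightarrow>
      (LINT x|lborel. (norm (u x - T F' x))\<^sup>2) < inverse (real (Suc n))"
    by metis
  \<comment> \<open>The sets \<open>F0 m\<close> make the L^2 error on \<open>G n\<close> smaller
    than 1 / (n + 1); the boxes make the sequence exhaust all indices, so that the partial sums
    along it also tend to S.\<close>
  define G where "G n = (\<Union>m\<le>n. F0 m) \<union> {- int n..int n} \<times> {- int n..int n}" for n
  have Gfin: "finite (G n)" for n by (simp add: G_def F0)
  have Glim: "filterlim G (finite_subsets_at_top UNIV) sequentially"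
  proof (rule exhausting_filterlim[OF Gfin])
    show "G n \<subseteq> G (Suc n)" for n by (auto simp: G_def le_Suc_eq)
    have "(j, k) \<in> G (nat (max \<bar>j\<bar> \<bar>k\<bar>))" for j k by (auto simp: G_def)
    then show "(\<Union>n. G n) = UNIV" by (auto intro: UN_I)
  qed
  have L1: "(\<lambda>n. LINT x|lborel. norm ((norm (u x - T (G n) x))\<^sup>2)) \<longlonglongrightarrow> 0"
  proof (rule Lim_null_comparison[OF _ LIMSEQ_inverse_real_of_nat])
    have "F0 n \<subseteq> G n" for n by (auto simp: G_def)
    then have "(LINT x|lborel. norm ((norm (u x - T (G n) x))\<^sup>2)) \<le> inverse (real (Suc n))" for n
      using F0(2)[OF Gfin, of n n] by (simp add: less_imp_le)
    then show "\<forall>\<^sub>F n in sequentially. norm (LINT x|lborel. norm ((norm (u x - T (G n) x))\<^sup>2)) \<le> inverse (real (Suc n))"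
      by (intro always_eventually allI) (simp add: abs_of_nonneg)
  qed
  from tendsto_L1_AE_subseq[OF planch(1)[OF Gfin] L1]
  obtain r where r: "strict_mono r" and AE: "AE x in lborel. (\<lambda>n. (norm (u x - T (G (r n)) x))\<^sup>2) \<longlonglongrightarrow> 0"
    by blast
  from AE show ?thesis
  proof (rule AE_mp, intro AE_I2 impI)
    fix x assume 1: "(\<lambda>n. (norm (u x - T (G (r n)) x))\<^sup>2) \<longlonglongrightarrow> 0" and x: "x \<in> A"
    have "(\<lambda>n. norm (u x - T (G (r n)) x)) \<longlonglongrightarrow> 0"
      using tendsto_real_sqrt[OF 1] by simp
    then have "(\<lambda>n. u x - T (G (r n)) x) \<longlonglongrightarrow> 0" by (rule tendsto_norm_zero_cancel)
    from tendsto_diff[OF tendsto_const this, of "u x"] have lim1: "(\<lambda>n. T (G (r n)) x) \<longlonglongrightarrow> u x" by simp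
    have "((\<lambda>i. b i * cnj (e i x)) has_sum S x) UNIV"
      using S[OF x] unfolding b_def e_def by (simp add: case_prod_unfold)
    then have "((\<lambda>F. T F x) \<longlongrightarrow> S x) (finite_subsets_at_top UNIV)"
      by (simp add: has_sum_def T_def)
    from filterlim_compose[OF this filterlim_compose[OF Glim filterlim_subseq[OF r]]]
    have "(\<lambda>n. T (G (r n)) x) \<longlonglongrightarrow> S x" by simp
    with lim1 show "S x = u x" by (rule LIMSEQ_unique[rotated])
  qed
qed

end

section \<open>The wavelet expansion of the one-dimensional kernel\<close>

text \<open>Peetre's inequality. The difference of the two sides is 1 + (2 x - y)^2 + 2 x^2 (x -
  y)^2.\<close>

lemma one_plus_square_le: "1 + y\<^sup>2 \<le> 2 * (1 + x\<^sup>2) * (1 + (x - y)\<^sup>2)" for x y :: real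
proof -
  have "0 \<le> (2 * x - y)\<^sup>2" "0 \<le> x\<^sup>2 * (x - y)\<^sup>2" by auto
  moreover have "2 * (1 + x\<^sup>2) * (1 + (x - y)\<^sup>2) = 1 + y\<^sup>2 + (2 * x - y)\<^sup>2 + 1 + 2 * (x\<^sup>2 * (x - y)\<^sup>2)"
    by (simp add: power2_eq_square algebra_simps)
  ultimately show ?thesis by linarith
qed

text \<open>Uniformity in y comes from replacing y by its floor, at the cost of a factor 3, and
  shifting the summation index; the two signs of the integers double the series over the
  naturals.\<close>

lemma sum_int_inverse_square_bound:
  "\<exists>K\<ge>0. \<forall>y F. finite F \<longrightarrow> (\<Sum>k\<in>F. 1 / (1 + (y - real_of_int k)\<^sup>2)) \<le> K"
proof -
  have summ: "summable (\<lambda>n. 1 / (1 + (real n)\<^sup>2))"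
  proof (rule summable_comparison_test_ev)
    show "\<forall>\<^sub>F n in sequentially. norm (1 / (1 + (real n)\<^sup>2)) \<le> inverse ((real n)\<^sup>2)"
      by (intro eventually_sequentiallyI[of 1]) (auto simp: field_simps add_pos_nonneg abs_of_nonneg)
    show "summable (\<lambda>n. inverse ((real n)\<^sup>2))"
      using inverse_power_summable[of 2, where 'a = real] by simp
  qed
  define K0 where "K0 = (\<Sum>n. 1 / (1 + (real n)\<^sup>2))"
  have K0: "(\<Sum>m\<in>F. 1 / (1 + (real_of_int m)\<^sup>2)) \<le> 2 * K0" if F: "finite F" for F :: "int set"
  proof -
    define N where "N = Suc (Max (insert 0 ((\<lambda>m. nat \<bar>m\<bar>) ` F)))"
    have N: "nat \<bar>m\<bar> < N" if "m \<in> F" for m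
      unfolding N_def less_Suc_eq_le using that F by (intro Max_ge) auto
    have "F \<subseteq> int ` {..<N} \<union> (\<lambda>n. - int n) ` {..<N}"
    proof
      fix m assume m: "m \<in> F"
      show "m \<in> int ` {..<N} \<union> (\<lambda>n. - int n) ` {..<N}"
        using N[OF m] by (cases m rule: int_cases2) auto
    qed
    then have "(\<Sum>m\<in>F. 1 / (1 + (real_of_int m)\<^sup>2)) \<le> (\<Sum>m\<in>int ` {..<N} \<union> (\<lambda>n. - int n) ` {..<N}. 1 / (1 + (real_of_int m)\<^sup>2))"
      by (intro sum_mono2) auto
    also have "\<dots> \<le> (\<Sum>m\<in>int ` {..<N}. 1 / (1 + (real_of_int m)\<^sup>2)) + (\<Sum>m\<in>(\<lambda>n. - int n) ` {..<N}. 1 / (1 + (real_of_int m)\<^sup>2))"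
      by (subst sum_Un) (auto intro!: sum_nonneg)
    also have "\<dots> = 2 * (\<Sum>n<N. 1 / (1 + (real n)\<^sup>2))"
      by (simp add: sum.reindex inj_on_def)
    also have "\<dots> \<le> 2 * K0"
      unfolding K0_def by (intro mult_left_mono sum_le_suminf summ) auto
    finally show ?thesis .
  qed
  have "(\<Sum>k\<in>F. 1 / (1 + (y - real_of_int k)\<^sup>2)) \<le> 3 * (2 * K0)" if F: "finite F" for y F
  proof -
    define n where "n = \<lfloor>y\<rfloor>"
    \<comment> \<open>With the fractional part \<theta> \<le> 1 one has m^2 \<le> 2 (\<theta> - m)^2
      + 2 \<theta>^2, hence 1 + m^2 \<le> 3 + 2 (\<theta> - m)^2, whence the 3.\<close>
    have "1 / (1 + (y - real_of_int k)\<^sup>2) \<le> 3 * (1 / (1 + (real_of_int (k - n))\<^sup>2))" for k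
    proof -
      define \<theta> m where "\<theta> = y - n" and "m = real_of_int (k - n)"
      have th: "0 \<le> \<theta>" "\<theta> \<le> 1" unfolding \<theta>_def n_def by linarith+
      have "m\<^sup>2 \<le> 2 * (\<theta> - m)\<^sup>2 + 2 * \<theta>\<^sup>2"
        using zero_le_power2[of "m - 2 * \<theta>"] by (simp add: power2_eq_square algebra_simps)
      moreover have "\<theta>\<^sup>2 \<le> 1" using th by (simp add: power_le_one)
      moreover have "1 + a \<le> 3 * (1 + b)" if "a \<le> 2 * b + 2 * c" "c \<le> 1" "0 \<le> b" for a b c :: real
      proof -
        have "1 + a \<le> 1 + (2 * b + 2 * 1)" using that by linarith
        then show ?thesis using that(3) by simp
      qed
      ultimately have "1 + m\<^sup>2 \<le> 3 * (1 + (\<theta> - m)\<^sup>2)" by (metis zero_le_power2)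
      moreover have "\<theta> - m = y - k" by (simp add: \<theta>_def m_def)
      ultimately show ?thesis unfolding m_def[symmetric]
        by (simp add: field_simps add_pos_nonneg)
    qed
    then have "(\<Sum>k\<in>F. 1 / (1 + (y - real_of_int k)\<^sup>2)) \<le> (\<Sum>k\<in>F. 3 * (1 / (1 + (real_of_int (k - n))\<^sup>2)))"
      by (intro sum_mono)
    also have "\<dots> = 3 * (\<Sum>m\<in>(\<lambda>k. k - n) ` F. 1 / (1 + (real_of_int m)\<^sup>2))"
      by (simp add: sum.reindex inj_on_def sum_distrib_left)
    also have "\<dots> \<le> 3 * (2 * K0)" using K0[of "(\<lambda>k. k - n) ` F"] F by simp
    finally show ?thesis .
  qed
  moreover have "0 \<le> K0" unfolding K0_def by (rule suminf_nonneg[OF summ]) auto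
  ultimately show ?thesis by (intro exI[of _ "3 * (2 * K0)"]) auto
qed

lemma divide_le_divideI: "a * y \<le> b * x \<Longrightarrow> 0 < x \<Longrightarrow> 0 < y \<Longrightarrow> a / x \<le> b / y" for a b x y :: real
  by (simp add: divide_simps mult_ac)

section \<open>Decay of \<open>psi_frac\<close> and of its increments\<close>

context meyer_wavelet
begin

text \<open>Up to a constant at most 1 the integral equals that of \<psi> x * ft q (x - y), a
  convolution. Peetre's inequality trades the decay in x - y for decay in y and a weight 1 + x^2,
  which \<psi> absorbs.\<close>

lemma psi_convolution_bound:
  assumes q: "integrable lborel q" and C: "\<And>y. norm (ft q y) \<le> C / (1 + y\<^sup>2)"
  shows "norm (LINT \<eta>|lborel. exp (\<i> * of_real (y * \<eta>)) * (fourier \<psi> \<eta> * q \<eta>))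
    \<le> 2 * C * (LINT x|lborel. (1 + x\<^sup>2) * \<bar>\<psi> x\<bar>) / (1 + y\<^sup>2)"
proof -
  have C0: "0 \<le> C" using order_trans[OF norm_ge_zero C[of 0]] by simp
  have [measurable]: "q \<in> borel_measurable borel" using q by auto
  have sh: "ft (\<lambda>\<eta>. exp (\<i> * of_real (y * \<eta>)) * q \<eta>) x = ft q (x - y)" for x
    unfolding ft_def
    by (rule Bochner_Integration.integral_cong[OF refl], subst mult.assoc[symmetric], subst exp_add[symmetric])
      (simp add: algebra_simps)
  have qe: "integrable lborel (\<lambda>\<eta>. exp (\<i> * of_real (y * \<eta>)) * q \<eta>)"
    by (intro integrable_exp_mult q) simp
  have "(LINT \<eta>|lborel. exp (\<i> * of_real (y * \<eta>)) * (fourier \<psi> \<eta> * q \<eta>))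
      = of_real (1 / sqrt (2 * pi)) * (LINT \<eta>|lborel. ft (\<lambda>x. of_real (\<psi> x)) \<eta> * (exp (\<i> * of_real (y * \<eta>)) * q \<eta>))"
    unfolding fourier_eq_ft sqrt_2pi integral_mult_right_zero[symmetric]
    by (rule Bochner_Integration.integral_cong) (auto simp: mult_ac)
  also have "(LINT \<eta>|lborel. ft (\<lambda>x. of_real (\<psi> x)) \<eta> * (exp (\<i> * of_real (y * \<eta>)) * q \<eta>))
      = (LINT x|lborel. of_real (\<psi> x) * ft q (x - y))"
    unfolding ft_multiplication[OF psi_integrable qe] sh ..
  finally have "norm (LINT \<eta>|lborel. exp (\<i> * of_real (y * \<eta>)) * (fourier \<psi> \<eta> * q \<eta>))
      = 1 / sqrt (2 * pi) * norm (LINT x|lborel. of_real (\<psi> x) * ft q (x - y))"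
    by (simp add: norm_mult norm_divide)
  also have "\<dots> \<le> 1 * norm (LINT x|lborel. of_real (\<psi> x) * ft q (x - y))"
  proof (rule mult_right_mono)
    have "1 \<le> 2 * pi" using pi_gt3 by simp
    then show "1 / sqrt (2 * pi) \<le> 1" by simp
  qed auto
  also have "\<dots> \<le> (LINT x|lborel. norm (complex_of_real (\<psi> x) * ft q (x - y)))"
    by (simp only: mult_1 integral_norm_bound)
  also have "\<dots> \<le> (LINT x|lborel. (2 * C / (1 + y\<^sup>2)) * ((1 + x\<^sup>2) * \<bar>\<psi> x\<bar>))"
  proof (rule integral_mono_AE')
    show "integrable lborel (\<lambda>x. (2 * C / (1 + y\<^sup>2)) * ((1 + x\<^sup>2) * \<bar>\<psi> x\<bar>))"
      by (intro integrable_mult_right psi_weighted_integrable)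
    have "norm (complex_of_real (\<psi> x) * ft q (x - y)) \<le> (2 * C / (1 + y\<^sup>2)) * ((1 + x\<^sup>2) * \<bar>\<psi> x\<bar>)" for x
    proof -
      have "C / (1 + (x - y)\<^sup>2) \<le> 2 * C * (1 + x\<^sup>2) / (1 + y\<^sup>2)"
      proof -
        have "C * (1 + y\<^sup>2) \<le> C * (2 * (1 + x\<^sup>2) * (1 + (x - y)\<^sup>2))"
          by (intro mult_left_mono one_plus_square_le C0)
        then show ?thesis
          by (intro divide_le_divideI) (auto simp: add_pos_nonneg mult_ac)
      qed
      then have "norm (ft q (x - y)) \<le> 2 * C * (1 + x\<^sup>2) / (1 + y\<^sup>2)"
        using C[of "x - y"] by linarith
      then have "\<bar>\<psi> x\<bar> * norm (ft q (x - y)) \<le> \<bar>\<psi> x\<bar> * (2 * C * (1 + x\<^sup>2) / (1 + y\<^sup>2))"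
        by (intro mult_left_mono) auto
      then show ?thesis by (simp add: norm_mult mult_ac)
    qed
    then show "AE x in lborel. norm (complex_of_real (\<psi> x) * ft q (x - y)) \<le> (2 * C / (1 + y\<^sup>2)) * ((1 + x\<^sup>2) * \<bar>\<psi> x\<bar>)"
      by auto
    show "AE x in lborel. 0 \<le> (2 * C / (1 + y\<^sup>2)) * ((1 + x\<^sup>2) * \<bar>\<psi> x\<bar>)"
      using C0 by auto
  qed
  finally show ?thesis by simp
qed

text \<open>The power of |\<eta>| is singular only at 0, where \<open>fourier \<psi>\<close>
  vanishes, so a cutoff \<open>w\<close> may replace it. Shifting the argument by b multiplies the
  integrand by exp (i b \<eta>), so the increment is an integral of the same kind, with (exp (i b
  \<eta>) - 1) * w \<eta> in place of w \<eta>.\<close>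

lemma psi_frac_decay:
  "\<exists>C\<ge>0. (\<forall>y. norm (psi_frac \<psi> \<alpha> v y) \<le> C / (1 + y\<^sup>2)) \<and>
     (\<forall>b y. norm (psi_frac \<psi> \<alpha> v (b + y) - psi_frac \<psi> \<alpha> v y) \<le> C * (\<bar>b\<bar> + b\<^sup>2) / (1 + y\<^sup>2))"
proof -
  define s where "s = v + 1 / \<alpha>"
  obtain w S where w: "C2 w" and weq: "\<And>x. 2 * pi / 3 \<le> \<bar>x\<bar> \<Longrightarrow> \<bar>x\<bar> \<le> 8 * pi / 3 \<Longrightarrow> w x = \<bar>x\<bar> powr (- s)"
    and wS: "\<And>x. \<bar>x\<bar> > S \<Longrightarrow> w x = 0" and S: "0 < S"
    using C2_cutoff_powr[of "2 * pi / 3" "8 * pi / 3" s] by auto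
  obtain C where C: "0 \<le> C" "\<And>y. norm (ft (\<lambda>x. of_real (w x)) y) \<le> C / (1 + y\<^sup>2)"
    "\<And>b y. norm (ft (\<lambda>x. (exp (\<i> * of_real (b * x)) - 1) * of_real (w x)) y) \<le> C * (\<bar>b\<bar> + b\<^sup>2) / (1 + y\<^sup>2)"
    using ft_C2_decay[OF w wS S] by blast
  have cw: "continuous_on UNIV (\<lambda>x. complex_of_real (w x))" by (intro continuous_intros C2_continuous w)
  have iw: "integrable lborel (\<lambda>x. complex_of_real (w x))"
    by (rule integrable_continuous_compact_support[OF cw, of S]) (simp add: wS)
  have iw': "integrable lborel (\<lambda>x. (exp (\<i> * of_real (b * x)) - 1) * complex_of_real (w x))" for b
    by (rule integrable_continuous_compact_support[of _ S]) (auto simp: wS intro!: continuous_intros C2_continuous w)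
  have frac: "psi_frac \<psi> \<alpha> v y = (LINT \<eta>|lborel. exp (\<i> * of_real (y * \<eta>)) * (fourier \<psi> \<eta> * of_real (w \<eta>)))" for y
    unfolding psi_frac_def s_def[symmetric]
  proof (rule Bochner_Integration.integral_cong[OF refl])
    show "exp (\<i> * of_real (y * \<eta>)) * (fourier \<psi> \<eta> / of_real (\<bar>\<eta>\<bar> powr s))
        = exp (\<i> * of_real (y * \<eta>)) * (fourier \<psi> \<eta> * of_real (w \<eta>))" for \<eta>
      using fourier_support[of \<eta>] weq[of \<eta>] by (cases "fourier \<psi> \<eta> = 0") (auto simp: powr_minus_divide)
  qed
  have int: "integrable lborel (\<lambda>\<eta>. exp (\<i> * of_real (y * \<eta>)) * (fourier \<psi> \<eta> * of_real (w \<eta>)))" for y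
    by (rule integrable_continuous_compact_support[of _ S])
      (auto simp: wS intro!: continuous_intros C2_continuous w fourier_continuous)
  have diff: "psi_frac \<psi> \<alpha> v (b + y) - psi_frac \<psi> \<alpha> v y
      = (LINT \<eta>|lborel. exp (\<i> * of_real (y * \<eta>)) * (fourier \<psi> \<eta> * ((exp (\<i> * of_real (b * \<eta>)) - 1) * of_real (w \<eta>))))" for b y
    unfolding frac Bochner_Integration.integral_diff[OF int int, symmetric]
    by (rule Bochner_Integration.integral_cong[OF refl]) (simp add: algebra_simps exp_add)
  define P where "P = (LINT x|lborel. (1 + x\<^sup>2) * \<bar>\<psi> x\<bar>)"
  have "0 \<le> P" unfolding P_def by (intro Bochner_Integration.integral_nonneg) auto
  moreover have "norm (psi_frac \<psi> \<alpha> v y) \<le> 2 * C * P / (1 + y\<^sup>2)" for y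
    unfolding frac P_def by (rule psi_convolution_bound[OF iw C(2)])
  moreover have "norm (psi_frac \<psi> \<alpha> v (b + y) - psi_frac \<psi> \<alpha> v y) \<le> (2 * C * P) * (\<bar>b\<bar> + b\<^sup>2) / (1 + y\<^sup>2)" for b y
  proof -
    have "(2 * C * P) * (\<bar>b\<bar> + b\<^sup>2) / (1 + y\<^sup>2) = 2 * (C * (\<bar>b\<bar> + b\<^sup>2)) * P / (1 + y\<^sup>2)"
      by (simp only: mult_ac)
    then show ?thesis
      unfolding diff P_def by (simp only: psi_convolution_bound[OF iw' C(3)])
  qed
  ultimately show ?thesis using C(1) by (intro exI[of _ "2 * C * P"]) auto
qed

end

definition harmonizable_kernel :: "real \<Rightarrow> real \<Rightarrow> real \<Rightarrow> real \<Rightarrow> complex" where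
  "harmonizable_kernel \<alpha> v t x = (exp (\<i> * of_real (t * x)) - 1) / of_real (\<bar>x\<bar> powr (v + 1 / \<alpha>))"

text \<open>The radii of the annulus have ratio 4 = 2^2, so all admissible j lie among three
  consecutive integers.\<close>

lemma card_dyadic_le_3:
  fixes a :: real
  assumes "finite J" and J: "\<And>j. j \<in> J \<Longrightarrow> a \<le> 2 powi (- j) * b \<and> 2 powi (- j) * b \<le> 4 * a" and "0 < a"
  shows "card J \<le> 3"
proof (cases "J = {}")
  case False
  define j0 where "j0 = Min J"
  have j0: "j0 \<in> J" "\<And>j. j \<in> J \<Longrightarrow> j0 \<le> j" unfolding j0_def using False assms(1) by auto
  have "J \<subseteq> {j0..j0 + 2}"
  proof
    fix j assume j: "j \<in> J"
    define n where "n = nat (j - j0)"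
    have jn: "- j0 = - j + int n" using j0(2)[OF j] by (simp add: n_def)
    have "2 powi (- j0) * b = 2 ^ n * (2 powi (- j) * b)"
      unfolding jn by (subst power_int_add) auto
    moreover have "2 ^ n * a \<le> 2 ^ n * (2 powi (- j) * b)" using J[OF j] by (intro mult_left_mono) auto
    ultimately have "2 ^ n * a \<le> 2 powi (- j0) * b" by (simp only:)
    also have "\<dots> \<le> 2 ^ 2 * a" using J[OF j0(1)] by simp
    finally have "2 ^ n * a \<le> 2 ^ 2 * a" .
    then have "(2::real) ^ n \<le> 2 ^ 2" using \<open>0 < a\<close> by (rule mult_right_le_imp_le)
    then have "n \<le> 2" by (simp only: power_increasing_iff)
    then show "j \<in> {j0..j0 + 2}" using j0(2)[OF j] by (auto simp: n_def)
  qed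
  then have "card J \<le> card {j0..j0 + 2}" by (intro card_mono) auto
  then show ?thesis by simp
qed simp

lemma two_powi_eq_powr: "2 powi j = (2::real) powr of_int j"
  by (simp add: powr_real_of_int')

section \<open>The terms of the one-dimensional series\<close>

context meyer_wavelet
begin

lemma fourier_vanish: "\<bar>\<xi>\<bar> > 8 * pi / 3 \<Longrightarrow> fourier \<psi> \<xi> = 0"
  using fourier_support[of \<xi>] by (cases "fourier \<psi> \<xi> = 0") auto

fun wcoef :: "real \<Rightarrow> real \<Rightarrow> real \<Rightarrow> int \<times> int \<Rightarrow> complex" where
  "wcoef \<alpha> v t (j, k) = of_real (2 powr (- (of_int j * v))) *
     (psi_frac \<psi> \<alpha> v (2 powi j * t - of_int k) - psi_frac \<psi> \<alpha> v (- of_int k))"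

text \<open>The factor belonging to one coordinate in the integrand whose stochastic integral is a
  summand of \<open>wavelet_partial_sum\<close>; see \<open>wterm_prod_eq\<close>.\<close>

fun wterm :: "real \<Rightarrow> real \<Rightarrow> real \<Rightarrow> int \<times> int \<Rightarrow> real \<Rightarrow> complex" where
  "wterm \<alpha> v t (j, k) x = wcoef \<alpha> v t (j, k) * cnj (psi_hat \<psi> \<alpha> j k x)"

text \<open>The factor \<open>min 1 (2 powi j)\<close> is the decay at coarse scales \<open>j < 0\<close>, produced by the
  subtraction of \<open>psi_frac \<psi> \<alpha> v (- of_int k)\<close>.\<close>

lemma wcoef_sum_bound:
  "\<exists>D\<ge>0. \<forall>j F. finite F \<longrightarrow>
     (\<Sum>k\<in>F. norm (wcoef \<alpha> v t (j, k))) \<le> D * (2 powr (- (of_int j * v)) * min 1 (2 powi j))"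
proof -
  obtain C where C0: "C \<ge> 0" and C1: "\<And>y. norm (psi_frac \<psi> \<alpha> v y) \<le> C / (1 + y\<^sup>2)"
    and C2: "\<And>b y. norm (psi_frac \<psi> \<alpha> v (b + y) - psi_frac \<psi> \<alpha> v y) \<le> C * (\<bar>b\<bar> + b\<^sup>2) / (1 + y\<^sup>2)"
    using psi_frac_decay[of \<alpha> v] by blast
  obtain K where K0: "K \<ge> 0" and K: "\<And>y F. finite F \<Longrightarrow> (\<Sum>k\<in>F. 1 / (1 + (y - real_of_int k)\<^sup>2)) \<le> K"
    using sum_int_inverse_square_bound by blast
  \<comment> \<open>The 2 serves the fine scales, where the two values of \<open>psi_frac\<close>
    are bounded separately; |t| + t^2 serves the coarse scales, where the increment is used.\<close>
  define D where "D = C * K * (2 + \<bar>t\<bar> + t\<^sup>2)"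
  have "(\<Sum>k\<in>F. norm (psi_frac \<psi> \<alpha> v (2 powi j * t - of_int k) - psi_frac \<psi> \<alpha> v (- of_int k)))
      \<le> D * min 1 (2 powi j)" if F: "finite F" for j F
  proof (cases "j \<ge> 0")
    case True
    have "(\<Sum>k\<in>F. norm (psi_frac \<psi> \<alpha> v (2 powi j * t - of_int k) - psi_frac \<psi> \<alpha> v (- of_int k)))
        \<le> (\<Sum>k\<in>F. C * (1 / (1 + (2 powi j * t - real_of_int k)\<^sup>2)) + C * (1 / (1 + (0 - real_of_int k)\<^sup>2)))"
      using C1[of "2 powi j * t - of_int _"] C1[of "- of_int _"]
      by (intro sum_mono order_trans[OF norm_triangle_ineq4] add_mono) auto
    also have "\<dots> \<le> C * K + C * K"
      unfolding sum.distrib sum_distrib_left[symmetric] using K[OF F] C0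
      by (intro add_mono mult_left_mono)
    also have "\<dots> \<le> D"
      using mult_nonneg_nonneg[OF mult_nonneg_nonneg[OF C0 K0], of "\<bar>t\<bar> + t\<^sup>2"] unfolding D_def by (simp add: algebra_simps)
    also have "D = D * min 1 (2 powi j)"
      using True by (simp add: one_le_power_int)
    finally show ?thesis .
  next
    case False
    define p :: real where "p = 2 powi j"
    have "2 powr real_of_int j \<le> 2 powr 0" using False by (intro powr_mono) auto
    then have p: "0 < p" "p \<le> 1" by (auto simp: p_def two_powi_eq_powr)
    \<comment> \<open>Since p \<le> 1, also p^2 \<le> p, so both parts of |b| + b^2 at b = p t are
      of order p.\<close>
    have pt: "\<bar>p * t\<bar> + (p * t)\<^sup>2 \<le> p * (\<bar>t\<bar> + t\<^sup>2)"
    proof -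
      have "p\<^sup>2 * t\<^sup>2 \<le> p * t\<^sup>2"
        using p by (intro mult_right_mono) (auto simp: power2_eq_square)
      then show ?thesis using p by (simp add: abs_mult power_mult_distrib algebra_simps)
    qed
    have "(\<Sum>k\<in>F. norm (psi_frac \<psi> \<alpha> v (p * t - of_int k) - psi_frac \<psi> \<alpha> v (- of_int k)))
        \<le> (\<Sum>k\<in>F. C * (p * (\<bar>t\<bar> + t\<^sup>2)) * (1 / (1 + (0 - real_of_int k)\<^sup>2)))"
    proof (rule sum_mono)
      fix k
      have "norm (psi_frac \<psi> \<alpha> v (p * t - of_int k) - psi_frac \<psi> \<alpha> v (- of_int k))
        \<le> C * (\<bar>p * t\<bar> + (p * t)\<^sup>2) / (1 + (- real_of_int k)\<^sup>2)"
        using C2[of "p * t" "- of_int k"] by simp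
      also have "\<dots> \<le> C * (p * (\<bar>t\<bar> + t\<^sup>2)) / (1 + (- real_of_int k)\<^sup>2)"
        by (intro divide_right_mono mult_left_mono pt C0) auto
      finally show "norm (psi_frac \<psi> \<alpha> v (p * t - of_int k) - psi_frac \<psi> \<alpha> v (- of_int k))
        \<le> C * (p * (\<bar>t\<bar> + t\<^sup>2)) * (1 / (1 + (0 - real_of_int k)\<^sup>2))" by simp
    qed
    also have "\<dots> \<le> C * (p * (\<bar>t\<bar> + t\<^sup>2)) * K"
      unfolding sum_distrib_left[symmetric] using C0 p by (intro mult_left_mono K F) auto
    also have "\<dots> \<le> D * p"
      using mult_nonneg_nonneg[OF mult_nonneg_nonneg[OF C0 K0], of p] p unfolding D_def by (simp add: algebra_simps)
    also have "D * p = D * min 1 (2 powi j)" using p by (simp add: p_def)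
    finally show ?thesis by (simp add: p_def)
  qed
  then have "(\<Sum>k\<in>F. norm (wcoef \<alpha> v t (j, k))) \<le> 2 powr (- (of_int j * v)) * (D * min 1 (2 powi j))" if "finite F" for j F
    using that by (simp add: norm_mult flip: sum_distrib_left)
  moreover have "0 \<le> D" using C0 K0 by (simp add: D_def)
  ultimately show ?thesis by (intro exI[of _ D]) (auto simp: mult_ac)
qed

text \<open>For given x at most three scales have a nonzero term, and at these 2^j is comparable
  with |x|, which converts the bound of \<open>wcoef_sum_bound\<close> into one in x.\<close>

lemma wterm_sum_bound:
  assumes "0 < v" "0 < \<alpha>"
  shows "\<exists>D\<ge>0. \<forall>x G. finite G \<longrightarrow>
    (\<Sum>i\<in>G. norm (wterm \<alpha> v t i x)) \<le> D * (\<bar>x\<bar> powr (- (v + 1 / \<alpha>)) * min 1 \<bar>x\<bar>)"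
proof -
  define s where "s = v + 1 / \<alpha>"
  have s: "0 < s" using assms by (simp add: s_def add_pos_pos)
  obtain D where D0: "D \<ge> 0" and D: "\<And>j F. finite F \<Longrightarrow>
     (\<Sum>k\<in>F. norm (wcoef \<alpha> v t (j, k))) \<le> D * (2 powr (- (of_int j * v)) * min 1 (2 powi j))"
    using wcoef_sum_bound[of \<alpha> v t] by blast
  obtain B where B: "\<And>\<xi>. norm (fourier \<psi> \<xi>) \<le> B"
    using bounded_continuous_compact_support[OF fourier_continuous fourier_vanish] by blast
  have B0: "0 \<le> B" using order_trans[OF norm_ge_zero B] .
  \<comment> \<open>The support gives |x| \<le> (8 pi / 3) 2^j, hence 2^j \<ge> |x| * 3 / (8 pi);
    raising this to the negative power - s produces the constant.\<close>
  define E where "E = B * D * (3 / (8 * pi)) powr (- s)"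
  have E0: "0 \<le> E" using B0 D0 by (simp add: E_def)
  have "(\<Sum>i\<in>G. norm (wterm \<alpha> v t i x)) \<le> (3 * E) * (\<bar>x\<bar> powr (- s) * min 1 \<bar>x\<bar>)" if G: "finite G" for x G
  proof -
    define J K where "J = fst ` G" and "K = snd ` G"
    have JK: "finite J" "finite K" "G \<subseteq> J \<times> K" using G by (force simp: J_def K_def)+
    define A where "A = {j. fourier \<psi> (2 powi (- j) * x) \<noteq> 0}"
    have A: "2 * pi / 3 \<le> 2 powi (- j) * \<bar>x\<bar>" "2 powi (- j) * \<bar>x\<bar> \<le> 8 * pi / 3" if "j \<in> A" for j
      using fourier_support[of "2 powi (- j) * x"] that by (auto simp: A_def abs_mult)
    have wt: "norm (wterm \<alpha> v t (j, k) x) = 2 powr (- of_int j / \<alpha>) * norm (fourier \<psi> (2 powi (- j) * x)) * norm (wcoef \<alpha> v t (j, k))" for j k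
      unfolding wterm.simps psi_hat_def norm_mult complex_mod_cnj norm_exp_ii norm_of_real
      by (simp del: wcoef.simps)
    have jt: "(\<Sum>k\<in>K. norm (wterm \<alpha> v t (j, k) x)) \<le> (if j \<in> A then E * (\<bar>x\<bar> powr (- s) * min 1 \<bar>x\<bar>) else 0)" for j
    proof (cases "j \<in> A")
      case False
      then show ?thesis by (simp add: wt A_def del: wterm.simps wcoef.simps)
    next
      case True
      define p :: real where "p = 2 powi j"
      have p0: "0 < p" by (simp add: p_def)
      have p1: "\<bar>x\<bar> * (3 / (8 * pi)) \<le> p" using A(2)[OF True] p0 by (simp add: p_def power_int_minus field_simps)
      have "2 * pi / 3 * p \<le> \<bar>x\<bar>" using A(1)[OF True] p0 by (simp add: p_def power_int_minus field_simps)
      \<comment> \<open>The inner radius 2 pi / 3 exceeds 1, which gives p \<le> |x| and so min 1 p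
        \<le> min 1 |x| without a constant.\<close>
      moreover have "1 * p \<le> 2 * pi / 3 * p" using pi_gt3 p0 by (intro mult_right_mono) auto
      ultimately have p2: "p \<le> \<bar>x\<bar>" by simp
      have x0: "\<bar>x\<bar> > 0" using p2 p0 by linarith
      have "(\<Sum>k\<in>K. norm (wterm \<alpha> v t (j, k) x))
          = 2 powr (- of_int j / \<alpha>) * norm (fourier \<psi> (2 powi (- j) * x)) * (\<Sum>k\<in>K. norm (wcoef \<alpha> v t (j, k)))"
        unfolding wt sum_distrib_left ..
      also have "\<dots> \<le> 2 powr (- of_int j / \<alpha>) * B * (D * (2 powr (- (of_int j * v)) * min 1 p))"
        unfolding p_def by (intro mult_mono D JK B mult_left_mono sum_nonneg mult_nonneg_nonneg B0) auto
      also have "\<dots> = B * D * (p powr (- s) * min 1 p)"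
      proof -
        have "p powr (- s) = 2 powr (- of_int j / \<alpha>) * 2 powr (- (of_int j * v))"
          unfolding p_def two_powi_eq_powr powr_powr s_def by (simp add: algebra_simps flip: powr_add)
        then show ?thesis by (simp only: mult_ac)
      qed
      also have "\<dots> \<le> B * D * ((\<bar>x\<bar> * (3 / (8 * pi))) powr (- s) * min 1 \<bar>x\<bar>)"
        using p0 p1 p2 B0 D0 s x0
        by (intro mult_left_mono mult_mono powr_mono2') auto
      also have "\<dots> = E * (\<bar>x\<bar> powr (- s) * min 1 \<bar>x\<bar>)"
        unfolding E_def by (subst powr_mult) (auto simp: mult_ac)
      finally show ?thesis using True by simp
    qed
    have "card (J \<inter> A) \<le> 3"
      by (rule card_dyadic_le_3[where a = "2 * pi / 3" and b = "\<bar>x\<bar>"]) (use JK A in auto)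
    have "(\<Sum>i\<in>G. norm (wterm \<alpha> v t i x)) \<le> (\<Sum>i\<in>J \<times> K. norm (wterm \<alpha> v t i x))"
      using JK by (intro sum_mono2) auto
    also have "\<dots> = (\<Sum>j\<in>J. \<Sum>k\<in>K. norm (wterm \<alpha> v t (j, k) x))"
      by (simp add: sum.cartesian_product case_prod_unfold del: wterm.simps)
    also have "\<dots> \<le> (\<Sum>j\<in>J. if j \<in> A then E * (\<bar>x\<bar> powr (- s) * min 1 \<bar>x\<bar>) else 0)"
      by (intro sum_mono jt)
    also have "\<dots> = card (J \<inter> A) * (E * (\<bar>x\<bar> powr (- s) * min 1 \<bar>x\<bar>))"
      using JK(1) by (simp add: sum.If_cases Int_def)
    also have "\<dots> \<le> 3 * (E * (\<bar>x\<bar> powr (- s) * min 1 \<bar>x\<bar>))"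
      using \<open>card (J \<inter> A) \<le> 3\<close> E0 by (intro mult_right_mono) auto
    finally show ?thesis by (simp add: mult.assoc)
  qed
  then show ?thesis using E0 by (intro exI[of _ "3 * E"]) (auto simp: s_def)
qed

lemma psi_frac_integrable:
  assumes "0 < v" "0 < \<alpha>"
  shows "integrable lborel (\<lambda>\<eta>. exp (\<i> * of_real (y * \<eta>)) * (fourier \<psi> \<eta> / of_real (\<bar>\<eta>\<bar> powr (v + 1 / \<alpha>))))"
proof (intro integrable_exp_mult(1))
  have s: "0 < v + 1 / \<alpha>" using assms by (simp add: add_pos_pos)
  have [measurable]: "fourier \<psi> \<in> borel_measurable borel"
    by (rule borel_measurable_continuous_onI) (rule fourier_continuous)
  have f: "integrable lborel (fourier \<psi>)"
    by (rule integrable_continuous_compact_support[OF fourier_continuous fourier_vanish])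
  show "integrable lborel (\<lambda>\<eta>. fourier \<psi> \<eta> / of_real (\<bar>\<eta>\<bar> powr (v + 1 / \<alpha>)))"
  proof (rule Bochner_Integration.integrable_bound)
    show "integrable lborel (\<lambda>\<eta>. fourier \<psi> \<eta> / of_real ((2 * pi / 3) powr (v + 1 / \<alpha>)))"
      using f by simp
    have "norm (fourier \<psi> \<eta>) / \<bar>\<eta>\<bar> powr (v + 1 / \<alpha>) \<le> norm (fourier \<psi> \<eta>) / (2 * pi / 3) powr (v + 1 / \<alpha>)" for \<eta>
    proof (cases "fourier \<psi> \<eta> = 0")
      case False
      then have "2 * pi / 3 \<le> \<bar>\<eta>\<bar>" using fourier_support by blast
      moreover have "0 < 2 * pi / 3" by simp
      ultimately have "0 < \<bar>\<eta>\<bar>" "(2 * pi / 3) powr (v + 1 / \<alpha>) \<le> \<bar>\<eta>\<bar> powr (v + 1 / \<alpha>)"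
        using s by (linarith, intro powr_mono2) auto
      then show ?thesis
        by (intro divide_left_mono mult_pos_pos) auto
    qed simp
    then show "AE \<eta> in lborel. norm (fourier \<psi> \<eta> / of_real (\<bar>\<eta>\<bar> powr (v + 1 / \<alpha>)))
        \<le> norm (fourier \<psi> \<eta> / of_real ((2 * pi / 3) powr (v + 1 / \<alpha>)))"
      by (intro AE_I2) (simp add: norm_divide)
  qed measurable
qed simp

text \<open>Only the values of \<open>u\<close> at the frequencies of scale \<open>j\<close> matter, so the kernel, which need not
  be square integrable, may be cut off.\<close>

lemma wterm_eq_coefficient:
  assumes "0 < v" "0 < \<alpha>"
    and u: "\<And>\<xi>. 2 * pi / 3 \<le> 2 powi (- j) * \<bar>\<xi>\<bar> \<Longrightarrow> 2 powi (- j) * \<bar>\<xi>\<bar> \<le> 8 * pi / 3 \<Longrightarrow> u \<xi> = harmonizable_kernel \<alpha> v t \<xi>"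
  shows "wterm \<alpha> v t (j, k) x = (LINT \<xi>|lborel. u \<xi> * psi_hat \<psi> 2 j k \<xi>) * cnj (psi_hat \<psi> 2 j k x)"
proof -
  define s where "s = v + 1 / \<alpha>"
  define p :: real where "p = 2 powi j"
  have p: "0 < p" "2 powi (- j) = 1 / p" "p powr a = 2 powr (of_int j * a)" for a
    by (auto simp: p_def power_int_minus divide_inverse two_powi_eq_powr powr_powr)
  have "psi_frac \<psi> \<alpha> v (p * t - of_int k) - psi_frac \<psi> \<alpha> v (- of_int k)
      = (LINT \<eta>|lborel. (exp (\<i> * of_real (p * t * \<eta>)) - 1) / of_real (\<bar>\<eta>\<bar> powr s) * exp (- (\<i> * of_real (of_int k * \<eta>))) * fourier \<psi> \<eta>)"
    unfolding psi_frac_def Bochner_Integration.integral_diff[OF psi_frac_integrable psi_frac_integrable, OF assms(1,2) assms(1,2), symmetric] s_def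
  proof (rule Bochner_Integration.integral_cong[OF refl])
    fix \<eta>
    have e1: "exp (\<i> * of_real ((p * t - of_int k) * \<eta>)) = exp (\<i> * of_real (p * t * \<eta>)) * exp (- (\<i> * of_real (of_int k * \<eta>)))"
      by (subst exp_add[symmetric]) (simp add: algebra_simps)
    have e2: "exp (\<i> * of_real (- of_int k * \<eta>)) = exp (- (\<i> * of_real (of_int k * \<eta>)))"
      by simp
    have "a * b * (f / q) - b * (f / q) = (a - 1) / q * b * f" for a b f q :: complex
      by (simp add: divide_inverse algebra_simps)
    then show "exp (\<i> * of_real ((p * t - of_int k) * \<eta>)) * (fourier \<psi> \<eta> / of_real (\<bar>\<eta>\<bar> powr (v + 1 / \<alpha>)))
        - exp (\<i> * of_real (- of_int k * \<eta>)) * (fourier \<psi> \<eta> / of_real (\<bar>\<eta>\<bar> powr (v + 1 / \<alpha>)))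
        = (exp (\<i> * of_real (p * t * \<eta>)) - 1) / of_real (\<bar>\<eta>\<bar> powr (v + 1 / \<alpha>)) * exp (- (\<i> * of_real (of_int k * \<eta>))) * fourier \<psi> \<eta>"
      unfolding e1 e2 .
  qed
  \<comment> \<open>Rescaling by 2^j moves the frequency annulus of \<psi> to that of scale j and
    makes the phase exp (i t \<xi>) independent of j.\<close>
  also have "\<dots> = \<bar>1 / p\<bar> *\<^sub>R (LINT \<xi>|lborel. (exp (\<i> * of_real (p * t * (0 + 1 / p * \<xi>))) - 1) / of_real (\<bar>0 + 1 / p * \<xi>\<bar> powr s) *
      exp (- (\<i> * of_real (of_int k * (0 + 1 / p * \<xi>)))) * fourier \<psi> (0 + 1 / p * \<xi>))"
    by (rule lborel_integral_real_affine) (use p in simp)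
  also have "\<dots> = \<bar>1 / p\<bar> *\<^sub>R (LINT \<xi>|lborel. of_real (p powr (s + 1 / 2)) * (u \<xi> * psi_hat \<psi> 2 j k \<xi>))"
  proof (intro arg_cong2[where f = scaleR] refl Bochner_Integration.integral_cong)
    fix \<xi>
    define F where "F = fourier \<psi> (1 / p * \<xi>)"
    define e where "e = exp (- (\<i> * complex_of_real (of_int k * (1 / p * \<xi>))))"
    \<comment> \<open>Where F = 0 nothing is known about u, but both integrands are 0 there.\<close>
    have F0: "F \<noteq> 0 \<Longrightarrow> u \<xi> = (exp (\<i> * of_real (t * \<xi>)) - 1) / of_real (\<bar>\<xi>\<bar> powr s)"
      using fourier_support[of "1 / p * \<xi>"] u[of \<xi>] p by (simp add: F_def abs_mult harmonizable_kernel_def s_def)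
    have l: "\<bar>1 / p * \<xi>\<bar> powr s = \<bar>\<xi>\<bar> powr s / p powr s" "p * t * (1 / p * \<xi>) = t * \<xi>" "0 + 1 / p * \<xi> = 1 / p * \<xi>"
      using p(1) by (simp_all add: abs_mult powr_divide)
    have ph: "psi_hat \<psi> 2 j k \<xi> = of_real (p powr (- 1 / 2)) * e * F"
      unfolding psi_hat_def p(2) p(3) e_def F_def by (simp add: mult.assoc)
    have pp: "p powr s = p powr (s + 1 / 2) * p powr (- 1 / 2)" by (simp flip: powr_add)
    show "(exp (\<i> * of_real (p * t * (0 + 1 / p * \<xi>))) - 1) / of_real (\<bar>0 + 1 / p * \<xi>\<bar> powr s) *
        exp (- (\<i> * of_real (of_int k * (0 + 1 / p * \<xi>)))) * fourier \<psi> (0 + 1 / p * \<xi>)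
        = of_real (p powr (s + 1 / 2)) * (u \<xi> * psi_hat \<psi> 2 j k \<xi>)"
    proof (cases "F = 0")
      case True
      then show ?thesis unfolding l ph F_def[symmetric] by simp
    next
      case False
      have "a / of_real (X / (A * B)) * e * F = of_real A * (a / of_real X * (of_real B * e * F))" for a X A B
        by (simp add: field_simps)
      then show ?thesis unfolding l ph F_def[symmetric] e_def[symmetric] F0[OF False] pp by blast
    qed
  qed
  also have "\<dots> = of_real (p powr (s - 1 / 2)) * (LINT \<xi>|lborel. u \<xi> * psi_hat \<psi> 2 j k \<xi>)"
  proof -
    have "\<bar>1 / p\<bar> * p powr (s + 1 / 2) = p powr (- 1) * p powr (s + 1 / 2)"
      using p by (simp add: powr_minus_divide)
    also have "\<dots> = p powr (s - 1 / 2)" unfolding powr_add[symmetric] by simp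
    finally have "complex_of_real \<bar>1 / p\<bar> * of_real (p powr (s + 1 / 2)) = of_real (p powr (s - 1 / 2))"
      by (simp only: of_real_mult[symmetric])
    then show ?thesis
      unfolding scaleR_conv_of_real integral_mult_right_zero mult.assoc[symmetric, of "of_real \<bar>1 / p\<bar>"] by (simp only:)
  qed
  finally have 1: "wcoef \<alpha> v t (j, k) = of_real (2 powr (- (of_int j * v)) * p powr (s - 1 / 2)) * (LINT \<xi>|lborel. u \<xi> * psi_hat \<psi> 2 j k \<xi>)"
    by (simp add: p_def)
  have 2: "psi_hat \<psi> \<alpha> j k x = of_real (2 powr (- of_int j / \<alpha>) * 2 powr (of_int j / 2)) * psi_hat \<psi> 2 j k x"
  proof -
    have "2 powr (- of_int j / \<alpha>) = 2 powr (- of_int j / \<alpha>) * 2 powr (of_int j / 2) * 2 powr (- of_int j / 2)"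
      by (simp add: mult.assoc flip: powr_add)
    then have "complex_of_real (2 powr (- of_int j / \<alpha>)) = of_real (2 powr (- of_int j / \<alpha>) * 2 powr (of_int j / 2)) * of_real (2 powr (- of_int j / 2))"
      by (simp only: of_real_mult[symmetric])
    then show ?thesis unfolding psi_hat_def by (simp only: mult.assoc)
  qed
  \<comment> \<open>The exponents of 2^j add up to - v + (s - 1/2) - 1 / \<alpha> + 1/2 = 0: passing
    from normalisation \<alpha> to normalisation 2 changes coefficient and basis function by inverse
    factors.\<close>
  have "2 powr (- (of_int j * v)) * p powr (s - 1 / 2) * (2 powr (- of_int j / \<alpha>) * 2 powr (of_int j / 2)) = 1"
    unfolding p powr_add[symmetric] by (simp add: s_def algebra_simps)
  then have 3: "complex_of_real (2 powr (- (of_int j * v)) * p powr (s - 1 / 2)) * of_real (2 powr (- of_int j / \<alpha>) * 2 powr (of_int j / 2)) = 1"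
    by (metis of_real_1 of_real_mult)
  have "wterm \<alpha> v t (j, k) x = (of_real (2 powr (- (of_int j * v)) * p powr (s - 1 / 2)) * of_real (2 powr (- of_int j / \<alpha>) * 2 powr (of_int j / 2)))
      * ((LINT \<xi>|lborel. u \<xi> * psi_hat \<psi> 2 j k \<xi>) * cnj (psi_hat \<psi> 2 j k x))"
    unfolding wterm.simps 1 2 complex_cnj_mult complex_cnj_complex_of_real by (simp only: mult_ac)
  then show ?thesis unfolding 3 by simp
qed

end

section \<open>Integrability of the majorant\<close>

lemma set_integrable_lborel_nonneg:
  fixes f :: "real \<Rightarrow> real"
  assumes "f integrable_on S" "\<And>x. x \<in> S \<Longrightarrow> 0 \<le> f x" "S \<in> sets borel" "f \<in> borel_measurable borel"
  shows "integrable lborel (\<lambda>x. indicator S x * f x)"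
proof -
  have [measurable]: "S \<in> sets borel" "f \<in> borel_measurable borel" by fact+
  have "integrable (completion lborel) (\<lambda>x. indicator S x * f x)"
    using nonnegative_absolutely_integrable_1[OF assms(1,2)] by (simp add: set_integrable_def)
  then show ?thesis by (subst (asm) integrable_completion) measurable
qed

text \<open>The power is \<alpha> (1 - v) - 1 near 0 and - \<alpha> v - 1 at infinity; v < 1 gives
  integrability at 0 and v > 0 at infinity.\<close>

lemma integrable_kernel_bound:
  assumes v: "0 < v" "v < 1" and \<alpha>: "0 < \<alpha>"
  shows "integrable lborel (\<lambda>x::real. (\<bar>x\<bar> powr (- (v + 1 / \<alpha>)) * min 1 \<bar>x\<bar>) powr \<alpha>)"
proof -
  define a where "a = \<alpha> * (1 - v) - 1"
  define e where "e = - \<alpha> * v - 1"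
  have a: "a > -1" and e: "e < -1" using v \<alpha> by (simp_all add: a_def e_def)
  define F where "F x = indicator {0..1} x * x powr a + indicator {1..} x * x powr e" for x :: real
  have F: "integrable lborel F" unfolding F_def
    using integrable_on_powr_from_0[OF a, of 1] has_integral_powr_to_inf[OF e, of 1]
    by (intro Bochner_Integration.integrable_add set_integrable_lborel_nonneg) (auto simp: integrable_on_def)
  have F': "integrable lborel (\<lambda>x. F (- x))"
    using lborel_integrable_real_affine[OF F, of "-1" 0] by simp
  show ?thesis
  proof (rule Bochner_Integration.integrable_bound[OF Bochner_Integration.integrable_add[OF F F']])
    have "(\<bar>x\<bar> powr (- (v + 1 / \<alpha>)) * min 1 \<bar>x\<bar>) powr \<alpha> \<le> F x + F (- x)" for x
    proof -
      have F0: "0 \<le> F y" for y by (auto simp: F_def)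
      have Fabs: "F \<bar>x\<bar> \<le> F x + F (- x)" using F0[of x] F0[of "-x"] by (cases "x \<ge> 0") auto
      have s: "(v + 1 / \<alpha>) * \<alpha> = v * \<alpha> + 1" using \<alpha> by (simp add: field_simps)
      have "(y powr (- (v + 1 / \<alpha>)) * min 1 y) powr \<alpha> \<le> F y" if y: "0 < y" for y
      proof (cases "y \<le> 1")
        case True
        have "y powr (- (v + 1 / \<alpha>)) * min 1 y = y powr (- (v + 1 / \<alpha>)) * y powr 1" using True y by simp
        then have "(y powr (- (v + 1 / \<alpha>)) * min 1 y) powr \<alpha> = y powr ((- (v + 1 / \<alpha>) + 1) * \<alpha>)"
          by (simp only: powr_powr flip: powr_add)
        also have "(- (v + 1 / \<alpha>) + 1) * \<alpha> = a" using s by (simp add: a_def algebra_simps)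
        finally show ?thesis using True y by (simp add: F_def)
      next
        case False
        then have "(y powr (- (v + 1 / \<alpha>)) * min 1 y) powr \<alpha> = y powr (- (v + 1 / \<alpha>) * \<alpha>)"
          by (simp add: powr_powr)
        also have "- (v + 1 / \<alpha>) * \<alpha> = e" using s by (simp add: e_def algebra_simps)
        finally show ?thesis using False by (simp add: F_def)
      qed
      from this[of "\<bar>x\<bar>"] Fabs F0[of x] F0[of "-x"] show ?thesis by (cases "x = 0") auto
    qed
    then show "AE x in lborel. norm ((\<bar>x\<bar> powr (- (v + 1 / \<alpha>)) * min 1 \<bar>x\<bar>) powr \<alpha>) \<le> norm (F x + F (- x))"
      by (intro AE_I2) (simp add: order_trans[OF _ abs_ge_self])
  qed measurable
qed

section \<open>The pointwise expansion of the one-dimensional kernel\<close>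

context meyer_wavelet
begin

lemma wterm_abs_summable:
  assumes "0 < v" "0 < \<alpha>"
  shows "(\<lambda>i. norm (wterm \<alpha> v t i x)) summable_on UNIV"
proof -
  obtain D where "\<And>x G. finite G \<Longrightarrow> (\<Sum>i\<in>G. norm (wterm \<alpha> v t i x)) \<le> D * (\<bar>x\<bar> powr (- (v + 1 / \<alpha>)) * min 1 \<bar>x\<bar>)"
    using wterm_sum_bound[OF assms, of t] by blast
  then show ?thesis by (intro nonneg_bdd_above_summable_on) (auto intro!: bdd_aboveI2)
qed

text \<open>The cutoff depends on the annulus, but the sum S does not, so the almost everywhere
  identities on countably many annuli covering all x \<noteq> 0 can be combined.\<close>

lemma harmonizable_kernel_expansion:
  assumes v: "0 < v" and \<alpha>: "0 < \<alpha>"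
  shows "AE x in lborel. ((\<lambda>i. wterm \<alpha> v t i x) has_sum harmonizable_kernel \<alpha> v t x) UNIV"
proof -
  define S where "S x = infsum (\<lambda>i. wterm \<alpha> v t i x) UNIV" for x
  have S: "((\<lambda>i. wterm \<alpha> v t i x) has_sum S x) UNIV" for x
    unfolding S_def by (rule has_sum_infsum, rule abs_summable_summable, rule wterm_abs_summable[OF v \<alpha>])
  have AE_n: "AE x in lborel. 1 / real (Suc n) \<le> \<bar>x\<bar> \<and> \<bar>x\<bar> \<le> real (Suc n) \<longrightarrow> S x = harmonizable_kernel \<alpha> v t x" for n
  proof -
    \<comment> \<open>Two frequencies seen by the same scale differ at most by the factor 4, the
      ratio of the radii of the support annulus; enlarging the annulus by 4 on both sides keeps the
      cutoff exact on all frequencies that affect x.\<close>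
    define c where "c = 1 / (4 * real (Suc n))"
    define R where "R = 4 * real (Suc n)"
    have cR: "0 < c" "0 < R" by (simp_all add: c_def R_def)
    obtain w Q where wQ': "C2 w \<and> (\<forall>x. c \<le> \<bar>x\<bar> \<and> \<bar>x\<bar> \<le> R \<longrightarrow> w x = \<bar>x\<bar> powr (- (v + 1 / \<alpha>))) \<and>
        (\<forall>x. \<bar>x\<bar> > Q \<longrightarrow> w x = 0) \<and> 0 < Q"
      using C2_cutoff_powr[OF cR, of "v + 1 / \<alpha>"] by (elim exE)
    have w: "C2 w" and Q: "0 < Q" using wQ' by (simp_all only:)
    have weq: "w x = \<bar>x\<bar> powr (- (v + 1 / \<alpha>))" if "c \<le> \<bar>x\<bar>" "\<bar>x\<bar> \<le> R" for x
      using wQ' that by (simp only: simp_thms)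
    have wQ: "w x = 0" if "\<bar>x\<bar> > Q" for x
      using wQ' that by (simp only: simp_thms)
    define u where "u x = (exp (\<i> * of_real (t * x)) - 1) * of_real (w x)" for x
    obtain C where C: "\<And>y. norm (ft u y) \<le> C * (\<bar>t\<bar> + t\<^sup>2) / (1 + y\<^sup>2)"
    proof (rule ft_C2_decay[OF w wQ Q])
      fix C assume "\<And>b y. norm (ft (\<lambda>x. (exp (\<i> * of_real (b * x)) - 1) * of_real (w x)) y) \<le> C * (\<bar>b\<bar> + b\<^sup>2) / (1 + y\<^sup>2)"
      then show thesis by (rule that[unfolded u_def[abs_def]])
    qed
    have u_eq: "u x = harmonizable_kernel \<alpha> v t x" if "c \<le> \<bar>x\<bar>" "\<bar>x\<bar> \<le> R" for x
      unfolding u_def weq[OF that] powr_minus harmonizable_kernel_def by (simp add: divide_inverse)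
    have cont: "continuous_on UNIV u" unfolding u_def by (intro continuous_intros C2_continuous w)
    have uQ: "u x = 0" if "\<bar>x\<bar> > Q" for x using wQ[OF that] by (simp add: u_def)
    have iu: "integrable lborel u" by (rule integrable_continuous_compact_support[OF cont uQ])
    then have [measurable]: "u \<in> borel_measurable borel" by auto
    have ftu: "integrable lborel (ft u)"
    proof (rule Bochner_Integration.integrable_bound)
      show "integrable lborel (\<lambda>y. C * (\<bar>t\<bar> + t\<^sup>2) * (1 / (1 + y\<^sup>2)))"
        by (intro integrable_mult_right integrable_inverse_1_plus_square')
      show "AE y in lborel. norm (ft u y) \<le> norm (C * (\<bar>t\<bar> + t\<^sup>2) * (1 / (1 + y\<^sup>2)))"
      proof (intro AE_I2)
        fix y
        have "norm (ft u y) \<le> C * (\<bar>t\<bar> + t\<^sup>2) * (1 / (1 + y\<^sup>2))" using C[of y] by simp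
        then show "norm (ft u y) \<le> norm (C * (\<bar>t\<bar> + t\<^sup>2) * (1 / (1 + y\<^sup>2)))"
          unfolding real_norm_def by (rule order_trans[OF _ abs_ge_self])
      qed
    qed measurable
    have hs: "((\<lambda>(j, k). (LINT \<xi>|lborel. u \<xi> * psi_hat \<psi> 2 j k \<xi>) * cnj (psi_hat \<psi> 2 j k x)) has_sum S x) UNIV"
      if x: "x \<in> {x. 1 / real (Suc n) \<le> \<bar>x\<bar> \<and> \<bar>x\<bar> \<le> real (Suc n)}" for x
    proof -
      have "wterm \<alpha> v t (j, k) x = (LINT \<xi>|lborel. u \<xi> * psi_hat \<psi> 2 j k \<xi>) * cnj (psi_hat \<psi> 2 j k x)" for j k
      proof (cases "fourier \<psi> (2 powi (- j) * x) = 0")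
        case True
        then show ?thesis by (simp add: psi_hat_def)
      next
        case False
        define p :: real where "p = 2 powi (- j)"
        have p: "0 < p" by (simp add: p_def)
        have 1: "2 * pi / 3 \<le> p * \<bar>x\<bar>" "p * \<bar>x\<bar> \<le> 8 * pi / 3"
          using fourier_support[OF False] p by (auto simp: abs_mult p_def)
        show ?thesis
        proof (rule wterm_eq_coefficient[OF v \<alpha>])
          fix \<xi> assume "2 * pi / 3 \<le> 2 powi (- j) * \<bar>\<xi>\<bar>" "2 powi (- j) * \<bar>\<xi>\<bar> \<le> 8 * pi / 3"
          then have "2 * pi / 3 \<le> p * \<bar>\<xi>\<bar>" "p * \<bar>\<xi>\<bar> \<le> 8 * pi / 3" by (simp_all only: p_def)
          then have "p * \<bar>\<xi>\<bar> \<le> 4 * (p * \<bar>x\<bar>)" "p * \<bar>x\<bar> \<le> 4 * (p * \<bar>\<xi>\<bar>)" using 1 by linarith+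
          then have "p * \<bar>\<xi>\<bar> \<le> p * (4 * \<bar>x\<bar>)" "p * \<bar>x\<bar> \<le> p * (4 * \<bar>\<xi>\<bar>)"
            by (simp_all only: mult.left_commute[of 4])
          then have "\<bar>\<xi>\<bar> \<le> 4 * \<bar>x\<bar>" "\<bar>x\<bar> \<le> 4 * \<bar>\<xi>\<bar>" using p by (auto dest: mult_left_le_imp_le)
          moreover have "4 * c = 1 / real (Suc n)" by (simp add: c_def del: of_nat_Suc)
          moreover have "1 / real (Suc n) \<le> \<bar>x\<bar>" "\<bar>x\<bar> \<le> real (Suc n)" using x by blast+
          ultimately have "c \<le> \<bar>\<xi>\<bar>" by linarith
          have "\<bar>\<xi>\<bar> \<le> 4 * \<bar>x\<bar>" by fact
          also have "\<dots> \<le> R" unfolding R_def using x by (intro mult_left_mono) auto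
          finally have "\<bar>\<xi>\<bar> \<le> R" .
          with \<open>c \<le> \<bar>\<xi>\<bar>\<close> show "u \<xi> = harmonizable_kernel \<alpha> v t \<xi>" by (rule u_eq)
        qed
      qed
      then have "(\<lambda>i. wterm \<alpha> v t i x) = (\<lambda>(j, k). (LINT \<xi>|lborel. u \<xi> * psi_hat \<psi> 2 j k \<xi>) * cnj (psi_hat \<psi> 2 j k x))"
        by (simp add: fun_eq_iff del: wterm.simps)
      with S[of x] show ?thesis by simp
    qed
    have "AE x in lborel. x \<in> {x. 1 / real (Suc n) \<le> \<bar>x\<bar> \<and> \<bar>x\<bar> \<le> real (Suc n)} \<longrightarrow> S x = u x"
      by (rule psi_hat_completeness[OF cont uQ ftu hs])
    then show ?thesis
    proof (rule AE_mp, intro AE_I2 impI)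
      fix x assume "x \<in> {x. 1 / real (Suc n) \<le> \<bar>x\<bar> \<and> \<bar>x\<bar> \<le> real (Suc n)} \<longrightarrow> S x = u x"
        and x: "1 / real (Suc n) \<le> \<bar>x\<bar> \<and> \<bar>x\<bar> \<le> real (Suc n)"
      then have "S x = u x" by simp
      moreover have "c \<le> 1 / real (Suc n)" "real (Suc n) \<le> R"
        unfolding c_def R_def by (intro divide_left_mono) auto
      then have "c \<le> \<bar>x\<bar>" "\<bar>x\<bar> \<le> R" using x by (blast intro: order_trans)+
      ultimately show "S x = harmonizable_kernel \<alpha> v t x" using u_eq by simp
    qed
  qed
  have "AE x in lborel. \<forall>n. 1 / real (Suc n) \<le> \<bar>x\<bar> \<and> \<bar>x\<bar> \<le> real (Suc n) \<longrightarrow> S x = harmonizable_kernel \<alpha> v t x"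
    unfolding AE_all_countable using AE_n by (rule allI)
  with AE_lborel_singleton[of "0 :: real"] show ?thesis
  proof eventually_elim
    case (elim x)
    then have x: "x \<noteq> 0" and *: "\<forall>n. 1 / real (Suc n) \<le> \<bar>x\<bar> \<and> \<bar>x\<bar> \<le> real (Suc n) \<longrightarrow> S x = harmonizable_kernel \<alpha> v t x"
      by (simp_all only: simp_thms)
    obtain m where m: "inverse (real (Suc m)) < \<bar>x\<bar>" using reals_Archimedean[of "\<bar>x\<bar>"] x by auto
    obtain n where n: "\<bar>x\<bar> < real n" using reals_Archimedean2 by blast
    have "1 / real (Suc (max m n)) \<le> 1 / real (Suc m)" by (intro divide_left_mono) auto
    then have "1 / real (Suc (max m n)) \<le> \<bar>x\<bar>" "\<bar>x\<bar> \<le> real (Suc (max m n))" using m n by (auto simp: inverse_eq_divide)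
    then have "S x = harmonizable_kernel \<alpha> v t x" using * by blast
    with S[of x] show "((\<lambda>i. wterm \<alpha> v t i x) has_sum harmonizable_kernel \<alpha> v t x) UNIV" by simp
  qed
qed

end

section \<open>Stable integrals converging to zero in probability\<close>

text \<open>For p < 1 there is no triangle inequality for the p-norm. Instead the sum is at most
  twice the larger summand in modulus, which works for every p > 0.\<close>

lemma Lspace_linear_combination:
  assumes p: "0 < p" and f: "f \<in> Lspace p" and g: "g \<in> Lspace p"
  shows "(\<lambda>x. a * f x + b * g x) \<in> Lspace p"
proof -
  have [measurable]: "f \<in> borel_measurable borel" "g \<in> borel_measurable borel"
    using f g by (auto simp: Lspace_def)
  have "integrable lborel (\<lambda>x. norm (a * f x + b * g x) powr p)"
  proof (rule Bochner_Integration.integrable_bound)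
    show "integrable lborel (\<lambda>x. (2 * norm a) powr p * norm (f x) powr p + (2 * norm b) powr p * norm (g x) powr p)"
      using f g by (auto simp: Lspace_def)
    have "norm (a * f x + b * g x) powr p \<le> (2 * norm a) powr p * norm (f x) powr p + (2 * norm b) powr p * norm (g x) powr p" for x
    proof -
      have "norm (a * f x + b * g x) \<le> 2 * norm (a * f x) \<or> norm (a * f x + b * g x) \<le> 2 * norm (b * g x)"
        using norm_triangle_ineq[of "a * f x" "b * g x"] by linarith
      then have "norm (a * f x + b * g x) powr p \<le> (2 * norm (a * f x)) powr p \<or> norm (a * f x + b * g x) powr p \<le> (2 * norm (b * g x)) powr p"
        using p by (meson powr_mono2 norm_ge_zero less_imp_le)
      moreover have "(2 * norm (a * f x)) powr p = (2 * norm a) powr p * norm (f x) powr p"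
        "(2 * norm (b * g x)) powr p = (2 * norm b) powr p * norm (g x) powr p"
        by (simp_all add: norm_mult powr_mult mult.assoc)
      ultimately show ?thesis by (auto intro: order_trans add_increasing add_increasing2)
    qed
    then show "AE x in lborel. norm (norm (a * f x + b * g x) powr p)
        \<le> norm ((2 * norm a) powr p * norm (f x) powr p + (2 * norm b) powr p * norm (g x) powr p)"
      by (intro AE_I2) (auto intro: order_trans[OF _ abs_ge_self])
  qed measurable
  then show ?thesis by (simp add: Lspace_def)
qed

lemma Lspace_zero: "0 < p \<Longrightarrow> (\<lambda>x. 0) \<in> Lspace p"
  by (simp add: Lspace_def)

lemma Lspace_sum:
  assumes "0 < p" "finite D" "\<And>i. i \<in> D \<Longrightarrow> f i \<in> Lspace p"
  shows "(\<lambda>x. \<Sum>i\<in>D. c i * f i x) \<in> Lspace p"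
  using assms(2,3)
proof (induction D)
  case (insert i D)
  then have "(\<lambda>x. c i * f i x + 1 * (\<Sum>i\<in>D. c i * f i x)) \<in> Lspace p"
    by (intro Lspace_linear_combination assms(1)) auto
  then show ?case using insert by simp
qed (simp add: Lspace_zero assms(1))

context rot_inv_stable_random_measure
begin

lemma integral_sum:
  assumes "0 < \<alpha>" "finite D" "\<And>i. i \<in> D \<Longrightarrow> f i \<in> Lspace \<alpha>"
  shows "AE \<omega> in M. I (\<lambda>x. \<Sum>i\<in>D. c i * f i x) \<omega> = (\<Sum>i\<in>D. c i * I (f i) \<omega>)"
  using assms(2,3)
proof (induction D)
  case empty
  \<comment> \<open>Linearity with both coefficients 0 yields I 0 = 0 almost surely.\<close>
  show ?case using integral_linear[OF Lspace_zero Lspace_zero, of 0 0] assms(1) by simp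
next
  case (insert i D)
  have "AE \<omega> in M. I (\<lambda>x. c i * f i x + 1 * (\<Sum>i\<in>D. c i * f i x)) \<omega> = c i * I (f i) \<omega> + 1 * I (\<lambda>x. \<Sum>i\<in>D. c i * f i x) \<omega>"
    using insert by (intro integral_linear Lspace_sum assms(1)) auto
  moreover have "AE \<omega> in M. I (\<lambda>x. \<Sum>i\<in>D. c i * f i x) \<omega> = (\<Sum>i\<in>D. c i * I (f i) \<omega>)"
    using insert by auto
  ultimately show ?case using insert by (auto elim!: AE_mp)
qed

text \<open>\<open>integral_char\<close> fixes the frequency 1; other frequencies are reached by
  applying it to u f, where the second summand \<open>0 * f x\<close> only brings the function into
  the shape of \<open>integral_linear\<close>.\<close>

lemma integral_char_scaled:
  assumes \<alpha>: "0 < \<alpha>" and f: "f \<in> Lspace \<alpha>"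
  shows "(LINT \<omega>|M. exp (\<i> * of_real (u * Re (I f \<omega>))))
    = of_real (exp (- (\<bar>u\<bar> powr \<alpha> * (LINT x|lborel. norm (f x) powr \<alpha>))))"
proof -
  have uf: "(\<lambda>x. of_real u * f x + 0 * f x) \<in> Lspace \<alpha>"
    by (rule Lspace_linear_combination[OF \<alpha> f f])
  have [measurable]: "I f \<in> borel_measurable M" "I (\<lambda>x. of_real u * f x + 0 * f x) \<in> borel_measurable M"
    by (intro integral_random_variable f uf)+
  have "AE \<omega> in M. I (\<lambda>x. of_real u * f x + 0 * f x) \<omega> = of_real u * I f \<omega> + 0 * I f \<omega>"
    by (rule integral_linear[OF f f])
  then have "AE \<omega> in M. exp (\<i> * complex_of_real (u * Re (I f \<omega>))) = exp (\<i> * of_real (Re (I (\<lambda>x. of_real u * f x + 0 * f x) \<omega>)))"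
    by (rule AE_mp) (intro AE_I2, simp)
  then have "(LINT \<omega>|M. exp (\<i> * of_real (u * Re (I f \<omega>)))) = (LINT \<omega>|M. exp (\<i> * of_real (Re (I (\<lambda>x. of_real u * f x + 0 * f x) \<omega>))))"
    by (intro integral_cong_AE) measurable
  also have "\<dots> = of_real (exp (- (LINT x|lborel. norm (of_real u * f x + 0 * f x) powr \<alpha>)))"
    by (rule integral_char[OF uf])
  also have "(LINT x|lborel. norm (of_real u * f x + 0 * f x) powr \<alpha>) = \<bar>u\<bar> powr \<alpha> * (LINT x|lborel. norm (f x) powr \<alpha>)"
    by (simp add: norm_mult powr_mult)
  finally show ?thesis .
qed

text \<open>exp (- X^2 / 2) is the mean of exp (i z X) over a standard normal z, and Fubini
  exchanges the two means.\<close>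

lemma expectation_gaussian:
  assumes \<alpha>: "0 < \<alpha>" and f: "f \<in> Lspace \<alpha>"
  shows "expectation (\<lambda>\<omega>. exp (- (Re (I f \<omega>))\<^sup>2 / 2))
    = (LINT z|std_normal_distribution. exp (- (\<bar>z\<bar> powr \<alpha> * (LINT x|lborel. norm (f x) powr \<alpha>))))"
proof -
  interpret N: prob_space std_normal_distribution
    by (rule prob_space_normal_density) simp
  interpret P: pair_prob_space M std_normal_distribution ..
  have [measurable]: "I f \<in> borel_measurable M" by (intro integral_random_variable f)
  have int: "integrable (M \<Otimes>\<^sub>M std_normal_distribution) (\<lambda>(\<omega>, z). exp (\<i> * complex_of_real (z * Re (I f \<omega>))))"
    by (rule P.integrable_const_bound[where B = 1]) (auto split: prod.splits)
  have "complex_of_real (expectation (\<lambda>\<omega>. exp (- (Re (I f \<omega>))\<^sup>2 / 2)))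
      = (LINT \<omega>|M. char std_normal_distribution (Re (I f \<omega>)))"
    unfolding char_std_normal_distribution by (simp only: integral_complex_of_real)
  also have "\<dots> = (LINT \<omega>|M. LINT z|std_normal_distribution. exp (\<i> * complex_of_real (z * Re (I f \<omega>))))"
    unfolding char_def by (simp only: mult.commute[of "Re _"])
  also have "\<dots> = (LINT z|std_normal_distribution. LINT \<omega>|M. exp (\<i> * complex_of_real (z * Re (I f \<omega>))))"
    using P.Fubini_integral[OF int] by simp
  also have "\<dots> = complex_of_real (LINT z|std_normal_distribution. exp (- (\<bar>z\<bar> powr \<alpha> * (LINT x|lborel. norm (f x) powr \<alpha>))))"
    unfolding integral_char_scaled[OF \<alpha> f] by (simp only: integral_complex_of_real)
  finally show ?thesis by (simp only: of_real_eq_iff)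
qed

text \<open>Markov's inequality for the bounded variable 1 - exp (- X^2 / 2), which is at least
  \<open>c\<close> where |X| > \<epsilon>. Its mean 1 - e n tends to 0 by dominated convergence in
  z.\<close>

lemma prob_Re_integral_tendsto_0:
  fixes f :: "nat \<Rightarrow> 'a \<Rightarrow> complex"
  assumes \<alpha>: "0 < \<alpha>" and f: "\<And>n. f n \<in> Lspace \<alpha>"
    and lim: "(\<lambda>n. LINT x|lborel. norm (f n x) powr \<alpha>) \<longlonglongrightarrow> 0" and \<epsilon>: "0 < \<epsilon>"
  shows "(\<lambda>n. prob {\<omega> \<in> space M. \<epsilon> < \<bar>Re (I (f n) \<omega>)\<bar>}) \<longlonglongrightarrow> 0"
proof -
  define e where "e n = (LINT z|std_normal_distribution. exp (- (\<bar>z\<bar> powr \<alpha> * (LINT x|lborel. norm (f n x) powr \<alpha>))))" for n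
  interpret N: prob_space std_normal_distribution
    by (rule prob_space_normal_density) simp
  have "e \<longlonglongrightarrow> (LINT z|std_normal_distribution. 1)"
    unfolding e_def
  proof (rule integral_dominated_convergence[where w = "\<lambda>_. 1"])
    have "(\<lambda>n. exp (- (\<bar>z\<bar> powr \<alpha> * (LINT x|lborel. norm (f n x) powr \<alpha>)))) \<longlonglongrightarrow> exp (- (\<bar>z\<bar> powr \<alpha> * 0))" for z
      by (intro tendsto_intros lim)
    then show "AE z in std_normal_distribution. (\<lambda>n. exp (- (\<bar>z\<bar> powr \<alpha> * (LINT x|lborel. norm (f n x) powr \<alpha>)))) \<longlonglongrightarrow> 1"
      by simp
    show "AE z in std_normal_distribution. norm (exp (- (\<bar>z\<bar> powr \<alpha> * (LINT x|lborel. norm (f n x) powr \<alpha>)))) \<le> 1" for n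
      by (intro AE_I2) (auto intro!: mult_nonneg_nonneg Bochner_Integration.integral_nonneg)
  qed auto
  moreover have "(LINT z|std_normal_distribution. 1) = (1 :: real)"
    using N.prob_space by simp
  ultimately have e: "e \<longlonglongrightarrow> 1" by (simp only:)
  define c where "c = 1 - exp (- \<epsilon>\<^sup>2 / 2)"
  have c: "0 < c" using \<epsilon> by (simp add: c_def)
  have bound: "prob {\<omega> \<in> space M. \<epsilon> < \<bar>Re (I (f n) \<omega>)\<bar>} \<le> (1 - e n) / c" for n
  proof -
    have [measurable]: "I (f n) \<in> borel_measurable M" by (intro integral_random_variable f)
    let ?A = "{\<omega> \<in> space M. \<epsilon> < \<bar>Re (I (f n) \<omega>)\<bar>}"
    have A: "?A \<in> events" by measurable
    have ie: "integrable M (\<lambda>\<omega>. exp (- (Re (I (f n) \<omega>))\<^sup>2 / 2))"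
      by (rule integrable_const_bound[where B = 1]) auto
    have "c * prob ?A = (LINT \<omega>|M. c * indicator ?A \<omega>)" using A by simp
    also have "\<dots> \<le> (LINT \<omega>|M. 1 - exp (- (Re (I (f n) \<omega>))\<^sup>2 / 2))"
    proof (rule integral_mono)
      show "integrable M (\<lambda>\<omega>. c * indicator ?A \<omega>)"
        using A by (intro integrable_mult_right integrable_real_indicator) (auto simp: emeasure_eq_measure)
      show "c * indicator ?A \<omega> \<le> 1 - exp (- (Re (I (f n) \<omega>))\<^sup>2 / 2)" for \<omega>
      proof (cases "\<omega> \<in> ?A")
        case True
        then have "\<epsilon>\<^sup>2 \<le> (Re (I (f n) \<omega>))\<^sup>2" using \<epsilon> by (auto simp flip: abs_le_square_iff)
        then show ?thesis using True by (simp add: c_def)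
      qed simp
    qed (use ie in auto)
    also have "\<dots> = 1 - e n"
      using ie expectation_gaussian[OF \<alpha> f[of n]] by (simp add: prob_space e_def)
    finally show ?thesis using c by (simp add: pos_le_divide_eq mult.commute)
  qed
  have "(\<lambda>n. (1 - e n) / c) \<longlonglongrightarrow> (1 - 1) / c" by (intro tendsto_intros e) (use c in simp)
  then have lim0: "(\<lambda>n. (1 - e n) / c) \<longlonglongrightarrow> 0" by simp
  show ?thesis
  proof (rule Lim_null_comparison[OF _ lim0])
    show "\<forall>\<^sub>F n in sequentially. norm (prob {\<omega> \<in> space M. \<epsilon> < \<bar>Re (I (f n) \<omega>)\<bar>}) \<le> (1 - e n) / c"
      using bound by (intro always_eventually allI) simp
  qed
qed

end

section \<open>Products over the coordinates\<close>

lemma borel_measurable_vec_nth' [measurable (raw)]: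
  "f \<in> borel_measurable M \<Longrightarrow> (\<lambda>x. (f x :: real ^ 'n) $ i) \<in> borel_measurable M"
  by (rule borel_measurable_continuous_on[of "\<lambda>x. x $ i"]) (auto intro!: continuous_intros)

lemma prod_Basis_vec: "(\<Prod>b\<in>(Basis :: (real ^ 'n) set). F b) = (\<Prod>i\<in>UNIV. F (axis i 1))"
proof -
  have 1: "(Basis :: (real ^ 'n) set) = range (\<lambda>i. axis i 1)" by (auto simp: Basis_vec_def)
  have 2: "inj (\<lambda>i :: 'n. axis i (1 :: real))" by (auto simp: inj_def axis_eq_axis)
  show ?thesis unfolding 1 prod.reindex[OF 2] o_def ..
qed

lemma nn_integral_prod_vec:
  fixes h :: "'n::finite \<Rightarrow> real \<Rightarrow> ennreal"
  assumes h: "\<And>i. h i \<in> borel_measurable borel"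
  shows "(\<integral>\<^sup>+x. (\<Prod>i\<in>UNIV. h i (x $ i)) \<partial>(lborel :: (real ^ 'n) measure)) = (\<Prod>i\<in>UNIV. \<integral>\<^sup>+y. h i y \<partial>lborel)"
proof -
  \<comment> \<open>\<open>nn_integral_lborel_prod\<close> indexes the factors by basis vectors; f
    recovers the coordinate from the vector.\<close>
  define f where "f b = h (THE i. b = axis i (1 :: real))" for b :: "real ^ 'n"
  have f: "f (axis i 1) = h i" for i
  proof -
    have "(THE i'. axis i (1 :: real) = axis i' 1) = i" by (auto simp: axis_eq_axis)
    then show ?thesis by (simp add: f_def)
  qed
  have "(\<integral>\<^sup>+x. (\<Prod>b\<in>Basis. f b (x \<bullet> b)) \<partial>(lborel :: (real ^ 'n) measure)) = (\<Prod>b\<in>(Basis :: (real ^ 'n) set). \<integral>\<^sup>+y. f b y \<partial>lborel)"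
    by (rule nn_integral_lborel_prod) (auto simp: f_def h)
  then show ?thesis unfolding prod_Basis_vec by (simp add: f inner_axis)
qed

lemma integrable_prod_vec:
  fixes h :: "'n::finite \<Rightarrow> real \<Rightarrow> real"
  assumes h: "\<And>i. integrable lborel (h i)" and nonneg: "\<And>i x. 0 \<le> h i x"
  shows "integrable lborel (\<lambda>x :: real ^ 'n. \<Prod>i\<in>UNIV. h i (x $ i))"
proof (rule integrableI_nonneg)
  have [measurable]: "h i \<in> borel_measurable borel" for i using h[of i] by auto
  show "(\<lambda>x :: real ^ 'n. \<Prod>i\<in>UNIV. h i (x $ i)) \<in> borel_measurable lborel" by measurable
  show "AE x in lborel. 0 \<le> (\<Prod>i\<in>UNIV. h i ((x :: real ^ 'n) $ i))"
    using nonneg by (intro AE_I2 prod_nonneg) auto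
  have "(\<integral>\<^sup>+x. ennreal (\<Prod>i\<in>UNIV. h i (x $ i)) \<partial>(lborel :: (real ^ 'n) measure))
      = (\<integral>\<^sup>+x. (\<Prod>i\<in>UNIV. ennreal (h i (x $ i))) \<partial>(lborel :: (real ^ 'n) measure))"
    using nonneg by (simp add: prod_ennreal)
  also have "\<dots> = (\<Prod>i\<in>UNIV. \<integral>\<^sup>+y. ennreal (h i y) \<partial>lborel)"
    by (rule nn_integral_prod_vec) measurable
  also have "\<dots> = (\<Prod>i\<in>UNIV. ennreal (LINT y|lborel. h i y))"
    using nn_integral_eq_integral[OF h] nonneg by simp
  also have "\<dots> = ennreal (\<Prod>i\<in>UNIV. LINT y|lborel. h i y)"
    using nonneg by (intro prod_ennreal Bochner_Integration.integral_nonneg) auto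
  also have "\<dots> < \<infinity>" by simp
  finally show "(\<integral>\<^sup>+x. ennreal (\<Prod>i\<in>UNIV. h i (x $ i)) \<partial>(lborel :: (real ^ 'n) measure)) < \<infinity>" .
qed

lemma AE_lborel_vec_nth:
  assumes "\<And>i. AE y in lborel. P i y"
  shows "AE x in (lborel :: (real ^ 'n) measure). \<forall>i. P i (x $ i)"
proof -
  have "AE x in (lborel :: (real ^ 'n) measure). P i (x $ i)" for i
  proof -
    obtain N where N: "{y \<in> space lborel. \<not> P i y} \<subseteq> N" "emeasure lborel N = 0" "N \<in> sets lborel"
      using assms[of i] by (rule AE_E)
    have [measurable]: "N \<in> sets borel" using N by simp
    let ?N = "{x :: real ^ 'n. x $ i \<in> N}"
    have "emeasure lborel ?N = (\<integral>\<^sup>+x. indicator ?N x \<partial>lborel)"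
      by (rule nn_integral_indicator[symmetric]) measurable
    also have "\<dots> = (\<integral>\<^sup>+x. (\<Prod>i'\<in>UNIV. if i' = i then indicator N (x $ i') else 1) \<partial>(lborel :: (real ^ 'n) measure))"
      by (intro nn_integral_cong) (simp add: prod.delta indicator_def)
    also have "\<dots> = (\<Prod>i'\<in>UNIV. \<integral>\<^sup>+y. (if i' = i then indicator N y else 1) \<partial>lborel)"
      by (rule nn_integral_prod_vec) auto
    \<comment> \<open>The factors of the other coordinates are infinite, but 0 times infinity is 0
      in \<open>ennreal\<close>.\<close>
    also have "\<dots> = 0"
      using N by (intro prod_zero bexI[of _ i]) auto
    finally have "?N \<in> null_sets lborel" by (intro null_setsI) measurable
    then show ?thesis by (rule AE_I') (use N in auto)
  qed
  then show ?thesis unfolding AE_all_countable by (rule allI)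
qed

text \<open>G lies in the finite box spanned by its coordinate projections, and over a box the sum
  of products factorises.\<close>

lemma sum_prod_le_prod:
  fixes f :: "'n::finite \<Rightarrow> 'i \<Rightarrow> real"
  assumes f: "\<And>l i. 0 \<le> f l i" and B: "\<And>l F. finite F \<Longrightarrow> (\<Sum>i\<in>F. f l i) \<le> B l" and G: "finite G"
  shows "(\<Sum>g\<in>G. \<Prod>l\<in>UNIV. f l (g l)) \<le> (\<Prod>l\<in>UNIV. B l)"
proof -
  define P where "P l = (\<lambda>g. g l) ` G" for l
  have P: "finite (P l)" for l using G by (simp add: P_def)
  have "G \<subseteq> PiE UNIV P" by (auto simp: P_def)
  then have "(\<Sum>g\<in>G. \<Prod>l\<in>UNIV. f l (g l)) \<le> (\<Sum>g\<in>PiE UNIV P. \<Prod>l\<in>UNIV. f l (g l))"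
    using P by (intro sum_mono2 finite_PiE prod_nonneg) (auto simp: f)
  also have "\<dots> = (\<Prod>l\<in>UNIV. \<Sum>i\<in>P l. f l i)"
    using P by (intro prod_sum_PiE[symmetric]) auto
  also have "\<dots> \<le> (\<Prod>l\<in>UNIV. B l)"
    using P by (intro prod_mono conjI sum_nonneg B f) auto
  finally show ?thesis .
qed

lemma bij_vec_pairs:
  "bij (\<lambda>(J :: 'a ^ 'n, K :: 'b ^ 'n) l. (J $ l, K $ l))"
  by (rule bij_betw_byWitness[where f' = "\<lambda>g. (\<chi> l. fst (g l), \<chi> l. snd (g l))"]) (auto simp: fun_eq_iff)

text \<open>Absolute convergence in each coordinate allows the product of the series to be
  multiplied out. The second claim bounds every finite partial sum independently of D and so
  supplies the majorant for dominated convergence.\<close>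

lemma prod_expansion_vec:
  fixes f :: "'n::finite \<Rightarrow> 'a \<times> 'b \<Rightarrow> complex"
  assumes s: "\<And>l. (f l has_sum s l) UNIV" and B: "\<And>l F. finite F \<Longrightarrow> (\<Sum>i\<in>F. norm (f l i)) \<le> B l"
  shows "((\<lambda>(J :: 'a ^ 'n, K :: 'b ^ 'n). \<Prod>l\<in>UNIV. f l (J $ l, K $ l)) has_sum (\<Prod>l\<in>UNIV. s l)) UNIV"
    and "finite D \<Longrightarrow> norm (\<Sum>(J :: 'a ^ 'n, K :: 'b ^ 'n)\<in>D. \<Prod>l\<in>UNIV. f l (J $ l, K $ l)) \<le> (\<Prod>l\<in>UNIV. B l)"
proof -
  let ?p = "\<lambda>(J :: 'a ^ 'n, K :: 'b ^ 'n) l. (J $ l, K $ l)"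
  have bound: "(\<Sum>g\<in>G. norm (\<Prod>l\<in>UNIV. f l (g l))) \<le> (\<Prod>l\<in>UNIV. B l)" if "finite G" for G
    unfolding prod_norm[symmetric] by (rule sum_prod_le_prod) (use B that in auto)
  have 1: "(\<lambda>g. norm (\<Prod>l\<in>UNIV. f l (g l))) summable_on UNIV"
    using bound by (intro nonneg_bdd_above_summable_on) (auto intro!: bdd_aboveI2)
  have 2: "(\<lambda>i. norm (f l i)) summable_on UNIV" for l
    using B by (intro nonneg_bdd_above_summable_on) (auto intro!: bdd_aboveI2)
  have "infsum (\<lambda>g. \<Prod>l\<in>UNIV. f l (g l)) (PiE UNIV (\<lambda>_. UNIV)) = (\<Prod>l\<in>UNIV. infsum (f l) UNIV)"
    by (rule infsum_prod_PiE_abs) (auto simp: 2)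
  then have "infsum (\<lambda>g. \<Prod>l\<in>UNIV. f l (g l)) UNIV = (\<Prod>l\<in>UNIV. s l)"
    using infsumI[OF s] by simp
  then have "((\<lambda>g. \<Prod>l\<in>UNIV. f l (g l)) has_sum (\<Prod>l\<in>UNIV. s l)) UNIV"
    using has_sum_infsum[OF abs_summable_summable[OF 1]] by simp
  then have "((\<lambda>JK. \<Prod>l\<in>UNIV. f l (?p JK l)) has_sum (\<Prod>l\<in>UNIV. s l)) UNIV"
    by (subst has_sum_reindex_bij_betw[OF bij_vec_pairs])
  then show "((\<lambda>(J :: 'a ^ 'n, K :: 'b ^ 'n). \<Prod>l\<in>UNIV. f l (J $ l, K $ l)) has_sum (\<Prod>l\<in>UNIV. s l)) UNIV"
    by (simp add: case_prod_unfold)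
  assume D: "finite D"
  have "norm (\<Sum>JK\<in>D. \<Prod>l\<in>UNIV. f l (?p JK l)) \<le> (\<Sum>JK\<in>D. norm (\<Prod>l\<in>UNIV. f l (?p JK l)))"
    by (rule norm_sum)
  also have "\<dots> = (\<Sum>g\<in>?p ` D. norm (\<Prod>l\<in>UNIV. f l (g l)))"
    by (subst sum.reindex) (auto intro: inj_on_subset[OF bij_is_inj[OF bij_vec_pairs]])
  also have "\<dots> \<le> (\<Prod>l\<in>UNIV. B l)" using D by (intro bound) auto
  finally show "norm (\<Sum>(J :: 'a ^ 'n, K :: 'b ^ 'n)\<in>D. \<Prod>l\<in>UNIV. f l (J $ l, K $ l)) \<le> (\<Prod>l\<in>UNIV. B l)"
    by (simp add: case_prod_unfold)
qed

section \<open>Convergence of the multivariate expansion in \<open>Lspace \<alpha>\<close>\<close>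

context meyer_wavelet
begin

lemma psi_hat_powr_integrable:
  assumes "0 < p"
  shows "integrable lborel (\<lambda>x. norm (psi_hat \<psi> \<alpha> j k x) powr p)"
proof -
  let ?R = "2 powi j * (8 * pi / 3)"
  obtain B where B: "\<And>x. norm (psi_hat \<psi> \<alpha> j k x) \<le> B"
    using bounded_continuous_compact_support[OF psi_hat_continuous psi_hat_compact_support] by blast
  have [measurable]: "psi_hat \<psi> \<alpha> j k \<in> borel_measurable borel"
    by (rule borel_measurable_continuous_onI) (rule psi_hat_continuous)
  show ?thesis
  proof (rule Bochner_Integration.integrable_bound)
    show "integrable lborel (\<lambda>x. indicator {- ?R..?R} x * B powr p)"
      by (intro integrable_mult_left integrable_real_indicator) auto
    have "norm (psi_hat \<psi> \<alpha> j k x) powr p \<le> indicator {- ?R..?R} x * B powr p" for x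
    proof (cases "\<bar>x\<bar> > ?R")
      case False
      then show ?thesis using B assms by (auto simp: indicator_def abs_le_iff not_less intro!: powr_mono2)
    qed (simp add: psi_hat_compact_support)
    then show "AE x in lborel. norm (norm (psi_hat \<psi> \<alpha> j k x) powr p) \<le> norm (indicator {- ?R..?R} x * B powr p)"
      by (intro AE_I2) (auto intro: order_trans[OF _ abs_ge_self])
  qed measurable
qed

lemma cnj_Psi_hat_Lspace:
  assumes "0 < p"
  shows "(\<lambda>x :: real ^ 'n. cnj (Psi_hat \<psi> \<alpha> J K x)) \<in> Lspace p"
proof -
  have [measurable]: "psi_hat \<psi> \<alpha> j k \<in> borel_measurable borel" for j k
    by (rule borel_measurable_continuous_onI) (rule psi_hat_continuous)
  have "norm (cnj (Psi_hat \<psi> \<alpha> J K x)) powr p = (\<Prod>l\<in>UNIV. norm (psi_hat \<psi> \<alpha> (J $ l) (K $ l) (x $ l)) powr p)" for x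
    unfolding Psi_hat_def complex_mod_cnj prod_norm[symmetric] by (rule prod_powr_distrib)
  then show ?thesis
    unfolding Lspace_def mem_Collect_eq
    by (auto simp: Psi_hat_def intro!: integrable_prod_vec psi_hat_powr_integrable assms)
qed

lemma wterm_prod_eq:
  fixes H t x :: "real ^ 'n"
  shows "(\<Prod>l\<in>UNIV. wterm \<alpha> (H $ l) (t $ l) (J $ l, K $ l) (x $ l))
    = of_real (2 powr (- (\<Sum>l\<in>UNIV. of_int (J $ l) * H $ l))) *
      (\<Prod>l\<in>UNIV. (psi_frac \<psi> \<alpha> (H $ l) (2 powi (J $ l) * t $ l - of_int (K $ l)) -
                   psi_frac \<psi> \<alpha> (H $ l) (- of_int (K $ l)))) * cnj (Psi_hat \<psi> \<alpha> J K x)"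
proof -
  have "2 powr (- (\<Sum>l\<in>UNIV. of_int (J $ l) * H $ l)) = (\<Prod>l\<in>UNIV. 2 powr (- (of_int (J $ l) * H $ l)) :: real)"
    unfolding sum_negf[symmetric] by (rule powr_sum) auto
  then show ?thesis
    by (simp only: wterm.simps wcoef.simps prod.distrib Psi_hat_def cnj_prod of_real_prod)
qed

lemma harmonizable_kernel_prod_Lp_limit:
  fixes H t :: "real ^ 'n" and D :: "nat \<Rightarrow> ((int ^ 'n) \<times> (int ^ 'n)) set"
  assumes \<alpha>: "0 < \<alpha>" and H: "\<And>l. 0 < H $ l \<and> H $ l < 1"
    and D: "\<And>n. finite (D n)" "\<And>n. D n \<subseteq> D (Suc n)" "(\<Union>n. D n) = UNIV"
  defines "F \<equiv> \<lambda>x :: real ^ 'n. \<Prod>l\<in>UNIV. harmonizable_kernel \<alpha> (H $ l) (t $ l) (x $ l)"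
    and "S \<equiv> \<lambda>n (x :: real ^ 'n). \<Sum>(J, K)\<in>D n. \<Prod>l\<in>UNIV. wterm \<alpha> (H $ l) (t $ l) (J $ l, K $ l) (x $ l)"
  shows "F \<in> Lspace \<alpha>" and "\<And>n. S n \<in> Lspace \<alpha>"
    and "(\<lambda>n. LINT x|lborel. norm (S n x - F x) powr \<alpha>) \<longlonglongrightarrow> 0"
proof -
  have "\<exists>C\<ge>0. \<forall>x G. finite G \<longrightarrow> (\<Sum>i\<in>G. norm (wterm \<alpha> (H $ l) (t $ l) i x))
      \<le> C * (\<bar>x\<bar> powr (- (H $ l + 1 / \<alpha>)) * min 1 \<bar>x\<bar>)" for l
    using H[of l] \<alpha> by (intro wterm_sum_bound) auto
  then obtain C where C: "\<And>l. C l \<ge> 0" "\<And>l x G. finite G \<Longrightarrow>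
      (\<Sum>i\<in>G. norm (wterm \<alpha> (H $ l) (t $ l) i x)) \<le> C l * (\<bar>x\<bar> powr (- (H $ l + 1 / \<alpha>)) * min 1 \<bar>x\<bar>)"
    by metis
  define B where "B l x = C l * (\<bar>x\<bar> powr (- (H $ l + 1 / \<alpha>)) * min 1 \<bar>x\<bar>)" for l x
  have B0: "0 \<le> B l x" for l x using C(1) by (simp add: B_def)
  have CB: "(\<Sum>i\<in>G. norm (wterm \<alpha> (H $ l) (t $ l) i x)) \<le> B l x" if "finite G" for l x G
    using C(2)[OF that] by (simp only: B_def)
  define W where "W x = (\<Prod>l\<in>UNIV. B l (x $ l))" for x :: "real ^ 'n"
  have W0: "0 \<le> W x" for x unfolding W_def by (intro prod_nonneg) (simp add: B0)
  have Wint: "integrable lborel (\<lambda>x. W x powr \<alpha>)"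
  proof -
    have "W x powr \<alpha> = (\<Prod>l\<in>UNIV. B l (x $ l) powr \<alpha>)" for x
      unfolding W_def by (rule prod_powr_distrib)
    moreover have "integrable lborel (\<lambda>x. B l x powr \<alpha>)" for l
    proof -
      have "B l x powr \<alpha> = C l powr \<alpha> * (\<bar>x\<bar> powr (- (H $ l + 1 / \<alpha>)) * min 1 \<bar>x\<bar>) powr \<alpha>" for x
        unfolding B_def by (rule powr_mult)
      then show ?thesis using integrable_kernel_bound[of "H $ l" \<alpha>] H[of l] \<alpha> by (simp only: integrable_mult_right)
    qed
    ultimately show ?thesis by (simp only:) (intro integrable_prod_vec, auto)
  qed
  have psm [measurable]: "psi_hat \<psi> \<alpha> j k \<in> borel_measurable borel" for j k
    by (rule borel_measurable_continuous_onI) (rule psi_hat_continuous)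
  have Fm [measurable]: "F \<in> borel_measurable borel"
    unfolding F_def harmonizable_kernel_def by measurable
  show S: "S n \<in> Lspace \<alpha>" for n
  proof -
    have "(\<lambda>x. \<Sum>i\<in>D n. (case i of (J, K) \<Rightarrow> of_real (2 powr (- (\<Sum>l\<in>UNIV. of_int (J $ l) * H $ l))) *
      (\<Prod>l\<in>UNIV. (psi_frac \<psi> \<alpha> (H $ l) (2 powi (J $ l) * t $ l - of_int (K $ l)) -
                   psi_frac \<psi> \<alpha> (H $ l) (- of_int (K $ l))))) * (case i of (J, K) \<Rightarrow> (\<lambda>x. cnj (Psi_hat \<psi> \<alpha> J K x))) x) \<in> Lspace \<alpha>"
      by (intro Lspace_sum \<alpha> D) (auto split: prod.splits intro!: cnj_Psi_hat_Lspace \<alpha>)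
    then show ?thesis unfolding S_def wterm_prod_eq by (simp only: case_prod_unfold)
  qed
  then have Sm [measurable]: "S n \<in> borel_measurable borel" for n by (auto simp: Lspace_def)
  have Sbound: "norm (S n x) \<le> W x" for n x
    unfolding S_def W_def by (rule prod_expansion_vec(2)[OF _ CB D(1)])
      (rule has_sum_infsum, rule abs_summable_summable, rule wterm_abs_summable, use H \<alpha> in auto)
  have "AE x in (lborel :: (real ^ 'n) measure). \<forall>l. ((\<lambda>i. wterm \<alpha> (H $ l) (t $ l) i (x $ l)) has_sum harmonizable_kernel \<alpha> (H $ l) (t $ l) (x $ l)) UNIV"
    using H by (intro AE_lborel_vec_nth harmonizable_kernel_expansion \<alpha>) auto
  then have lim: "AE x in lborel. (\<lambda>n. S n x) \<longlonglongrightarrow> F x"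
  proof eventually_elim
    case (elim x)
    have "((\<lambda>(J :: int ^ 'n, K :: int ^ 'n). \<Prod>l\<in>UNIV. wterm \<alpha> (H $ l) (t $ l) (J $ l, K $ l) (x $ l)) has_sum F x) UNIV"
      unfolding F_def by (rule prod_expansion_vec(1)[OF _ CB]) (use elim in auto)
    then show ?case
      unfolding has_sum_def S_def by (rule filterlim_compose[OF _ exhausting_filterlim[OF D]])
  qed
  \<comment> \<open>The bound on the partial sums passes to their limit, so membership of F in
    \<open>Lspace \<alpha>\<close> needs no separate estimate of the kernel.\<close>
  then have Fbound: "AE x in lborel. norm (F x) \<le> W x"
  proof eventually_elim
    case (elim x)
    then show ?case
      using Sbound by (intro LIMSEQ_le_const2[OF tendsto_norm]) auto
  qed
  show "F \<in> Lspace \<alpha>"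
  proof -
    have "integrable lborel (\<lambda>x. norm (F x) powr \<alpha>)"
    proof (rule Bochner_Integration.integrable_bound[OF Wint])
      show "AE x in lborel. norm (norm (F x) powr \<alpha>) \<le> norm (W x powr \<alpha>)"
        using Fbound by eventually_elim (use \<alpha> in \<open>auto intro: powr_mono2\<close>)
    qed measurable
    then show ?thesis using Fm by (simp add: Lspace_def)
  qed
  have "(\<lambda>n. LINT x|lborel. norm (S n x - F x) powr \<alpha>) \<longlonglongrightarrow> (LINT x|(lborel :: (real ^ 'n) measure). 0)"
  proof (rule integral_dominated_convergence[where w = "\<lambda>x. 2 powr \<alpha> * W x powr \<alpha>"])
    show "integrable lborel (\<lambda>x. 2 powr \<alpha> * W x powr \<alpha>)" using Wint by simp
    show "AE x in lborel. (\<lambda>n. norm (S n x - F x) powr \<alpha>) \<longlonglongrightarrow> 0"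
      using lim
    proof eventually_elim
      case (elim x)
      then have "(\<lambda>n. norm (S n x - F x)) \<longlonglongrightarrow> 0" by (intro tendsto_norm_zero) (simp add: LIM_zero_iff)
      then show ?case by (rule tendsto_zero_powrI[OF _ tendsto_const]) (use \<alpha> in auto)
    qed
    show "AE x in lborel. norm (norm (S n x - F x) powr \<alpha>) \<le> 2 powr \<alpha> * W x powr \<alpha>" for n
      using Fbound
    proof eventually_elim
      case (elim x)
      have "norm (S n x - F x) \<le> 2 * W x"
        using norm_triangle_ineq4[of "S n x" "F x"] Sbound[of n x] elim by linarith
      then have "norm (S n x - F x) powr \<alpha> \<le> (2 * W x) powr \<alpha>" using \<alpha> by (intro powr_mono2) auto
      also have "\<dots> = 2 powr \<alpha> * W x powr \<alpha>" by (rule powr_mult)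
      finally show ?case by simp
    qed
  qed measurable
  then show "(\<lambda>n. LINT x|lborel. norm (S n x - F x) powr \<alpha>) \<longlonglongrightarrow> 0" by simp
qed

end

section \<open>From \<alpha>-integrals to convergence in probability\<close>

theorem proposition2p1:
  fixes M :: "'w measure"
    and \<alpha> :: real
    and I :: "(real ^ 'n \<Rightarrow> complex) \<Rightarrow> 'w \<Rightarrow> complex"
    and H :: "real ^ 'n"
    and \<psi> :: "real \<Rightarrow> real"
    and D :: "nat \<Rightarrow> ((int ^ 'n) \<times> (int ^ 'n)) set"
  assumes "0 < \<alpha>" and "\<alpha> < 2"
    and "\<And>l. 0 < H $ l \<and> H $ l < 1"
    and "rot_inv_stable_random_measure M \<alpha> I"
    and "lemarie_meyer_wavelet \<psi>"
    and "\<And>n. finite (D n)"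
    and "\<And>n. D n \<subseteq> D (Suc n)"
    and "(\<Union>n. D n) = UNIV"
  shows "\<forall>t. converges_in_probability M
           (\<lambda>n. wavelet_partial_sum I \<psi> \<alpha> H (D n) t) (harmonizable_sheet I \<alpha> H t)"
proof
  fix t :: "real ^ 'n"
  interpret rot_inv_stable_random_measure M \<alpha> I by fact
  interpret meyer_wavelet \<psi> by standard fact
  define F where "F = (\<lambda>x :: real ^ 'n. \<Prod>l\<in>UNIV. harmonizable_kernel \<alpha> (H $ l) (t $ l) (x $ l))"
  define S where "S = (\<lambda>n (x :: real ^ 'n). \<Sum>(J, K)\<in>D n. \<Prod>l\<in>UNIV. wterm \<alpha> (H $ l) (t $ l) (J $ l, K $ l) (x $ l))"
  note limit = harmonizable_kernel_prod_Lp_limit[OF assms(1,3,6-8)]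
  have F: "F \<in> Lspace \<alpha>" unfolding F_def by (rule limit(1))
  have S: "S n \<in> Lspace \<alpha>" for n unfolding S_def by (rule limit(2))
  have lim: "(\<lambda>n. LINT x|lborel. norm (S n x - F x) powr \<alpha>) \<longlonglongrightarrow> 0"
    unfolding S_def F_def by (rule limit(3))
  define f where "f n x = 1 * S n x + (- 1) * F x" for n x
  have f: "f n \<in> Lspace \<alpha>" for n
    unfolding f_def by (rule Lspace_linear_combination[OF assms(1) S F])
  have sheet: "harmonizable_sheet I \<alpha> H t \<omega> = Re (I F \<omega>)" for \<omega>
    by (simp add: harmonizable_sheet_def F_def harmonizable_kernel_def)
  define c where "c = (\<lambda>(J :: int ^ 'n, K :: int ^ 'n). complex_of_real (2 powr (- (\<Sum>l\<in>UNIV. of_int (J $ l) * H $ l))) *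
      (\<Prod>l\<in>UNIV. (psi_frac \<psi> \<alpha> (H $ l) (2 powi (J $ l) * t $ l - of_int (K $ l)) -
                   psi_frac \<psi> \<alpha> (H $ l) (- of_int (K $ l)))))"
  define e where "e = (\<lambda>(J, K) (x :: real ^ 'n). cnj (Psi_hat \<psi> \<alpha> J K x))"
  have e: "e i \<in> Lspace \<alpha>" for i
    by (cases i) (simp add: e_def cnj_Psi_hat_Lspace assms(1))
  have Sce: "S n = (\<lambda>x. \<Sum>i\<in>D n. c i * e i x)" for n
    unfolding S_def wterm_prod_eq c_def e_def by (simp only: case_prod_unfold)
  have wps: "wavelet_partial_sum I \<psi> \<alpha> H (D n) t \<omega> = Re (\<Sum>i\<in>D n. c i * I (e i) \<omega>)" for n \<omega>
    unfolding wavelet_partial_sum_def wavelet_coeff_def c_def e_def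
    by (simp only: case_prod_unfold mult_ac)
  \<comment> \<open>The exceptional set may change with n: convergence in probability compares only
    probabilities, one n at a time.\<close>
  have AE: "AE \<omega> in M. wavelet_partial_sum I \<psi> \<alpha> H (D n) t \<omega> - harmonizable_sheet I \<alpha> H t \<omega> = Re (I (f n) \<omega>)" for n
  proof -
    have "AE \<omega> in M. I (S n) \<omega> = (\<Sum>i\<in>D n. c i * I (e i) \<omega>)"
      unfolding Sce by (rule integral_sum[OF assms(1,6) e])
    moreover have "AE \<omega> in M. I (f n) \<omega> = 1 * I (S n) \<omega> + (- 1) * I F \<omega>"
      unfolding f_def by (rule integral_linear[OF S F])
    ultimately show ?thesis
      by eventually_elim (simp add: wps sheet)
  qed
  have [measurable]: "I F \<in> borel_measurable M" "I (e i) \<in> borel_measurable M" "I (f n) \<in> borel_measurable M" for i n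
    by (intro integral_random_variable F e f)+
  show "converges_in_probability M (\<lambda>n. wavelet_partial_sum I \<psi> \<alpha> H (D n) t) (harmonizable_sheet I \<alpha> H t)"
    unfolding converges_in_probability_def
  proof (intro allI impI)
    fix \<epsilon> :: real assume "0 < \<epsilon>"
    have "(\<lambda>n. prob {\<omega> \<in> space M. \<epsilon> < \<bar>Re (I (f n) \<omega>)\<bar>}) \<longlonglongrightarrow> 0"
      by (rule prob_Re_integral_tendsto_0[OF assms(1) f _ \<open>0 < \<epsilon>\<close>]) (use lim in \<open>simp add: f_def\<close>)
    moreover have "prob {\<omega> \<in> space M. \<epsilon> < \<bar>wavelet_partial_sum I \<psi> \<alpha> H (D n) t \<omega> - harmonizable_sheet I \<alpha> H t \<omega>\<bar>}
        = prob {\<omega> \<in> space M. \<epsilon> < \<bar>Re (I (f n) \<omega>)\<bar>}" for n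
    proof (rule finite_measure_eq_AE)
      show "AE \<omega> in M. (\<omega> \<in> {\<omega> \<in> space M. \<epsilon> < \<bar>wavelet_partial_sum I \<psi> \<alpha> H (D n) t \<omega> - harmonizable_sheet I \<alpha> H t \<omega>\<bar>})
          = (\<omega> \<in> {\<omega> \<in> space M. \<epsilon> < \<bar>Re (I (f n) \<omega>)\<bar>})"
        using AE[of n] by eventually_elim simp
    qed (unfold wps sheet, measurable)
    ultimately show "(\<lambda>n. prob {\<omega> \<in> space M. \<epsilon> < \<bar>wavelet_partial_sum I \<psi> \<alpha> H (D n) t \<omega> - harmonizable_sheet I \<alpha> H t \<omega>\<bar>}) \<longlonglongrightarrow> 0"
      by simp
  qed
qed

end
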